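(* Let $n\ge 2$, let $D$ be a domain in $\overline{\mathbb R^n}=\mathbb R^n\cup\{\infty\}$, and let $\Phi:[0,\infty]\to[0,\infty]$ be a non-decreasing convex function. If $$\int_{\delta_0}^{\infty}\frac{d\tau}{\tau\,[\Phi^{-1}(\tau)]^{\frac1{n-1}}}=\infty$$ for some $\delta_0>\tau_0:=\Phi(0)$, then for every $M\in(0,\infty)$ and every $\Delta\in(0,1)$ the class $\mathfrak R^{\Phi}_{M,\Delta}$ is equicontinuous and, consequently, forms a normal family of mappings.
   Context: Notation: $dm$ is Lebesgue measure. $\overline{\mathbb R^n}$ carries the spherical (chordal) metric $h(x,y)=\frac{|x-y|}{\sqrt{1+|x|^2}\sqrt{1+|y|^2}}$ for $x,y\neq\infty$, $h(x,\infty)=\frac1{\sqrt{1+|x|^2}}$; for a set $E$, $h(E)=\sup_{x_1,x_2\in E}h(x_1,x_2)$. $\Phi$ is convex on $[0,\infty]$ if $\Phi(\lambda t_1+(1-\lambda)t_2)\le\lambda\Phi(t_1)+(1-\lambda)\Phi(t_2)$ for all $t_1,t_2\in[0,\infty]$, $\lambda\in[0,1]$. For non-decreasing $\Phi$, $\Phi^{-1}(\tau)=\inf\{t\in[0,\infty]:\Phi(t)\ge\tau\}$, with $\inf\emptyset=\infty$; $1/\infty=0$, $1/0=\infty$. Modulus: for a family $\Gamma$ of curves, $M(\Gamma)=\inf\int_{\mathbb R^n}\rho^n\,dm$, the infimum over Borel $\rho:\mathbb R^n\to[0,\infty]$ with $\int_\gamma\rho\,|dx|\ge1$ for all $\gamma\in\Gamma$.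 $\Gamma(E,F,G)$ is the family of all curves $\gamma:[a,b]\to\overline{\mathbb R^n}$ with $\gamma(a)\in E$, $\gamma(b)\in F$, $\gamma(t)\in G$ for $t\in(a,b)$. Ring $Q$-homeomorphism: let $Q:D\to[0,\infty]$ be measurable. A homeomorphism (onto its image) $f:D\to\overline{\mathbb R^n}$ is a ring $Q$-homeomorphism at a finite point $x_0\in D$ if $$M\big(f(\Gamma(S_1,S_2,R))\big)\le\int_R Q(x)\,\eta^n(|x-x_0|)\,dm(x)$$ for every ring $R=\{r_1<|x-x_0|<r_2\}$ with boundary spheres $S_i=\{|x-x_0|=r_i\}$, $0<r_1<r_2<\mathrm{dist}(x_0,\partial D)$ (Euclidean distance to the finite boundary points, $\infty$ if there are none), and every measurable $\eta:(r_1,r_2)\to[0,\infty]$ with $\int_{r_1}^{r_2}\eta(r)\,dr\ge1$. If $\infty\in D$, $f$ is a ring $Q$-homeomorphism at $\infty$ if $\widetilde f(x)=f(x/|x|^2)$ (with $0\mapsto f(\infty)$) is a ring $Q'$-homeomorphism at $0$ with $Q'(x)=Q(x/|x|^2)$. $f$ is a ring $Q$-homeomorphism in $D$ if it is one at every point of $D$. Class $\mathfrak R^{\Phi}_{M,\Delta}$: all homeomorphisms $f:D\to\overline{\mathbb R^n}$ with $h(\overline{\mathbb R^n}\setminus f(D))\ge\Delta$ that are ring $Q$-homeomorphisms in $D$ for some measurable $Q:D\to[0,\infty]$ (which may depend on $f$) satisfying $$\int_D\Phi(Q(x))\,\frac{dm(x)}{(1+|x|^2)^n}\le M.$$ A family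 $\mathfrak F$ of mappings $D\to\overline{\mathbb R^n}$ is equicontinuous if at every $x_0\in D$: for every $\varepsilon>0$ there is a neighbourhood $U$ of $x_0$ in $D$ with $h(f(x),f(x_0))<\varepsilon$ for all $x\in U$, $f\in\mathfrak F$. A family of continuous mappings is normal if every sequence in it has a subsequence converging, uniformly (w.r.t. $h$) on each compact subset of $D$, to a continuous mapping $D\to\overline{\mathbb R^n}$. *)

theory Defs
  imports "HOL-Analysis.Analysis"
begin

section \<open>The extended space with the chordal metric\<close>

text \<open>The constructor \<open>Some\<close> embeds \<open>real ^ 'n\<close>; the added point at infinity is \<open>None\<close>.\<close>

type_synonym 'n ext_space = "(real ^ 'n) option"

fun chordal :: "'n::finite ext_space \<Rightarrow> 'n ext_space \<Rightarrow> real" where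
  "chordal (Some x) (Some y) = norm (x - y) / (sqrt (1 + (norm x)\<^sup>2) * sqrt (1 + (norm y)\<^sup>2))"
| "chordal (Some x) None = 1 / sqrt (1 + (norm x)\<^sup>2)"
| "chordal None (Some y) = 1 / sqrt (1 + (norm y)\<^sup>2)"
| "chordal None None = 0"

text \<open>The triangle inequality holds because the chordal distance is the Euclidean distance after
  stereographic projection to the sphere of radius \<open>1/2\<close> about \<open>(0, 1/2)\<close>.\<close>

definition stereo :: "'n::finite ext_space \<Rightarrow> (real ^ 'n) \<times> real" where
  "stereo p = (case p of None \<Rightarrow> (0, 1)
     | Some x \<Rightarrow> (x /\<^sub>R (1 + (norm x)\<^sup>2), 1 - 1 / (1 + (norm x)\<^sup>2)))"

lemma stereo_aux:
  fixes x y :: "real ^ 'n::finite"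
  defines "a \<equiv> 1 + (norm x)\<^sup>2" and "b \<equiv> 1 + (norm y)\<^sup>2"
  shows "(norm (x /\<^sub>R a - y /\<^sub>R b))\<^sup>2 + (1 / b - 1 / a)\<^sup>2 = (norm (x - y))\<^sup>2 / (a * b)"
proof -
  have pos: "a > 0" "b > 0"
    by (auto simp: a_def b_def add_pos_nonneg)
  have xx: "x \<bullet> x = a - 1" and yy: "y \<bullet> y = b - 1"
    by (simp_all add: a_def b_def power2_norm_eq_inner)
  have "(norm (x /\<^sub>R a - y /\<^sub>R b))\<^sup>2
      = (x \<bullet> x) / a\<^sup>2 - 2 * (x \<bullet> y) / (a * b) + (y \<bullet> y) / b\<^sup>2"
    unfolding power2_norm_eq_inner using pos
    by (simp add: inner_diff_left inner_diff_right inner_commute[of y x] power2_eq_square)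
       (simp add: field_simps)
  moreover have "(norm (x - y))\<^sup>2 = a - 1 - 2 * (x \<bullet> y) + (b - 1)"
    by (simp add: power2_norm_eq_inner inner_diff_left inner_diff_right inner_commute xx yy)
  moreover have "(a - 1) / a\<^sup>2 - 2 * c / (a * b) + (b - 1) / b\<^sup>2 + (1 / b - 1 / a)\<^sup>2
      = (a - 1 - 2 * c + (b - 1)) / (a * b)" for c
    using pos by (simp add: field_simps power2_eq_square)
  ultimately show ?thesis
    by (simp only: xx yy)
qed

lemma chordal_eq_dist_stereo: "chordal p q = dist (stereo p) (stereo q)"
proof -
  have nz: "(1::real) + (norm x)\<^sup>2 > 0" for x :: "real ^ 'n"
    by (simp add: add_pos_nonneg)
  have 1: "chordal (Some x) (Some y) = dist (stereo (Some x)) (stereo (Some y))"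
    for x y :: "real ^ 'n"
  proof -
    have "dist (stereo (Some x)) (stereo (Some y))
      = sqrt ((norm (x - y))\<^sup>2 / ((1 + (norm x)\<^sup>2) * (1 + (norm y)\<^sup>2)))"
      unfolding stereo_aux[symmetric]
      by (simp add: stereo_def dist_prod_def dist_norm)
    then show ?thesis
      by (simp add: real_sqrt_divide real_sqrt_mult)
  qed
  have 2: "chordal (Some x) None = dist (stereo (Some x)) (stereo None)" for x :: "real ^ 'n"
  proof -
    let ?a = "1 + (norm x)\<^sup>2"
    have "(norm x / ?a)\<^sup>2 + (1 / ?a)\<^sup>2 = ?a / ?a\<^sup>2"
      by (simp add: power_divide add_divide_distrib)
    also have "\<dots> = 1 / ?a"
      using nz[of x] by (simp add: power2_eq_square)
    finally have "sqrt ((norm x / ?a)\<^sup>2 + (1 / ?a)\<^sup>2) = 1 / sqrt ?a"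
      by (simp add: real_sqrt_divide)
    then show ?thesis
      using nz[of x]
      by (simp add: stereo_def dist_prod_def dist_norm divide_inverse mult.commute)
  qed
  have 3: "chordal None (Some x) = dist (stereo None) (stereo (Some x))" for x :: "real ^ 'n"
    using 2[of x] by (simp add: dist_commute)
  show ?thesis
    by (cases p; cases q) (auto simp only: 1 2 3 chordal.simps(4) dist_self)
qed

lemma Metric_space_chordal: "Metric_space UNIV (chordal :: 'n::finite ext_space \<Rightarrow> _)"
proof
  have nz: "sqrt (1 + (norm x)\<^sup>2) \<noteq> 0" for x :: "real ^ 'n"
    by (smt (verit) real_sqrt_eq_zero_cancel_iff zero_le_power2)
  fix p q r :: "'n ext_space"
  show "0 \<le> chordal p q" "chordal p q = chordal q p"
    by (simp_all add: chordal_eq_dist_stereo dist_commute)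
  show "chordal p q = 0 \<longleftrightarrow> p = q"
    using nz by (cases p; cases q) auto
  show "chordal p r \<le> chordal p q + chordal q r"
    by (simp add: chordal_eq_dist_stereo dist_triangle)
qed

definition ext_top :: "'n::finite ext_space topology" where
  "ext_top = Metric_space.mtopology UNIV chordal"

text \<open>The supremum is taken in \<^typ>\<open>ennreal\<close>, so the empty set has diameter 0.\<close>

definition chordal_diam :: "'n::finite ext_space set \<Rightarrow> ennreal" where
  "chordal_diam E = (SUP p\<in>E. SUP q\<in>E. ennreal (chordal p q))"

definition ext_domain :: "'n::finite ext_space set \<Rightarrow> bool" where
  "ext_domain D \<longleftrightarrow> D \<noteq> {} \<and> openin ext_top D \<and> connectedin ext_top D"

definition finite_part :: "'n::finite ext_space set \<Rightarrow> (real ^ 'n) set" where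
  "finite_part D = {x. Some x \<in> D}"

definition inversion :: "'n::finite ext_space \<Rightarrow> 'n ext_space" where
  "inversion p = (case p of None \<Rightarrow> Some 0
     | Some x \<Rightarrow> if x = 0 then None else Some (x /\<^sub>R (norm x)\<^sup>2))"


section \<open>Curves and modulus\<close>

text \<open>A triple \<open>(a, b, \<gamma>)\<close> stands for the restriction of \<open>\<gamma>\<close> to \<open>{a..b}\<close>.\<close>

type_synonym 'n curve = "real \<times> real \<times> (real \<Rightarrow> 'n ext_space)"

definition curve_length :: "real \<Rightarrow> real \<Rightarrow> (real \<Rightarrow> 'a::metric_space) \<Rightarrow> ennreal" where
  "curve_length a b g = (SUP t\<in>{t. sorted t \<and> set t \<subseteq> {a..b}}.
     \<Sum>i<length t - 1. ennreal (dist (g (t ! i)) (g (t ! Suc i))))"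

definition rectifiable_curve :: "'n::finite curve \<Rightarrow> bool" where
  "rectifiable_curve c = (case c of (a, b, \<gamma>) \<Rightarrow>
     \<gamma> ` {a..b} \<subseteq> range Some \<and> curve_length a b (the \<circ> \<gamma>) < \<infinity>)"

text \<open>The choice of the parameter value is immaterial: \<open>g\<close> is constant on each set where the
  length function is constant.\<close>

definition arclength_param :: "real \<Rightarrow> real \<Rightarrow> (real \<Rightarrow> 'a::metric_space) \<Rightarrow> real \<Rightarrow> 'a" where
  "arclength_param a b g s = g (SOME t. t \<in> {a..b} \<and> curve_length a t g = ennreal s)"

text \<open>Usual convention: curves that are not rectifiable (in particular those through infinity)
  impose no condition on admissible densities; this is expressed by the value \<open>\<infinity>\<close>.\<close>

definition line_integral :: "(real ^ 'n::finite \<Rightarrow> ennreal) \<Rightarrow> 'n curve \<Rightarrow> ennreal" where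
  "line_integral \<rho> c = (case c of (a, b, \<gamma>) \<Rightarrow>
     if rectifiable_curve (a, b, \<gamma>)
     then (\<integral>\<^sup>+ s \<in> {0..enn2real (curve_length a b (the \<circ> \<gamma>))}.
             \<rho> (arclength_param a b (the \<circ> \<gamma>) s) \<partial>lborel)
     else \<infinity>)"

definition admissible :: "(real ^ 'n::finite \<Rightarrow> ennreal) \<Rightarrow> 'n curve set \<Rightarrow> bool" where
  "admissible \<rho> \<Gamma> \<longleftrightarrow> \<rho> \<in> borel_measurable borel \<and> (\<forall>c\<in>\<Gamma>. 1 \<le> line_integral \<rho> c)"

definition modulus :: "'n::finite curve set \<Rightarrow> ennreal" where
  "modulus \<Gamma> = (INF \<rho>\<in>{\<rho>. admissible \<rho> \<Gamma>}. \<integral>\<^sup>+ x. \<rho> x ^ CARD('n) \<partial>lborel)"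

definition joining_curves ::
    "'n::finite ext_space set \<Rightarrow> 'n ext_space set \<Rightarrow> 'n ext_space set \<Rightarrow> 'n curve set" where
  "joining_curves E F G = {(a, b, \<gamma>). a < b \<and>
     continuous_map (top_of_set {a..b}) ext_top \<gamma> \<and>
     \<gamma> a \<in> E \<and> \<gamma> b \<in> F \<and> (\<forall>t\<in>{a<..<b}. \<gamma> t \<in> G)}"

definition image_curves ::
    "('n::finite ext_space \<Rightarrow> 'n ext_space) \<Rightarrow> 'n curve set \<Rightarrow> 'n curve set" where
  "image_curves f \<Gamma> = (\<lambda>(a, b, \<gamma>). (a, b, f \<circ> \<gamma>)) ` \<Gamma>"


section \<open>Ring Q-homeomorphisms\<close>

text \<open>A mapping on \<open>D\<close> is a total function whose values outside \<open>D\<close> are irrelevant; likewise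
  for \<open>Q\<close>.\<close>

definition measurable_on_domain ::
    "'n::finite ext_space set \<Rightarrow> ('n ext_space \<Rightarrow> ennreal) \<Rightarrow> bool" where
  "measurable_on_domain D Q \<longleftrightarrow>
     (\<lambda>x. Q (Some x)) \<in> borel_measurable (restrict_space lebesgue (finite_part D))"

definition homeo_into :: "'n::finite ext_space set \<Rightarrow> ('n ext_space \<Rightarrow> 'n ext_space) \<Rightarrow> bool" where
  "homeo_into D f \<longleftrightarrow> embedding_map (subtopology ext_top D) ext_top f"

definition boundary_dist :: "'n::finite ext_space set \<Rightarrow> real ^ 'n \<Rightarrow> ennreal" where
  "boundary_dist D x0 = (INF y\<in>finite_part (ext_top frontier_of D). ennreal (dist x0 y))"

definition ring_homeo_at_finite :: "'n::finite ext_space set \<Rightarrow> ('n ext_space \<Rightarrow> ennreal) \<Rightarrow>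
    ('n ext_space \<Rightarrow> 'n ext_space) \<Rightarrow> real ^ 'n \<Rightarrow> bool" where
  "ring_homeo_at_finite D Q f x0 \<longleftrightarrow> homeo_into D f \<and>
     (\<forall>r1 r2 \<eta>. 0 < r1 \<and> r1 < r2 \<and> ennreal r2 < boundary_dist D x0 \<and>
        \<eta> \<in> borel_measurable (restrict_space lebesgue {r1<..<r2}) \<and>
        1 \<le> (\<integral>\<^sup>+ r \<in> {r1<..<r2}. \<eta> r \<partial>lebesgue) \<longrightarrow>
        (let R = {x. r1 < dist x0 x \<and> dist x0 x < r2} in
         modulus (image_curves f
           (joining_curves (Some ` sphere x0 r1) (Some ` sphere x0 r2) (Some ` R)))
         \<le> (\<integral>\<^sup>+ x \<in> R. Q (Some x) * \<eta> (norm (x - x0)) ^ CARD('n) \<partial>lebesgue)))"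

definition ring_homeo_at :: "'n::finite ext_space set \<Rightarrow> ('n ext_space \<Rightarrow> ennreal) \<Rightarrow>
    ('n ext_space \<Rightarrow> 'n ext_space) \<Rightarrow> 'n ext_space \<Rightarrow> bool" where
  "ring_homeo_at D Q f p = (case p of
     Some x0 \<Rightarrow> ring_homeo_at_finite D Q f x0
   | None \<Rightarrow> ring_homeo_at_finite (inversion ` D) (Q \<circ> inversion) (f \<circ> inversion) 0)"

definition ring_homeo :: "'n::finite ext_space set \<Rightarrow> ('n ext_space \<Rightarrow> ennreal) \<Rightarrow>
    ('n ext_space \<Rightarrow> 'n ext_space) \<Rightarrow> bool" where
  "ring_homeo D Q f \<longleftrightarrow> (\<forall>p\<in>D. ring_homeo_at D Q f p)"

definition ring_homeo_class :: "'n::finite ext_space set \<Rightarrow> (ennreal \<Rightarrow> ennreal) \<Rightarrow> real \<Rightarrow> real \<Rightarrow>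
    ('n ext_space \<Rightarrow> 'n ext_space) set" where
  "ring_homeo_class D \<Phi> M \<Delta> = {f. homeo_into D f \<and> ennreal \<Delta> \<le> chordal_diam (- (f ` D)) \<and>
     (\<exists>Q. measurable_on_domain D Q \<and> ring_homeo D Q f \<and>
       (\<integral>\<^sup>+ x \<in> finite_part D. \<Phi> (Q (Some x)) / ennreal ((1 + (norm x)\<^sup>2) ^ CARD('n)) \<partial>lebesgue)
         \<le> ennreal M)}"


section \<open>The function \<open>\<Phi>\<close>\<close>

definition convex_ennreal :: "(ennreal \<Rightarrow> ennreal) \<Rightarrow> bool" where
  "convex_ennreal \<Phi> \<longleftrightarrow> (\<forall>t1 t2. \<forall>l\<in>{0..1::real}.
     \<Phi> (ennreal l * t1 + ennreal (1 - l) * t2) \<le> ennreal l * \<Phi> t1 + ennreal (1 - l) * \<Phi> t2)"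

definition gen_inverse :: "(ennreal \<Rightarrow> ennreal) \<Rightarrow> ennreal \<Rightarrow> ennreal" where
  "gen_inverse \<Phi> \<tau> = Inf {t. \<tau> \<le> \<Phi> t}"

text \<open>Only used with positive exponents, so that \<open>\<infinity>\<close> is mapped to \<open>\<infinity>\<close> and 0 to 0.\<close>

definition ennreal_rpow :: "ennreal \<Rightarrow> real \<Rightarrow> ennreal" where
  "ennreal_rpow x p = (if x = \<infinity> then \<infinity> else ennreal (enn2real x powr p))"


section \<open>Equicontinuous and normal families\<close>

definition equicontinuous_family ::
    "'n::finite ext_space set \<Rightarrow> ('n ext_space \<Rightarrow> 'n ext_space) set \<Rightarrow> bool" where
  "equicontinuous_family D \<F> \<longleftrightarrow> (\<forall>p\<in>D. \<forall>\<epsilon>>0. \<exists>U. openin (subtopology ext_top D) U \<and> p \<in> U \<and>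
     (\<forall>q\<in>U. \<forall>f\<in>\<F>. chordal (f q) (f p) < \<epsilon>))"

definition normal_family ::
    "'n::finite ext_space set \<Rightarrow> ('n ext_space \<Rightarrow> 'n ext_space) set \<Rightarrow> bool" where
  "normal_family D \<F> \<longleftrightarrow>
     (\<forall>f\<in>\<F>. continuous_map (subtopology ext_top D) ext_top f) \<and>
     (\<forall>F::nat \<Rightarrow> 'n ext_space \<Rightarrow> 'n ext_space. range F \<subseteq> \<F> \<longrightarrow>
       (\<exists>k g. strict_mono (k::nat \<Rightarrow> nat) \<and> continuous_map (subtopology ext_top D) ext_top g \<and>
         (\<forall>K. compactin ext_top K \<and> K \<subseteq> D \<longrightarrow>
           (\<forall>\<epsilon>>0. \<exists>N. \<forall>j\<ge>N. \<forall>p\<in>K. chordal (F (k j) p) (g p) < \<epsilon>))))"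

end

theory Submission
  imports Defs "HOL-Complex_Analysis.Great_Picard"
begin

text \<open>
  Let \<open>f\<close> belong to the class and let \<open>x0\<close> be a point of \<open>D\<close>, moved to \<open>0\<close> by the inversion if it
  is \<open>\<infinity>\<close>. The modulus of the image of the ring \<open>r1 < |x - x0| < r\<close> is estimated from both sides.

  From above: on the dyadic annulus \<open>A k = {r / 2^(k+1) < |x - x0| < r / 2^k}\<close> convexity of \<open>\<Phi>\<close> and
  the integral bound give \<open>\<integral>\<^bsub>A k\<^esub> Q \<le> C 2^(-kn) \<Phi>\<inverse>(\<tau> 2^(kn))\<close>. With the weights
  \<open>w k = \<Phi>\<inverse>(\<tau> 2^(kn)) powr (-1/(n-1))\<close> and the partial sum \<open>S\<close> of the first \<open>N\<close> of them, the step
  density \<open>\<eta> = w k 2^(k+1) / (S r)\<close> on \<open>A k\<close>, \<open>k < N\<close>, has integral 1 and bounds the modulus by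
  \<open>C' / S^(n-1)\<close>. The sum of the weights diverges by comparison with the integral in the hypothesis,
  so the modulus is small, uniformly in \<open>f\<close>, once \<open>r1 = r / 2^N\<close> is small.

  From below: if \<open>f x\<close> is far from \<open>f x0\<close> for some \<open>|x - x0| \<le> r1\<close>, then the image \<open>E\<close> of the inner
  ball and the complement \<open>F\<close> of the image of the outer ball are connected and not small. If
  \<open>\<integral> \<rho>^n\<close> is small, a Vitali covering argument yields \<open>z \<in> E\<close> and \<open>w \<in> F\<close> with
  \<open>\<integral>\<^bsub>B(z, s)\<^esub> \<rho>^n \<le> \<kappa> s\<close> for all \<open>s\<close>, and likewise for \<open>w\<close>. Averaging over \<open>y\<close> in a ball, some
  polyline from \<open>z\<close> through \<open>y\<close> to \<open>w\<close> has \<open>\<rho>\<close>-length less than 1; it crosses the image of the ring,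
  so \<open>\<rho>\<close> is not admissible.
\<close>

section \<open>The topology of the extended space\<close>

text \<open>Lower bound: \<open>E\<close> and \<open>F\<close> are large only chordally and may be
  unbounded, so each is cut down to the part near one of its finite points of controlled norm. What
  is kept of connectedness there is that every small sphere about that point is met. This is a
  one-dimensional size, so the covering argument compares \<open>\<rho> ^ n\<close> with sums of
  radii, and the bound at good points is linear in \<open>s\<close>. That is just enough: it gives
  the integral of \<open>\<rho>\<close> over \<open>B(z, s)\<close> the order
  \<open>s powr (n - 1 + 1/n)\<close>, and the averaged length of the segments from \<open>z\<close>
  is finite because \<open>1/n - 1 > -1\<close>. Upper bound: annulus \<open>k\<close> contributes a
  multiple of \<open>(w k / S) ^ n * 2 ^ (k * n)\<close> times the integral of \<open>Q\<close>. The
  exponent \<open>1/(n-1)\<close> is the one for which \<open>w k ^ (n - 1)\<close> cancels the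
  generalized inverse, leaving \<open>w k / S ^ n\<close>, with sum \<open>S ^ (1 - n)\<close>.
  Convexity enters through \<open>s \<le> t + 2 * t * \<Phi> s / \<tau>\<close>, valid when
  \<open>\<Phi> t \<ge> \<tau> \<ge> 2 * \<Phi> 0\<close>, in the role of Jensen's inequality. At
  \<infinity> the weight \<open>(1 + |x|^2)^(-n)\<close> has the order of the Jacobian of the
  inversion, so the same powers of 2 appear.\<close>

interpretation ext: Metric_space UNIV "chordal :: 'n::finite ext_space \<Rightarrow> _"
  rewrites "ext.mtopology = ext_top"
  by (simp_all add: Metric_space_chordal ext_top_def)

lemma topspace_ext_top [simp]: "topspace ext_top = UNIV"
  using ext.topspace_mtopology by blast

lemma chordal_le_norm: "chordal (Some x) (Some y) \<le> norm (x - y)"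
proof -
  have "1 * 1 \<le> sqrt (1 + (norm x)\<^sup>2) * sqrt (1 + (norm y)\<^sup>2)"
    by (intro mult_mono) auto
  then have "norm (x - y) / (sqrt (1 + (norm x)\<^sup>2) * sqrt (1 + (norm y)\<^sup>2)) \<le> norm (x - y) / 1"
    by (intro divide_left_mono) auto
  then show ?thesis by simp
qed

lemma chordal_infinity_less:
  assumes "0 < r" "1 / r < norm x"
  shows "chordal None (Some x) < r"
proof -
  have "1 / r < sqrt (1 + (norm x)\<^sup>2)"
    using assms by (smt (verit) real_le_rsqrt real_less_rsqrt norm_ge_zero abs_le_square_iff power2_norm_eq_inner real_sqrt_abs2 real_sqrt_le_mono)
  moreover have "0 < sqrt (1 + (norm x)\<^sup>2)"
    by (simp add: add_pos_nonneg)
  ultimately show ?thesis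
    using assms by (simp add: field_simps)
qed

lemma norm_le_of_chordal_infinity:
  assumes "0 < r" "r \<le> chordal None (Some x)"
  shows "norm x \<le> 1 / r"
  using chordal_infinity_less[of r x] assms by force

text \<open>\<open>sqrt (1 + (norm x)\<^sup>2)\<close> is the norm of \<open>(1, x)\<close> in the
  product space, so this is a triangle inequality.\<close>

lemma sqrt_one_plus_norm_triangle:
  "sqrt (1 + (norm x)\<^sup>2) \<le> sqrt (1 + (norm y)\<^sup>2) + norm (x - y)"
proof -
  have "norm (1::real, x) \<le> norm (1::real, y) + norm ((1::real, x) - (1, y))"
    using norm_triangle_sub by blast
  then show ?thesis by (simp add: norm_Pair)
qed

text \<open>The chordal metric induces the topology of the one-point compactification. From here on
  most continuity proofs treat the finite part and the neighbourhoods of \<infinity> separately and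
  do not touch the chordal formula.\<close>

lemma openin_ext_top_iff:
  fixes U :: "'n::finite ext_space set"
  shows "openin ext_top U \<longleftrightarrow>
    open (finite_part U) \<and> (None \<in> U \<longrightarrow> (\<exists>R. \<forall>x. R < norm x \<longrightarrow> Some x \<in> U))"
proof (intro iffI conjI impI)
  assume U: "openin ext_top U"
  then have ball: "\<exists>r>0. \<forall>q. chordal p q < r \<longrightarrow> q \<in> U" if "p \<in> U" for p
    using that unfolding ext.openin_mtopology by (auto simp: ext.mball_def subset_iff)
  show "open (finite_part U)"
    unfolding open_dist
  proof
    fix x assume "x \<in> finite_part U"
    then obtain r where "r > 0" and r: "\<And>q. chordal (Some x) q < r \<Longrightarrow> q \<in> U"
      using ball[of "Some x"] by (auto simp: finite_part_def)
    have "y \<in> finite_part U" if "dist y x < r" for y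
      using r[of "Some y"] chordal_le_norm[of x y] that
      by (simp add: finite_part_def dist_norm norm_minus_commute)
    with \<open>r > 0\<close> show "\<exists>e>0. \<forall>y. dist y x < e \<longrightarrow> y \<in> finite_part U" by blast
  qed
  assume "None \<in> U"
  then obtain r where "r > 0" and r: "\<And>q. chordal None q < r \<Longrightarrow> q \<in> U"
    using ball by blast
  show "\<exists>R. \<forall>x. R < norm x \<longrightarrow> Some x \<in> U"
    using chordal_infinity_less[OF \<open>r > 0\<close>] r by blast
next
  assume U: "open (finite_part U) \<and> (None \<in> U \<longrightarrow> (\<exists>R. \<forall>x. R < norm x \<longrightarrow> Some x \<in> U))"
  have "\<exists>r>0. \<forall>q. chordal p q < r \<longrightarrow> q \<in> U" if "p \<in> U" for p
  proof (cases p)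
    case None
    then obtain R where R: "\<And>x. R < norm x \<Longrightarrow> Some x \<in> U" using U \<open>p \<in> U\<close> by auto
    \<comment> \<open>With this radius, \<open>chordal None (Some x) < r\<close> forces
      \<open>norm x > max R 0\<close>; the maximum is there because \<open>R\<close> may be
      negative.\<close>
    define r where "r = 1 / sqrt (1 + (max R 0)\<^sup>2)"
    have pos: "0 < sqrt (1 + (max R 0)\<^sup>2)" by (simp add: add_pos_nonneg)
    have "q \<in> U" if "chordal None q < r" for q
    proof (cases q)
      case None then show ?thesis using \<open>p = None\<close> \<open>p \<in> U\<close> by simp
    next
      case (Some x)
      have "sqrt (1 + (max R 0)\<^sup>2) < sqrt (1 + (norm x)\<^sup>2)"
        using that pos unfolding Some r_def by (simp add: divide_simps add_pos_nonneg split: if_splits)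
      then have "(max R 0)\<^sup>2 < (norm x)\<^sup>2" by simp
      then have "max R 0 < norm x" by (rule power_less_imp_less_base) simp
      then show ?thesis using R Some by auto
    qed
    with pos show ?thesis unfolding None r_def by (intro exI[of _ r]) (auto simp: r_def)
  next
    case (Some x)
    then have "x \<in> finite_part U" using that by (simp add: finite_part_def)
    then obtain e where "e > 0" and e: "\<And>y. dist y x < e \<Longrightarrow> Some y \<in> U"
      using U unfolding open_dist by (auto simp: finite_part_def)
    define a where "a = sqrt (1 + (norm x)\<^sup>2)"
    have a: "a > 0" by (simp add: a_def add_pos_nonneg)
    \<comment> \<open>The first bound keeps \<infinity>, at distance \<open>1 / a\<close>, out of
      the ball. It also gives \<open>r * a \<le> 1 / 2\<close>, so that in the estimate of
      \<open>?d\<close> the term \<open>(r * a) * ?d\<close> is absorbed on the left; the second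
      bound then brings \<open>?d\<close> below \<open>e\<close>.\<close>
    define r where "r = min (1 / (2 * a)) (e / (2 * a\<^sup>2))"
    have r0: "r > 0" using a \<open>e > 0\<close> by (simp add: r_def)
    have ra: "r * a \<le> 1 / 2" "2 * r * a\<^sup>2 \<le> e"
      using a \<open>e > 0\<close> by (auto simp: r_def min_def field_simps power2_eq_square)
    have "q \<in> U" if q: "chordal (Some x) q < r" for q
    proof (cases q)
      case None
      then have "1 / a < r" using q by (simp add: a_def)
      moreover have "r \<le> 1 / (2 * a)" by (simp add: r_def)
      ultimately have False using a by (simp add: field_simps)
      then show ?thesis ..
    next
      case (Some y)
      let ?d = "norm (x - y)"
      define b where "b = sqrt (1 + (norm y)\<^sup>2)"
      have b: "b > 0" by (simp add: b_def add_pos_nonneg)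
      have "b \<le> a + ?d"
        using sqrt_one_plus_norm_triangle[of y x] by (simp add: a_def b_def norm_minus_commute)
      have "?d < r * (a * b)"
        using q a b unfolding Some by (simp add: a_def[symmetric] b_def[symmetric] field_simps)
      also have "\<dots> \<le> r * (a * (a + ?d))"
        using \<open>b \<le> a + ?d\<close> a r0 by simp
      also have "\<dots> = r * a\<^sup>2 + (r * a) * ?d" by (simp add: algebra_simps power2_eq_square)
      also have "\<dots> \<le> r * a\<^sup>2 + 1 / 2 * ?d"
        using ra(1) by (intro add_left_mono mult_right_mono) auto
      finally have "?d < 2 * r * a\<^sup>2" by simp
      then have "dist y x < e" using ra(2) by (simp add: dist_norm norm_minus_commute)
      then show ?thesis using e Some by simp
    qed
    then show ?thesis using r0 Some by blast
  qed
  then show "openin ext_top U"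
    unfolding ext.openin_mtopology by (auto simp: ext.mball_def subset_iff)
qed

lemma openin_Some_image [simp]: "openin ext_top (Some ` S) \<longleftrightarrow> open S"
  by (auto simp: openin_ext_top_iff finite_part_def image_iff)

lemma continuous_map_Some: "continuous_map euclidean ext_top Some"
  unfolding continuous_map_def by (auto simp: openin_ext_top_iff finite_part_def)

lemma continuous_map_from_ext_top:
  assumes "continuous_map euclidean Y (\<lambda>x. g (Some x))" "g None \<in> topspace Y"
    and "\<And>V. openin Y V \<Longrightarrow> g None \<in> V \<Longrightarrow> \<exists>R. \<forall>x. R < norm x \<longrightarrow> g (Some x) \<in> V"
  shows "continuous_map ext_top Y (g :: 'n::finite ext_space \<Rightarrow> _)"
  unfolding continuous_map_def
proof (intro conjI allI impI)
  show "g \<in> topspace ext_top \<rightarrow> topspace Y"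
  proof
    fix p show "g p \<in> topspace Y"
      using assms(1,2) by (cases p) (auto simp: continuous_map_def Pi_iff)
  qed
  fix V assume V: "openin Y V"
  have "open {x. g (Some x) \<in> V}"
    using assms(1) V by (auto simp: continuous_map_def)
  then show "openin ext_top {x \<in> topspace ext_top. g x \<in> V}"
    using assms(3)[OF V] by (auto simp: openin_ext_top_iff finite_part_def)
qed

lemma continuous_map_ext_top_finite:
  fixes g :: "'a \<Rightarrow> real ^ 'n::finite"
  shows "continuous_map X ext_top (\<lambda>x. Some (g x)) \<longleftrightarrow> continuous_map X euclidean g"
proof
  assume L: "continuous_map X ext_top (\<lambda>x. Some (g x))"
  show "continuous_map X euclidean g"
    unfolding continuous_map_def
  proof (intro conjI allI impI)
    fix U :: "(real ^ 'n) set" assume "openin euclidean U"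
    then have "openin X {x \<in> topspace X. Some (g x) \<in> Some ` U}"
      using L by (intro openin_continuous_map_preimage) auto
    then show "openin X {x \<in> topspace X. g x \<in> U}" by (simp add: image_iff)
  qed auto
next
  assume "continuous_map X euclidean g"
  then show "continuous_map X ext_top (\<lambda>x. Some (g x))"
    using continuous_map_compose[OF _ continuous_map_Some] by (simp add: o_def)
qed

section \<open>Inversion, translations, and moving a point to infinity\<close>

lemma inversion_inversion [simp]: "inversion (inversion p) = p"
  by (cases p) (auto simp: inversion_def power2_eq_square field_simps)

lemma inversion_simps [simp]:
  "inversion None = Some 0" "inversion (Some 0) = None"
  "x \<noteq> 0 \<Longrightarrow> inversion (Some x) = Some (x /\<^sub>R (norm x)\<^sup>2)"
  by (auto simp: inversion_def)

lemma continuous_map_inversion: "continuous_map ext_top ext_top (inversion :: 'n::finite ext_space \<Rightarrow> _)"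
proof -
  have "openin ext_top (inversion -` V)" if "openin ext_top V" for V :: "'n ext_space set"
  proof -
    have V: "open (finite_part V)" "None \<in> V \<Longrightarrow> \<exists>R. \<forall>x. R < norm x \<longrightarrow> Some x \<in> V"
      using that by (auto simp: openin_ext_top_iff)
    \<comment> \<open>\<open>W\<close> is the part of the preimage away from \<open>0\<close> and
      \<infinity>, where inversion is a continuous Euclidean map. The point \<open>0\<close> belongs
      to the preimage exactly when \<infinity> is in \<open>V\<close>, and then a whole ball about
      \<open>0\<close> does.\<close>
    define W where "W = {x \<in> - {0}. x /\<^sub>R (norm x)\<^sup>2 \<in> finite_part V}"
    have "open W"
      unfolding W_def
      by (intro continuous_open_preimage[unfolded vimage_def Int_def, simplified] V)
         (auto intro!: continuous_intros)
    have sub: "finite_part (inversion -` V) = W \<union> (if None \<in> V then {0} else {})"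
      by (auto simp: finite_part_def W_def inversion_def split: if_splits)
    show ?thesis
      unfolding openin_ext_top_iff
    proof (intro conjI impI)
      show "open (finite_part (inversion -` V))"
      proof (cases "None \<in> V")
        case False then show ?thesis using sub \<open>open W\<close> by simp
      next
        case True
        then obtain R where R: "\<And>x. R < norm x \<Longrightarrow> Some x \<in> V" using V by blast
        define r where "r = 1 / (max R 0 + 1)"
        have "r > 0" by (simp add: r_def add_pos_nonneg add_nonneg_pos)
        have "ball 0 r \<subseteq> W \<union> {0}"
        proof
          fix x :: "real ^ 'n" assume x: "x \<in> ball 0 r"
          show "x \<in> W \<union> {0}"
          proof (cases "x = 0")
            case False
            have "norm (x /\<^sub>R (norm x)\<^sup>2) = 1 / norm x"
              using False by (simp add: power2_eq_square divide_simps)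
            moreover have "1 / norm x > R"
            proof -
              have "norm x * (max R 0 + 1) < 1"
                using x \<open>r > 0\<close> by (auto simp: r_def field_simps)
              moreover have "norm x * R < norm x * (max R 0 + 1)"
                using False by (intro mult_strict_left_mono) auto
              ultimately show ?thesis using False by (simp add: field_simps)
            qed
            ultimately show ?thesis using R False by (auto simp: W_def finite_part_def)
          qed auto
        qed
        then have "W \<union> {0} = W \<union> ball 0 r" using \<open>r > 0\<close> by auto
        then show ?thesis using sub True \<open>open W\<close> by (simp add: open_Un)
      qed
      assume "None \<in> inversion -` V"
      then have "0 \<in> finite_part V" by (simp add: finite_part_def)
      then obtain e where "e > 0" and e: "ball 0 e \<subseteq> finite_part V"
        using V(1) openE by blast
      have "Some x \<in> inversion -` V" if x: "1 / e < norm x" for x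
      proof -
        have "x \<noteq> 0" using x \<open>e > 0\<close> by (smt (verit) norm_zero zero_less_divide_1_iff)
        moreover have "norm (x /\<^sub>R (norm x)\<^sup>2) = 1 / norm x"
          using \<open>x \<noteq> 0\<close> by (simp add: power2_eq_square divide_simps)
        moreover have "1 / norm x < e" using x \<open>e > 0\<close> \<open>x \<noteq> 0\<close> by (simp add: field_simps)
        ultimately show ?thesis using e by (auto simp: finite_part_def subset_iff)
      qed
      then show "\<exists>R. \<forall>x. R < norm x \<longrightarrow> Some x \<in> inversion -` V" by blast
    qed
  qed
  then show ?thesis by (auto simp: continuous_map_def vimage_def)
qed

lemma homeomorphic_maps_inversion: "homeomorphic_maps ext_top ext_top inversion inversion"
  by (simp add: homeomorphic_maps_def continuous_map_inversion)

definition ext_translate :: "real ^ 'n \<Rightarrow> 'n::finite ext_space \<Rightarrow> 'n ext_space" where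
  "ext_translate a = map_option (\<lambda>x. x + a)"

lemma continuous_map_ext_translate: "continuous_map ext_top ext_top (ext_translate a)"
proof (rule continuous_map_from_ext_top)
  show "continuous_map euclidean ext_top (\<lambda>x. ext_translate a (Some x))"
    by (auto simp: ext_translate_def continuous_map_ext_top_finite intro!: continuous_intros)
  fix V assume "openin ext_top V" "ext_translate a None \<in> V"
  then obtain R where R: "\<And>x. R < norm x \<Longrightarrow> Some x \<in> V"
    by (auto simp: openin_ext_top_iff ext_translate_def)
  have "ext_translate a (Some x) \<in> V" if "R + norm a < norm x" for x
    using R[of "x + a"] that norm_triangle_ineq4[of "x + a" a] by (simp add: ext_translate_def)
  then show "\<exists>R. \<forall>x. R < norm x \<longrightarrow> ext_translate a (Some x) \<in> V" by blast
qed simp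

lemma homeomorphic_maps_ext_translate:
  fixes a :: "real ^ 'n::finite"
  shows "homeomorphic_maps ext_top ext_top (ext_translate a) (ext_translate (- a))"
proof -
  have "ext_translate b (ext_translate (- b) p) = p" for b :: "real ^ 'n" and p
    by (cases p) (auto simp: ext_translate_def)
  from this[of a] this[of "- a"] show ?thesis
    by (simp add: homeomorphic_maps_def continuous_map_ext_translate)
qed

text \<open>A member of the class omits some value \<open>p\<close>. Sending \<open>p\<close> to
  \<infinity> turns the mapping on a ball into an injection into \<open>real ^ 'n\<close>, where the
  Euclidean theorems apply. Only topological conclusions are drawn this way, so \<open>T\<close>
  need not be a chordal isometry.\<close>

lemma exists_homeomorphism_to_infinity:
  fixes p :: "'n::finite ext_space"
  obtains T T' :: "'n ext_space \<Rightarrow> 'n ext_space"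
    where "homeomorphic_maps ext_top ext_top T T'" "T p = None"
proof (cases p)
  case None
  then show ?thesis using that[of id id] by (simp add: homeomorphic_maps_def)
next
  case (Some x)
  have "homeomorphic_maps ext_top ext_top (inversion \<circ> ext_translate (-x)) (ext_translate (-(-x)) \<circ> inversion)"
    by (rule homeomorphic_maps_compose[OF conjI[OF homeomorphic_maps_ext_translate homeomorphic_maps_inversion]])
  then show ?thesis
    by (rule that) (simp add: Some ext_translate_def)
qed

section \<open>Images of balls under embeddings\<close>

lemma homeo_intoD:
  assumes "homeo_into D f"
  shows "continuous_map (subtopology ext_top D) ext_top f" "inj_on f D"
    "\<exists>g. continuous_map (subtopology ext_top (f ` D)) ext_top g \<and> (\<forall>p\<in>D. g (f p) = p) \<and> g ` f ` D \<subseteq> D"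
proof -
  have hm: "homeomorphic_map (subtopology ext_top D) (subtopology ext_top (f ` D)) f"
    using assms by (simp add: homeo_into_def embedding_map_def)
  then show "continuous_map (subtopology ext_top D) ext_top f" "inj_on f D"
    using homeomorphic_imp_continuous_map continuous_map_into_fulltopology
      homeomorphic_imp_injective_map by fastforce+
  obtain g where "homeomorphic_maps (subtopology ext_top D) (subtopology ext_top (f ` D)) f g"
    using hm homeomorphic_map_maps by blast
  then show "\<exists>g. continuous_map (subtopology ext_top (f ` D)) ext_top g \<and> (\<forall>p\<in>D. g (f p) = p) \<and> g ` f ` D \<subseteq> D"
    by (intro exI[of _ g]) (auto simp: homeomorphic_maps_def continuous_map_in_subtopology)
qed

lemma chart_avoiding_infinity:
  assumes f: "homeo_into D f" and sub: "Some ` S \<subseteq> D" and p: "p \<notin> f ` D"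
    and T: "homeomorphic_maps ext_top ext_top T T'" "T p = None"
  obtains g where "continuous_on S g" "inj_on g S" "\<And>x. x \<in> S \<Longrightarrow> T (f (Some x)) = Some (g x)"
proof -
  have T'T: "T' (T q) = q" for q using T(1) by (simp add: homeomorphic_maps_def)
  define g where "g x = the (T (f (Some x)))" for x
  have g: "T (f (Some x)) = Some (g x)" if "x \<in> S" for x
  proof -
    have "f (Some x) \<noteq> p" using that sub p by auto
    then have "T (f (Some x)) \<noteq> None" using T(2) T'T by metis
    then show ?thesis by (simp add: g_def)
  qed
  have "continuous_map (top_of_set S) (subtopology ext_top D) Some"
    using sub continuous_map_from_subtopology[OF continuous_map_Some]
    by (auto simp: continuous_map_in_subtopology)
  then have "continuous_map (top_of_set S) ext_top (T \<circ> (f \<circ> Some))"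
    using homeo_intoD(1)[OF f] T(1) by (auto simp: homeomorphic_maps_def intro: continuous_map_compose)
  then have "continuous_map (top_of_set S) ext_top (\<lambda>x. Some (g x))"
    by (rule continuous_map_eq) (auto simp: g)
  then have "continuous_on S g" by (simp add: continuous_map_ext_top_finite)
  moreover have "inj_on g S"
  proof
    fix x y assume xy: "x \<in> S" "y \<in> S" "g x = g y"
    then have "f (Some x) = f (Some y)" using g T'T by metis
    then show "x = y" using homeo_intoD(2)[OF f] sub xy by (auto dest!: inj_onD)
  qed
  ultimately show ?thesis using that g by blast
qed

text \<open>Invariance of domain in the chart that sends the omitted value to \<infinity>, pulled
  back by \<open>T\<close>.\<close>

lemma openin_image_ball:
  fixes f :: "'n::finite ext_space \<Rightarrow> 'n ext_space"
  assumes f: "homeo_into D f" and sub: "Some ` ball x r \<subseteq> D" and p: "p \<notin> f ` D"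
  shows "openin ext_top (f ` Some ` ball x r)"
proof -
  obtain T T' :: "'n ext_space \<Rightarrow> 'n ext_space"
    where T: "homeomorphic_maps ext_top ext_top T T'" "T p = None"
    by (rule exists_homeomorphism_to_infinity[of p])
  have T'T: "T' (T q) = q" for q using T(1) by (simp add: homeomorphic_maps_def)
  obtain g where g: "continuous_on (ball x r) g" "inj_on g (ball x r)"
      "\<And>y. y \<in> ball x r \<Longrightarrow> T (f (Some y)) = Some (g y)"
    using chart_avoiding_infinity[OF f sub p T] by blast
  have "openin ext_top (Some ` g ` ball x r)"
    using invariance_of_domain[OF g(1) _ g(2)] by simp
  then have "openin ext_top {q \<in> topspace ext_top. T q \<in> Some ` g ` ball x r}"
    using T(1) by (intro openin_continuous_map_preimage) (auto simp: homeomorphic_maps_def)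
  moreover have "{q \<in> topspace ext_top. T q \<in> Some ` g ` ball x r} = f ` Some ` ball x r"
  proof (intro equalityI subsetI)
    fix q assume "q \<in> {q \<in> topspace ext_top. T q \<in> Some ` g ` ball x r}"
    then obtain y where "y \<in> ball x r" "T q = T (f (Some y))" using g(3) by auto
    then show "q \<in> f ` Some ` ball x r" using T'T by (metis imageI)
  qed (use g(3) in auto)
  ultimately show ?thesis by simp
qed

lemma compactin_image_cball:
  assumes "homeo_into D f" and "Some ` cball x r \<subseteq> D"
  shows "compactin ext_top (f ` Some ` cball x r)"
proof (rule image_compactin)
  have "compactin ext_top (Some ` cball x r)"
    by (rule image_compactin[OF _ continuous_map_Some]) auto
  then show "compactin (subtopology ext_top D) (Some ` cball x r)"
    using assms(2) by (simp add: compactin_subtopology)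
  show "continuous_map (subtopology ext_top D) ext_top f" by (rule homeo_intoD[OF assms(1)])
qed

lemma closedin_image_cball:
  assumes "homeo_into D f" and "Some ` cball x r \<subseteq> D"
  shows "closedin ext_top (f ` Some ` cball x r)"
  using compactin_image_cball[OF assms] ext.Hausdorff_space_mtopology compactin_imp_closedin by blast

lemma connectedin_image_cball:
  assumes "homeo_into D f" and "Some ` cball x r \<subseteq> D"
  shows "connectedin ext_top (f ` Some ` cball x r)"
proof (rule connectedin_continuous_map_image)
  have "connectedin ext_top (Some ` cball x r)"
    by (rule connectedin_continuous_map_image[OF continuous_map_Some]) auto
  then show "connectedin (subtopology ext_top D) (Some ` cball x r)"
    using assms(2) by (simp add: connectedin_subtopology)
  show "continuous_map (subtopology ext_top D) ext_top f" by (rule homeo_intoD[OF assms(1)])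
qed

text \<open>In the chart the image is a compact set homeomorphic to a ball, and such a set does not
  separate \<open>real ^ 'n\<close> when the dimension is at least 2. It remains to add
  \<infinity>.\<close>

lemma connectedin_complement_image_cball:
  fixes f :: "'n::finite ext_space \<Rightarrow> 'n ext_space"
  assumes n: "2 \<le> CARD('n)"
    and f: "homeo_into D f" and sub: "Some ` cball x r \<subseteq> D" and p: "p \<notin> f ` D"
  shows "connectedin ext_top (- f ` Some ` cball x r)"
proof -
  obtain T T' :: "'n ext_space \<Rightarrow> 'n ext_space"
    where T: "homeomorphic_maps ext_top ext_top T T'" "T p = None"
    by (rule exists_homeomorphism_to_infinity[of p])
  have T'T: "T' (T q) = q" and TT': "T (T' q) = q" for q
    using T(1) by (simp_all add: homeomorphic_maps_def)
  obtain g where g: "continuous_on (cball x r) g" "inj_on g (cball x r)"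
      "\<And>y. y \<in> cball x r \<Longrightarrow> T (f (Some y)) = Some (g y)"
    using chart_avoiding_infinity[OF f sub p T] by blast
  let ?K = "g ` cball x r"
  have "compact ?K" by (intro compact_continuous_image g) simp
  have "cball x r homeomorphic ?K"
    by (rule homeomorphic_compact[OF compact_cball g(1) refl g(2)])
  then have "?K homeomorphic cball x r" by (rule homeomorphic_sym[THEN iffD1])
  then have "connected (- ?K)"
    using n by (intro connected_complement_homeomorphic_convex_compact) auto
  then have conn: "connectedin ext_top (Some ` (- ?K))"
    by (intro connectedin_continuous_map_image[OF continuous_map_Some]) simp
  \<comment> \<open>The complement of a compact set is unbounded, so \<infinity> is a limit point of
    it, and adjoining a limit point keeps a set connected.\<close>
  have "None \<in> ext_top closure_of (Some ` (- ?K))"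
    unfolding in_closure_of
  proof (intro conjI allI impI)
    fix V :: "'n ext_space set" assume "None \<in> V \<and> openin ext_top V"
    then obtain R where R: "\<And>y. R < norm y \<Longrightarrow> Some y \<in> V" by (auto simp: openin_ext_top_iff)
    obtain B where B: "\<And>y. y \<in> ?K \<Longrightarrow> norm y \<le> B"
      using compact_imp_bounded[OF \<open>compact ?K\<close>] by (meson bounded_iff)
    obtain y :: "real ^ 'n" where "norm y = max (R + 1) (max (B + 1) 0)"
      by (rule vector_choose_size[of "max (R + 1) (max (B + 1) 0)"]) simp_all
    then have "R < norm y" "y \<notin> ?K" using B[of y] by fastforce+
    then show "\<exists>y. y \<in> Some ` (- ?K) \<and> y \<in> V" using R by blast
  qed simp
  then have "connectedin ext_top (insert None (Some ` (- ?K)))"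
    using conn by (intro connectedin_intermediate_closure_of[OF conn]) (auto simp: closure_of_subset)
  then have "connectedin ext_top (T' ` insert None (Some ` (- ?K)))"
    using T(1) by (intro connectedin_continuous_map_image) (auto simp: homeomorphic_maps_def)
  moreover have "T' ` insert None (Some ` (- ?K)) = - f ` Some ` cball x r"
  proof (intro equalityI subsetI)
    fix q assume "q \<in> T' ` insert None (Some ` (- ?K))"
    then have "T q \<in> insert None (Some ` (- ?K))" using TT' by auto
    then show "q \<in> - f ` Some ` cball x r" using g(3) by auto
  next
    fix q assume q: "q \<in> - f ` Some ` cball x r"
    have "T q \<notin> Some ` ?K"
    proof
      assume "T q \<in> Some ` ?K"
      then obtain y where "y \<in> cball x r" "T q = T (f (Some y))" using g(3) by auto
      then show False using q T'T by (metis ComplD imageI)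
    qed
    then have "T q \<in> insert None (Some ` (- ?K))" by (cases "T q") auto
    then show "q \<in> T' ` insert None (Some ` (- ?K))" using T'T by (metis imageI)
  qed
  ultimately show ?thesis by simp
qed

text \<open>Intermediate value theorem for the distance to \<open>e\<close>, truncated at
  \<open>\<epsilon>\<close> so that it extends continuously to \<infinity>. At \<open>q\<close> it
  equals \<open>\<epsilon>\<close> because the Euclidean distance dominates the chordal one. The
  weaker conclusion replaces connectedness in all measure estimates below.\<close>

lemma connectedin_radii_onto:
  fixes E :: "'n::finite ext_space set"
  assumes E: "connectedin ext_top E" "Some e \<in> E" "q \<in> E" and "\<epsilon> \<le> chordal (Some e) q" "0 < \<epsilon>"
    and s: "0 \<le> s" "s < \<epsilon>"
  shows "\<exists>z. Some z \<in> E \<and> norm (z - e) = s"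
proof -
  define u where "u p = (case p of None \<Rightarrow> \<epsilon> | Some z \<Rightarrow> min (norm (z - e)) \<epsilon>)" for p :: "'n ext_space"
  have "continuous_map ext_top euclidean u"
  proof (rule continuous_map_from_ext_top)
    fix V assume V: "openin euclidean V" "u None \<in> V"
    have "u (Some x) \<in> V" if "\<epsilon> + norm e < norm x" for x
      using that V norm_triangle_ineq2[of x e] by (simp add: u_def)
    then show "\<exists>R. \<forall>x. R < norm x \<longrightarrow> u (Some x) \<in> V" by blast
  qed (auto simp: u_def intro!: continuous_intros)
  then have conn: "connected (u ` E)"
    using connectedin_continuous_map_image[OF _ E(1)] by fastforce
  have u0: "u (Some e) = 0" using \<open>0 < \<epsilon>\<close> by (simp add: u_def)
  have u1: "u q = \<epsilon>"
  proof (cases q)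
    case (Some x)
    then show ?thesis using assms chordal_le_norm[of e x] by (simp add: u_def norm_minus_commute)
  qed (simp add: u_def)
  have "0 \<in> u ` E" "\<epsilon> \<in> u ` E" using imageI[OF E(2), of u] imageI[OF E(3), of u] u0 u1 by simp_all
  then have "s \<in> u ` E"
    by (rule connectedD_interval[OF conn]) (use s in simp_all)
  then obtain p where p: "p \<in> E" "u p = s" by auto
  show ?thesis using p s by (cases p) (auto simp: u_def min_def split: if_splits)
qed

text \<open>Polylines are drawn in the image, while the modulus is taken over images of curves in
  the ring. Between the last visit to the inner image and the first exit from the outer one,
  \<open>\<sigma>\<close> can be lifted through \<open>f\<close>; the lift joins the two boundary
  spheres.\<close>

lemma crossing_subcurve:
  fixes f :: "'n::finite ext_space \<Rightarrow> 'n ext_space"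
  assumes f: "homeo_into D f" and sub: "Some ` cball x r2 \<subseteq> D" and p: "p \<notin> f ` D"
    and r: "0 < r1" "r1 < r2"
    and \<sigma>: "continuous_on {0..L} \<sigma>" "0 \<le> L"
    and start: "Some (\<sigma> 0) \<in> f ` Some ` cball x r1" and stop: "Some (\<sigma> L) \<notin> f ` Some ` cball x r2"
  obtains a b \<gamma> where "0 \<le> a" "a < b" "b \<le> L" "\<And>t. t \<in> {a..b} \<Longrightarrow> f (\<gamma> t) = Some (\<sigma> t)"
    "(a, b, \<gamma>) \<in> joining_curves (Some ` sphere x r1) (Some ` sphere x r2)
        (Some ` {y. r1 < dist x y \<and> dist x y < r2})"
proof -
  let ?I = "\<lambda>S. f ` Some ` S"
  have cball_split: "?I (cball x r) = ?I (ball x r) \<union> ?I (sphere x r)" for r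
  proof -
    have "cball x r = ball x r \<union> sphere x r" by auto
    then show ?thesis by (metis image_Un)
  qed
  have sub1: "Some ` cball x r1 \<subseteq> D" using sub r by (meson dual_order.trans image_mono subset_cball less_imp_le)
  have subb: "Some ` ball x r2 \<subseteq> D" "Some ` ball x r1 \<subseteq> D"
    using sub sub1 by (meson ball_subset_cball dual_order.trans image_mono)+
  have con: "continuous_map (top_of_set {0..L}) ext_top (\<lambda>t. Some (\<sigma> t))"
    using \<sigma>(1) by (simp add: continuous_map_ext_top_finite)
  have closedI: "closed {t \<in> {0..L}. Some (\<sigma> t) \<in> C}" if "closedin ext_top C" for C
  proof -
    have "closedin (top_of_set {0..L}) {t \<in> topspace (top_of_set {0..L}). Some (\<sigma> t) \<in> C}"
      by (rule closedin_continuous_map_preimage[OF con that])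
    then show ?thesis using closedin_closed_trans by fastforce
  qed
  have openI: "\<exists>e>0. \<forall>t'\<in>{0..L}. dist t' t < e \<longrightarrow> Some (\<sigma> t') \<in> U"
    if "openin ext_top U" "t \<in> {0..L}" "Some (\<sigma> t) \<in> U" for U t
  proof -
    have "openin (top_of_set {0..L}) {t \<in> topspace (top_of_set {0..L}). Some (\<sigma> t) \<in> U}"
      by (rule openin_continuous_map_preimage[OF con that(1)])
    then show ?thesis using that(2,3) unfolding openin_euclidean_subtopology_iff by simp
  qed
  \<comment> \<open>The minimum \<open>b\<close> of this compact set is the first time outside the
    image of the open outer ball.\<close>
  define X where "X = {t \<in> {0..L}. Some (\<sigma> t) \<in> - ?I (ball x r2)}"
  have "closed X" unfolding X_def
    using openin_image_ball[OF f subb(1) p] by (intro closedI) (simp add: closedin_def Compl_eq_Diff_UNIV double_diff)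
  have "X \<subseteq> {0..L}" by (auto simp: X_def)
  then have "compact X"
    using \<open>closed X\<close> bounded_subset[OF bounded_closed_interval] compact_eq_bounded_closed by blast
  have "L \<in> X" using stop \<sigma>(2) by (auto simp: X_def image_iff)
  then obtain b where b: "b \<in> X" "\<And>t. t \<in> X \<Longrightarrow> b \<le> t"
    using compact_attains_inf[OF \<open>compact X\<close>] by blast
  have before_b: "Some (\<sigma> t) \<in> ?I (ball x r2)" if "0 \<le> t" "t < b" for t
    using that b by (force simp: X_def)
  have "Some (\<sigma> 0) \<in> ?I (ball x r2)" using start r by (auto simp: image_iff)
  then have "b > 0" using b(1) by (cases "b = 0") (auto simp: X_def)
  have bL: "b \<le> L" using b(1) by (simp add: X_def)
  \<comment> \<open>The maximum \<open>a\<close> is the last time before \<open>b\<close> in the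
    image of the closed inner ball, so that the curve stays in the open ring strictly between
    \<open>a\<close> and \<open>b\<close>.\<close>
  define Y where "Y = {t \<in> {0..L}. Some (\<sigma> t) \<in> ?I (cball x r1)} \<inter> {0..b}"
  have "compact Y" unfolding Y_def
    by (intro closed_Int_compact closedI closedin_image_cball[OF f sub1]) auto
  have "0 \<in> Y" using start \<open>b > 0\<close> \<sigma>(2) by (auto simp: Y_def)
  then obtain a where a: "a \<in> Y" "\<And>t. t \<in> Y \<Longrightarrow> t \<le> a"
    using compact_attains_sup[OF \<open>compact Y\<close>] by blast
  have a0: "0 \<le> a" "a \<le> b" and aI: "Some (\<sigma> a) \<in> ?I (cball x r1)" using a(1) by (auto simp: Y_def)
  have cb: "?I (cball x r1) \<subseteq> ?I (ball x r2)" using r by (intro image_mono) auto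
  have "a \<noteq> b" using aI cb b(1) by (auto simp: X_def)
  with a0 have "a < b" by simp
  have after_a: "Some (\<sigma> t) \<notin> ?I (cball x r1)" if "a < t" "t \<le> b" for t
  proof
    assume "Some (\<sigma> t) \<in> ?I (cball x r1)"
    then have "t \<in> Y" using that a0 bL by (auto simp: Y_def)
    then show False using a(2) that by force
  qed
  \<comment> \<open>The image of the open inner ball is open, so otherwise \<open>\<sigma>\<close>
    would still be in it shortly after \<open>a\<close>. Hence \<open>a\<close> corresponds to a
    point of the sphere.\<close>
  have "Some (\<sigma> a) \<notin> ?I (ball x r1)"
  proof
    assume "Some (\<sigma> a) \<in> ?I (ball x r1)"
    then obtain e where "e > 0" and e: "\<And>t. t \<in> {0..L} \<Longrightarrow> dist t a < e \<Longrightarrow> Some (\<sigma> t) \<in> ?I (ball x r1)"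
      using openI[OF openin_image_ball[OF f subb(2) p], of a] a0 bL by auto
    define t where "t = min b (a + e / 2)"
    have t: "a < t" "t \<le> b" "dist t a < e" using \<open>a < b\<close> \<open>e > 0\<close> by (auto simp: t_def dist_real_def)
    then have "Some (\<sigma> t) \<in> ?I (ball x r1)" using e a0 bL by auto
    then show False using after_a[OF t(1,2)] ball_subset_cball by blast
  qed
  with aI have a1: "Some (\<sigma> a) \<in> ?I (sphere x r1)"
    by (auto simp: cball_split)
  have "Some (\<sigma> b) \<in> ?I (cball x r2)"
  proof -
    have cl: "closed {t \<in> {0..L}. Some (\<sigma> t) \<in> ?I (cball x r2)}"
      by (intro closedI closedin_image_cball[OF f sub])
    have "{0..<b} \<subseteq> {t \<in> {0..L}. Some (\<sigma> t) \<in> ?I (cball x r2)}"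
    proof
      fix t assume "t \<in> {0..<b}"
      then show "t \<in> {t \<in> {0..L}. Some (\<sigma> t) \<in> ?I (cball x r2)}"
        using before_b[of t] bL ball_subset_cball[of x r2] by auto
    qed
    then have "closure {0..<b} \<subseteq> {t \<in> {0..L}. Some (\<sigma> t) \<in> ?I (cball x r2)}"
      by (rule closure_minimal[OF _ cl])
    then show ?thesis using \<open>b > 0\<close> by (simp add: closure_atLeastLessThan subset_iff)
  qed
  moreover have "Some (\<sigma> b) \<notin> ?I (ball x r2)" using b(1) by (auto simp: X_def)
  ultimately have b1: "Some (\<sigma> b) \<in> ?I (sphere x r2)"
    by (auto simp: cball_split)
  obtain g where g: "continuous_map (subtopology ext_top (f ` D)) ext_top g" "\<And>q. q \<in> D \<Longrightarrow> g (f q) = q"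
    using homeo_intoD(3)[OF f] by blast
  have g_in: "g (Some (\<sigma> t)) \<in> Some ` S \<and> f (g (Some (\<sigma> t))) = Some (\<sigma> t)"
    if S: "Some (\<sigma> t) \<in> ?I S" "S \<subseteq> cball x r2" for S t
  proof -
    obtain y where y: "y \<in> S" "Some (\<sigma> t) = f (Some y)" using S(1) by auto
    then have "Some y \<in> D" using sub S(2) by auto
    with y g(2) show ?thesis by auto
  qed
  have inb: "Some (\<sigma> t) \<in> ?I (cball x r2)" if "t \<in> {a..b}" for t
  proof (cases "t = b")
    case True then show ?thesis using \<open>Some (\<sigma> b) \<in> ?I (cball x r2)\<close> by simp
  next
    case False
    then have "Some (\<sigma> t) \<in> ?I (ball x r2)" using that before_b[of t] a0 by auto
    then show ?thesis using ball_subset_cball by blast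
  qed
  have sphere1: "sphere x r1 \<subseteq> cball x r2" using r by auto
  show ?thesis
  proof
    show "0 \<le> a" "a < b" "b \<le> L" by fact+
    show "f (g (Some (\<sigma> t))) = Some (\<sigma> t)" if "t \<in> {a..b}" for t
      using g_in[OF inb[OF that]] by simp
    have "continuous_map (top_of_set {a..b}) (subtopology ext_top (f ` D)) (\<lambda>t. Some (\<sigma> t))"
      unfolding continuous_map_in_subtopology
    proof
      have "continuous_map (subtopology (top_of_set {0..L}) {a..b}) ext_top (\<lambda>t. Some (\<sigma> t))"
        by (rule continuous_map_from_subtopology[OF con])
      moreover have "subtopology (top_of_set {0..L}) {a..b} = top_of_set {a..b}"
        using a0 bL by (simp add: subtopology_subtopology Int_absorb1)
      ultimately show "continuous_map (top_of_set {a..b}) ext_top (\<lambda>t. Some (\<sigma> t))" by simp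
      show "(\<lambda>t. Some (\<sigma> t)) \<in> topspace (top_of_set {a..b}) \<rightarrow> f ` D"
        using inb image_mono[OF sub, of f] by (simp add: Pi_iff subset_iff)
    qed
    then have "continuous_map (top_of_set {a..b}) ext_top (\<lambda>t. g (Some (\<sigma> t)))"
      using continuous_map_compose[OF _ g(1)] by (simp add: o_def)
    moreover have "g (Some (\<sigma> t)) \<in> Some ` {y. r1 < dist x y \<and> dist x y < r2}" if "t \<in> {a<..<b}" for t
    proof -
      have "Some (\<sigma> t) \<in> ?I {y. r1 < dist x y \<and> dist x y < r2}"
      proof -
        obtain y where y: "y \<in> ball x r2" "Some (\<sigma> t) = f (Some y)"
          using before_b[of t] \<open>t \<in> {a<..<b}\<close> a0 by auto
        then have "y \<notin> cball x r1" using after_a[of t] \<open>t \<in> {a<..<b}\<close> by auto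
        with y show ?thesis by auto
      qed
      then show ?thesis by (intro g_in[THEN conjunct1]) auto
    qed
    ultimately show "(a, b, \<lambda>t. g (Some (\<sigma> t))) \<in> joining_curves (Some ` sphere x r1) (Some ` sphere x r2)
        (Some ` {y. r1 < dist x y \<and> dist x y < r2})"
      using \<open>a < b\<close> g_in[OF a1 sphere1] g_in[OF b1 sphere_cball] by (simp add: joining_curves_def)
  qed
qed

section \<open>Polylines\<close>

text \<open>Line integral along the segment, over the fixed interval \<open>{0..1}\<close>. In this
  form the integrand is jointly measurable in \<open>t\<close> and \<open>y\<close>, as the later
  exchange of integrals requires.\<close>

definition segment_integral :: "('a::euclidean_space \<Rightarrow> ennreal) \<Rightarrow> 'a \<Rightarrow> 'a \<Rightarrow> ennreal" where
  "segment_integral \<rho> z y = ennreal (norm (y - z)) * (\<integral>\<^sup>+ t \<in> {0..1}. \<rho> (z + t *\<^sub>R (y - z)) \<partial>lborel)"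

text \<open>Unit speed on both legs, so that parameter and arc length agree up to a shift. A
  degenerate leg causes no trouble because \<open>sgn 0 = 0\<close>.\<close>

definition polyline :: "'a::euclidean_space \<Rightarrow> 'a \<Rightarrow> 'a \<Rightarrow> real \<Rightarrow> 'a" where
  "polyline z y w t = (if t \<le> norm (y - z) then z + t *\<^sub>R sgn (y - z)
     else y + (t - norm (y - z)) *\<^sub>R sgn (w - y))"

text \<open>Isometric legs on both sides of the corner \<open>c\<close> make the curve 1-Lipschitz,
  which bounds all sums by telescoping; the partition through the corner attains the bound. The
  corner may lie outside \<open>{a..b}\<close>, since a crossing subcurve need not contain
  it.\<close>

lemma curve_length_unit_speed:
  fixes g :: "real \<Rightarrow> 'a::metric_space"
  assumes 1: "\<And>s t. a \<le> s \<Longrightarrow> s \<le> t \<Longrightarrow> t \<le> b \<Longrightarrow> t \<le> c \<Longrightarrow> dist (g s) (g t) = t - s"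
    and 2: "\<And>s t. a \<le> s \<Longrightarrow> c \<le> s \<Longrightarrow> s \<le> t \<Longrightarrow> t \<le> b \<Longrightarrow> dist (g s) (g t) = t - s"
    and u: "a \<le> u" "u \<le> b"
  shows "curve_length a u g = ennreal (u - a)"
proof (rule antisym)
  have lip: "dist (g s) (g t) \<le> t - s" if "a \<le> s" "s \<le> t" "t \<le> b" for s t
  proof (cases "t \<le> c \<or> c \<le> s")
    case True then show ?thesis using 1[of s t] 2[of s t] that by auto
  next
    case False
    then show ?thesis
      using 1[of s c] 2[of c t] that dist_triangle[of "g s" "g t" "g c"] by auto
  qed
  show "curve_length a u g \<le> ennreal (u - a)"
    unfolding curve_length_def
  proof (rule SUP_least, clarify)
    fix t :: "real list" assume t: "sorted t" "set t \<subseteq> {a..u}"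
    show "(\<Sum>i<length t - 1. ennreal (dist (g (t ! i)) (g (t ! Suc i)))) \<le> ennreal (u - a)"
    proof (cases "t = []")
      case False
      have in_t: "t ! i \<in> {a..u}" if "i < length t" for i using t(2) that nth_mem by blast
      have "(\<Sum>i<length t - 1. dist (g (t ! i)) (g (t ! Suc i))) \<le> (\<Sum>i<length t - 1. t ! Suc i - t ! i)"
      proof (rule sum_mono)
        fix i assume "i \<in> {..<length t - 1}"
        then have i: "Suc i < length t" by auto
        show "dist (g (t ! i)) (g (t ! Suc i)) \<le> t ! Suc i - t ! i"
          using i in_t[of i] in_t[of "Suc i"] sorted_nth_mono[OF t(1), of i "Suc i"] u by (intro lip) auto
      qed
      also have "\<dots> = t ! (length t - 1) - t ! 0" by (rule sum_lessThan_telescope)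
      also have "\<dots> \<le> u - a" using in_t[of 0] in_t[of "length t - 1"] False by auto
      finally show ?thesis by (simp add: sum_ennreal ennreal_leI)
    qed simp
  qed
  have le: "(\<Sum>i<length t - 1. ennreal (dist (g (t ! i)) (g (t ! Suc i)))) \<le> curve_length a u g"
    if "sorted t" "set t \<subseteq> {a..u}" for t
    unfolding curve_length_def using that by (intro SUP_upper) auto
  show "ennreal (u - a) \<le> curve_length a u g"
  proof (cases "u \<le> c \<or> c \<le> a")
    case True
    then have "dist (g a) (g u) = u - a" using 1[of a u] 2[of a u] u by auto
    then show ?thesis using le[of "[a, u]"] u by auto
  next
    case False
    then have "dist (g a) (g c) = c - a" "dist (g c) (g u) = u - c" using 1[of a c] 2[of c u] u by auto
    then show ?thesis using le[of "[a, c, u]"] u False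
      by (auto simp: lessThan_Suc numeral_2_eq_2 simp flip: ennreal_plus)
  qed
qed

text \<open>The length function is \<open>u - a\<close>, hence injective, so the choice in
  \<open>arclength_param\<close> has the single candidate \<open>a + s\<close>.\<close>

lemma line_integral_unit_speed:
  fixes g :: "real \<Rightarrow> real ^ 'n::finite"
  assumes 1: "\<And>s t. a \<le> s \<Longrightarrow> s \<le> t \<Longrightarrow> t \<le> b \<Longrightarrow> t \<le> c \<Longrightarrow> dist (g s) (g t) = t - s"
    and 2: "\<And>s t. a \<le> s \<Longrightarrow> c \<le> s \<Longrightarrow> s \<le> t \<Longrightarrow> t \<le> b \<Longrightarrow> dist (g s) (g t) = t - s"
    and ab: "a < b" and g: "continuous_on UNIV g" and \<gamma>: "\<And>t. t \<in> {a..b} \<Longrightarrow> \<gamma> t = Some (g t)"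
    and \<rho> [measurable]: "\<rho> \<in> borel_measurable borel"
  shows "line_integral \<rho> (a, b, \<gamma>) = (\<integral>\<^sup>+ t \<in> {a..b}. \<rho> (g t) \<partial>lborel)"
proof -
  have [measurable]: "g \<in> borel_measurable borel" by (rule borel_measurable_continuous_onI[OF g])
  have len: "curve_length a u (the \<circ> \<gamma>) = ennreal (u - a)" if "a \<le> u" "u \<le> b" for u
    using that \<gamma> 1 2 by (intro curve_length_unit_speed[where b=b and c=c]) auto
  have par: "arclength_param a b (the \<circ> \<gamma>) s = g (a + s)" if "s \<in> {0..b - a}" for s
  proof -
    have "t \<in> {a..b} \<and> curve_length a t (the \<circ> \<gamma>) = ennreal s \<longleftrightarrow> t = a + s" for t
      using that len[of t] by (auto simp: ennreal_inj)
    then show ?thesis using that \<gamma> by (simp add: arclength_param_def)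
  qed
  have "rectifiable_curve (a, b, \<gamma>)"
    using \<gamma> len[of b] ab by (auto simp: rectifiable_curve_def)
  then have "line_integral \<rho> (a, b, \<gamma>)
      = (\<integral>\<^sup>+ s \<in> {0..b - a}. \<rho> (arclength_param a b (the \<circ> \<gamma>) s) \<partial>lborel)"
    using len[of b] ab by (simp add: line_integral_def)
  also have "\<dots> = (\<integral>\<^sup>+ s. \<rho> (g (a + 1 * s)) * indicator {a..b} (a + 1 * s) \<partial>lborel)"
    by (intro nn_integral_cong) (auto simp: par split: split_indicator)
  also have "\<dots> = (\<integral>\<^sup>+ t \<in> {a..b}. \<rho> (g t) \<partial>lborel)"
    using nn_integral_real_affine[of "\<lambda>t. \<rho> (g t) * indicator {a..b} t" 1 a] by simp
  finally show ?thesis .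
qed

lemma polyline_0 [simp]: "polyline z y w 0 = z"
  by (simp add: polyline_def)

lemma scaleR_norm_sgn: "norm x *\<^sub>R sgn x = (x :: 'a::real_normed_vector)"
  by (cases "x = 0") (simp_all add: sgn_div_norm)

lemma polyline_end [simp]: "polyline z y w (norm (y - z) + norm (w - y)) = w"
  by (cases "w = y") (auto simp: polyline_def scaleR_norm_sgn)

lemma polyline_second_leg:
  "norm (y - z) \<le> t \<Longrightarrow> polyline z y w t = y + (t - norm (y - z)) *\<^sub>R sgn (w - y)"
  by (auto simp: polyline_def scaleR_norm_sgn)

lemma continuous_polyline: "continuous_on UNIV (polyline z y w)"
proof -
  have "continuous_on ({..norm (y - z)} \<union> {norm (y - z)..})
     (\<lambda>t. if t \<le> norm (y - z) then z + t *\<^sub>R sgn (y - z)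
     else y + (t - norm (y - z)) *\<^sub>R sgn (w - y))"
    by (rule continuous_on_If) (auto intro!: continuous_intros simp: scaleR_norm_sgn)
  moreover have "{..norm (y - z)} \<union> {norm (y - z)..} = UNIV" by auto
  ultimately show ?thesis unfolding polyline_def by simp
qed

lemma dist_polyline_first_leg:
  assumes "0 \<le> s" "s \<le> t" "t \<le> norm (y - z)"
  shows "dist (polyline z y w s) (polyline z y w t) = t - s"
proof -
  have "polyline z y w s - polyline z y w t = (s - t) *\<^sub>R sgn (y - z)"
    using assms by (simp add: polyline_def algebra_simps)
  then show ?thesis using assms by (cases "y = z") (simp_all add: dist_norm norm_sgn)
qed

lemma dist_polyline_second_leg:
  assumes "norm (y - z) \<le> s" "s \<le> t" "t \<le> norm (y - z) + norm (w - y)"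
  shows "dist (polyline z y w s) (polyline z y w t) = t - s"
proof -
  have "polyline z y w s - polyline z y w t = (s - t) *\<^sub>R sgn (w - y)"
    using assms by (simp add: polyline_second_leg algebra_simps)
  then show ?thesis using assms by (cases "w = y") (simp_all add: dist_norm norm_sgn)
qed

lemma nn_integral_polyline_le:
  assumes [measurable]: "\<rho> \<in> borel_measurable borel"
  shows "(\<integral>\<^sup>+ t \<in> {0..norm (y - z) + norm (w - y)}. \<rho> (polyline z y w t) \<partial>lborel)
    \<le> segment_integral \<rho> z y + segment_integral \<rho> w y"
proof -
  let ?l = "norm (y - z)" and ?m = "norm (w - y)" and ?p = "polyline z y w"
  have [measurable]: "?p \<in> borel_measurable borel"
    by (rule borel_measurable_continuous_onI[OF continuous_polyline])
  have 1: "(\<integral>\<^sup>+ t \<in> {0..?l}. \<rho> (?p t) \<partial>lborel) \<le> segment_integral \<rho> z y"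
  proof (cases "y = z")
    case True
    have "(\<integral>\<^sup>+ t \<in> {0}. \<rho> (?p t) \<partial>lborel) = 0"
      by (intro nn_integral_null_set) (simp add: null_sets_def)
    then show ?thesis using True by simp
  next
    case False
    have "(\<integral>\<^sup>+ t \<in> {0..?l}. \<rho> (?p t) \<partial>lborel)
        = ?l * (\<integral>\<^sup>+ t. \<rho> (?p (0 + ?l * t)) * indicator {0..?l} (0 + ?l * t) \<partial>lborel)"
      using nn_integral_real_affine[of "\<lambda>t. \<rho> (?p t) * indicator {0..?l} t" ?l 0] False by simp
    also have "\<dots> = segment_integral \<rho> z y"
    proof -
      have "?p (0 + ?l * t) = z + t *\<^sub>R (y - z)" if "t \<le> 1" for t
      proof -
        have "?l * t \<le> ?l" using that by (simp add: mult_left_le)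
        then have "?p (0 + ?l * t) = z + (?l * t) *\<^sub>R sgn (y - z)" by (simp add: polyline_def)
        also have "(?l * t) *\<^sub>R sgn (y - z) = t *\<^sub>R (?l *\<^sub>R sgn (y - z))" by simp
        finally show ?thesis unfolding scaleR_norm_sgn .
      qed
      moreover have "indicator {0..?l} (0 + ?l * t) = (indicator {0..1} t :: ennreal)" for t
        using False mult_le_cancel_left_pos[of ?l t 1] mult_le_cancel_left_pos[of ?l 0 t]
        by (simp add: indicator_def)
      ultimately have "\<rho> (?p (0 + ?l * t)) * indicator {0..?l} (0 + ?l * t) = \<rho> (z + t *\<^sub>R (y - z)) * indicator {0..1} t" for t
        by (cases "t \<in> {0..1}") simp_all
      then show ?thesis
        unfolding segment_integral_def
        by (intro arg_cong[where f="\<lambda>u. ennreal ?l * u"] nn_integral_cong) simp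
    qed
    finally show ?thesis by simp
  qed
  have 2: "(\<integral>\<^sup>+ t \<in> {?l..?l + ?m}. \<rho> (?p t) \<partial>lborel) \<le> segment_integral \<rho> w y"
  proof (cases "w = y")
    case True
    have "(\<integral>\<^sup>+ t \<in> {?l}. \<rho> (?p t) \<partial>lborel) = 0"
      by (intro nn_integral_null_set) (simp add: null_sets_def)
    then show ?thesis using True by simp
  next
    case False
    \<comment> \<open>The substitution runs backwards, with factor \<open>- ?m\<close>:
      \<open>segment_integral \<rho> w y\<close> starts at \<open>w\<close>, where the polyline
      ends.\<close>
    have "(\<integral>\<^sup>+ t \<in> {?l..?l + ?m}. \<rho> (?p t) \<partial>lborel)
        = ?m * (\<integral>\<^sup>+ t. \<rho> (?p ((?l + ?m) + (- ?m) * t)) * indicator {?l..?l + ?m} ((?l + ?m) + (- ?m) * t) \<partial>lborel)"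
      using nn_integral_real_affine[of "\<lambda>t. \<rho> (?p t) * indicator {?l..?l + ?m} t" "- ?m" "?l + ?m"] False
      by simp
    also have "\<dots> = segment_integral \<rho> w y"
    proof -
      have "?p ((?l + ?m) + (- ?m) * t) = w + t *\<^sub>R (y - w)" if "t \<le> 1" for t
      proof -
        have "?m * t \<le> ?m" using that by (simp add: mult_left_le)
        then have "?l \<le> (?l + ?m) + (- ?m) * t" by simp
        then have "?p ((?l + ?m) + (- ?m) * t) = y + ((1 - t) * ?m) *\<^sub>R sgn (w - y)"
          by (simp add: polyline_second_leg algebra_simps)
        also have "((1 - t) * ?m) *\<^sub>R sgn (w - y) = (1 - t) *\<^sub>R (?m *\<^sub>R sgn (w - y))" by simp
        also note scaleR_norm_sgn
        finally show ?thesis by (simp add: algebra_simps)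
      qed
      moreover have "indicator {?l..?l + ?m} ((?l + ?m) + (- ?m) * t) = (indicator {0..1} t :: ennreal)" for t
        using False mult_le_cancel_left_pos[of ?m t 1] mult_le_cancel_left_pos[of ?m 0 t]
        by (auto simp: indicator_def)
      ultimately have "\<rho> (?p ((?l + ?m) + (- ?m) * t)) * indicator {?l..?l + ?m} ((?l + ?m) + (- ?m) * t) = \<rho> (w + t *\<^sub>R (y - w)) * indicator {0..1} t" for t
        by (cases "t \<in> {0..1}") simp_all
      then show ?thesis
        unfolding segment_integral_def norm_minus_commute[of y w]
        by (intro arg_cong[where f="\<lambda>u. ennreal ?m * u"] nn_integral_cong) simp
    qed
    finally show ?thesis by simp
  qed
  have "(\<integral>\<^sup>+ t \<in> {0..?l + ?m}. \<rho> (?p t) \<partial>lborel)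
      \<le> (\<integral>\<^sup>+ t. \<rho> (?p t) * indicator {0..?l} t + \<rho> (?p t) * indicator {?l..?l + ?m} t \<partial>lborel)"
    by (intro nn_integral_mono) (auto split: split_indicator)
  also have "\<dots> = (\<integral>\<^sup>+ t \<in> {0..?l}. \<rho> (?p t) \<partial>lborel) + (\<integral>\<^sup>+ t \<in> {?l..?l + ?m}. \<rho> (?p t) \<partial>lborel)"
    by (intro nn_integral_add) auto
  finally show ?thesis using 1 2 by (meson add_mono dual_order.trans)
qed

section \<open>A lower bound for the modulus\<close>

lemma nn_integral_affine:
  fixes f :: "'a::euclidean_space \<Rightarrow> ennreal"
  assumes [measurable]: "f \<in> borel_measurable borel" and c: "c \<noteq> 0"
  shows "(\<integral>\<^sup>+ x. f x \<partial>lborel) = ennreal (\<bar>c\<bar> ^ DIM('a)) * (\<integral>\<^sup>+ x. f (t + c *\<^sub>R x) \<partial>lborel)"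
  by (subst lborel_affine[OF c, of t]) (simp add: nn_integral_density nn_integral_distr nn_integral_cmult ennreal_power)

text \<open>Either \<open>x \<le> s\<close>, or \<open>(x / s) ^ (n - 1) \<ge> 1\<close> and the
  second term alone dominates. Integrated over a ball with a well chosen \<open>s\<close>, this
  serves as Hoelder's inequality.\<close>

lemma ennreal_le_plus_power:
  fixes x :: ennreal
  assumes "0 < s" "0 < n"
  shows "x \<le> ennreal s + ennreal (1 / s ^ (n - 1)) * x ^ n"
proof (cases "x \<le> ennreal s")
  case False
  then have "ennreal s ^ (n - 1) \<le> x ^ (n - 1)" by (intro power_mono) auto
  then have "ennreal (1 / s ^ (n - 1)) * ennreal s ^ (n - 1) * x \<le> ennreal (1 / s ^ (n - 1)) * x ^ (n - 1) * x"
    by (intro mult_left_mono mult_right_mono) auto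
  moreover have "ennreal (1 / s ^ (n - 1)) * ennreal s ^ (n - 1) = 1"
    using assms by (simp add: ennreal_power flip: ennreal_mult)
  moreover have "x ^ n = x ^ (n - 1) * x"
    using assms by (metis Suc_diff_1 power_Suc2)
  ultimately show ?thesis
    by (metis add_increasing mult.assoc mult.left_neutral zero_le)
qed (simp add: add_increasing2)

lemma ennreal_linear_combination:
  assumes "0 \<le> a" "0 \<le> b" "0 \<le> c" "0 \<le> d"
  shows "ennreal a * ennreal b + ennreal c * ennreal d = ennreal (a * b + c * d)"
  using assms by (simp add: ennreal_mult)

lemma nn_integral_ball_le_of_power:
  fixes \<rho> :: "'a::euclidean_space \<Rightarrow> ennreal"
  assumes [measurable]: "\<rho> \<in> borel_measurable borel" and "0 < r" "0 < k"
    and good: "(\<integral>\<^sup>+ x \<in> ball z r. \<rho> x ^ DIM('a) \<partial>lborel) \<le> ennreal (k ^ DIM('a) * r)"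
  shows "(\<integral>\<^sup>+ x \<in> ball z r. \<rho> x \<partial>lborel)
    \<le> ennreal ((unit_ball_vol (DIM('a)) + 1) * k * r powr (1 / DIM('a) - 1) * r ^ DIM('a))"
proof -
  let ?n = "DIM('a)"
  \<comment> \<open>This level balances the two terms: \<open>s ^ n * r ^ n = k ^ n * r\<close>, so
    the integral of the second one is \<open>s * r ^ n\<close>, comparable with that of the
    first.\<close>
  define s where "s = k * r powr (1 / ?n - 1)"
  have s: "s > 0" using assms by (simp add: s_def)
  have [measurable]: "ball z r \<in> sets borel" by simp
  have "s ^ ?n * r ^ ?n = k ^ ?n * (r powr (1 / ?n - 1) * r powr 1) ^ ?n"
    using \<open>0 < r\<close> by (simp add: s_def power_mult_distrib)
  also have "r powr (1 / ?n - 1) * r powr 1 = r powr (1 / ?n)"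
    by (subst powr_add[symmetric]) simp
  also have "(r powr (1 / ?n)) ^ ?n = r"
    using \<open>0 < r\<close> by (simp add: powr_powr flip: powr_realpow)
  finally have sr: "s ^ ?n * r ^ ?n = k ^ ?n * r" .
  have "(\<integral>\<^sup>+ x \<in> ball z r. \<rho> x \<partial>lborel) \<le>
      (\<integral>\<^sup>+ x. ennreal s * indicator (ball z r) x + ennreal (1 / s ^ (?n - 1)) * (\<rho> x ^ ?n * indicator (ball z r) x) \<partial>lborel)"
    using ennreal_le_plus_power[OF s, of ?n] by (intro nn_integral_mono) (auto split: split_indicator)
  also have "\<dots> = ennreal s * emeasure lborel (ball z r)
      + ennreal (1 / s ^ (?n - 1)) * (\<integral>\<^sup>+ x \<in> ball z r. \<rho> x ^ ?n \<partial>lborel)"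
    by (simp add: nn_integral_add nn_integral_cmult nn_integral_cmult_indicator)
  also have "\<dots> \<le> ennreal s * ennreal (unit_ball_vol ?n * r ^ ?n) + ennreal (1 / s ^ (?n - 1)) * ennreal (k ^ ?n * r)"
    using \<open>0 < r\<close> by (intro add_mono mult_left_mono good) (auto simp: emeasure_ball)
  also have "\<dots> = ennreal (s * (unit_ball_vol ?n * r ^ ?n) + 1 / s ^ (?n - 1) * (s ^ ?n * r ^ ?n))"
    unfolding sr using s \<open>0 < r\<close> \<open>0 < k\<close> by (intro ennreal_linear_combination) auto
  also have "1 / s ^ (?n - 1) * (s ^ ?n * r ^ ?n) = s * r ^ ?n"
    using s power_minus_mult[of ?n s] by (simp add: field_simps DIM_positive)
  finally show ?thesis by (simp add: s_def algebra_simps)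
qed

lemma nn_integral_powr_unit_interval:
  assumes "0 < (n::nat)"
  shows "(\<integral>\<^sup>+ t \<in> {0..1}. ennreal (t powr (1 / n - 1)) \<partial>lborel) = ennreal n"
proof -
  have "((\<lambda>t::real. t powr (1 / n - 1)) has_integral (1 powr (1 / n - 1 + 1) / (1 / n - 1 + 1))) {0..1}"
    using assms by (intro has_integral_powr_from_0) auto
  then have "((\<lambda>t::real. t powr (1 / n - 1)) has_integral n) {0..1}"
    using assms by simp
  then have "((\<lambda>t::real. if t \<in> {0..1} then t powr (1 / n - 1) else 0) has_integral n) UNIV"
    by (simp only: has_integral_restrict_UNIV)
  then have "(\<integral>\<^sup>+ t. ennreal (if t \<in> {0..1} then t powr (1 / n - 1) else 0) \<partial>lborel) = ennreal n"
    by (intro nn_integral_has_integral_lborel) auto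
  moreover have "(\<integral>\<^sup>+ t \<in> {0..1}. ennreal (t powr (1 / n - 1)) \<partial>lborel)
      = (\<integral>\<^sup>+ t. ennreal (if t \<in> {0..1} then t powr (1 / n - 1) else 0) \<partial>lborel)"
    by (intro nn_integral_cong) (auto split: split_indicator)
  ultimately show ?thesis by simp
qed

text \<open>Scaling about \<open>z\<close> by \<open>t\<close> turns the integral over the segments from \<open>z\<close> into integrals of
  \<open>\<rho>\<close> over the balls of radius \<open>2Rt\<close> about \<open>z\<close>; these are \<open>O(t powr (n - 1 + 1/n))\<close>.\<close>

lemma nn_integral_segment_integral_le:
  fixes \<rho> :: "'a::euclidean_space \<Rightarrow> ennreal"
  assumes [measurable]: "\<rho> \<in> borel_measurable borel" and "0 < R" "0 < k" and z: "z \<in> ball 0 R"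
    and good: "\<And>r. 0 < r \<Longrightarrow> r \<le> 2 * R \<Longrightarrow>
        (\<integral>\<^sup>+ x \<in> ball z r. \<rho> x ^ DIM('a) \<partial>lborel) \<le> ennreal (k ^ DIM('a) * r)"
  shows "(\<integral>\<^sup>+ y \<in> ball 0 R. segment_integral \<rho> z y \<partial>lborel)
    \<le> ennreal (2 * R * ((unit_ball_vol (DIM('a)) + 1) * (2 * R) powr (1 / DIM('a) - 1) * (2 * R) ^ DIM('a) * DIM('a)) * k)"
proof -
  let ?n = "DIM('a)"
  define C where "C = (unit_ball_vol ?n + 1) * k * (2 * R) powr (1 / ?n - 1) * (2 * R) ^ ?n"
  have [measurable]: "ball z (2 * R) \<in> sets borel" by simp
  have C: "C \<ge> 0" using \<open>0 < R\<close> \<open>0 < k\<close> by (simp add: C_def)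
  have inner: "(\<integral>\<^sup>+ y \<in> ball z (2 * R). \<rho> (z + t *\<^sub>R (y - z)) \<partial>lborel) \<le> ennreal (C * t powr (1 / ?n - 1))"
    if t: "0 < t" "t \<le> 1" for t
  proof -
    have [measurable]: "ball z (2 * R * t) \<in> sets borel" by simp
    let ?h = "\<lambda>w. \<rho> w * indicator (ball z (2 * R * t)) w"
    have ind: "indicator (ball z (2 * R * t)) ((z - t *\<^sub>R z) + t *\<^sub>R y) = (indicator (ball z (2 * R)) y :: ennreal)" for y
    proof -
      have "dist z ((z - t *\<^sub>R z) + t *\<^sub>R y) = norm (t *\<^sub>R (z - y))"
        by (simp add: dist_norm algebra_simps)
      also have "\<dots> = t * dist z y" using t by (simp add: dist_norm)
      finally show ?thesis using t by (simp add: indicator_def mult.commute)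
    qed
    have "(\<integral>\<^sup>+ w. ?h w \<partial>lborel) = ennreal (t ^ ?n) * (\<integral>\<^sup>+ y. ?h ((z - t *\<^sub>R z) + t *\<^sub>R y) \<partial>lborel)"
      using nn_integral_affine[of ?h t "z - t *\<^sub>R z"] t by simp
    also have "(\<integral>\<^sup>+ y. ?h ((z - t *\<^sub>R z) + t *\<^sub>R y) \<partial>lborel)
        = (\<integral>\<^sup>+ y \<in> ball z (2 * R). \<rho> (z + t *\<^sub>R (y - z)) \<partial>lborel)"
      unfolding ind by (simp add: algebra_simps)
    finally have "ennreal (t ^ ?n) * (\<integral>\<^sup>+ y \<in> ball z (2 * R). \<rho> (z + t *\<^sub>R (y - z)) \<partial>lborel) = (\<integral>\<^sup>+ w. ?h w \<partial>lborel)"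
      by simp
    also have "\<dots> \<le> ennreal ((unit_ball_vol ?n + 1) * k * (2 * R * t) powr (1 / ?n - 1) * (2 * R * t) ^ ?n)"
      using t \<open>0 < R\<close> \<open>0 < k\<close> by (intro nn_integral_ball_le_of_power good) (auto simp: mult_left_le)
    also have "\<dots> = ennreal (t ^ ?n) * ennreal (C * t powr (1 / ?n - 1))"
      using t \<open>0 < R\<close> \<open>0 < k\<close>
      by (simp add: C_def powr_mult power_mult_distrib ac_simps flip: ennreal_mult)
    finally show ?thesis
      using t by (subst (asm) ennreal_mult_le_mult_iff) auto
  qed
  have "(\<integral>\<^sup>+ y \<in> ball 0 R. segment_integral \<rho> z y \<partial>lborel)
      \<le> (\<integral>\<^sup>+ y. ennreal (2 * R) * (\<integral>\<^sup>+ t. \<rho> (z + t *\<^sub>R (y - z)) * indicator {0..1} t * indicator (ball z (2 * R)) y \<partial>lborel) \<partial>lborel)"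
  proof (rule nn_integral_mono)
    fix y
    show "segment_integral \<rho> z y * indicator (ball 0 R) y
       \<le> ennreal (2 * R) * (\<integral>\<^sup>+ t. \<rho> (z + t *\<^sub>R (y - z)) * indicator {0..1} t * indicator (ball z (2 * R)) y \<partial>lborel)"
    proof (cases "y \<in> ball 0 R")
      case True
      have le: "norm (y - z) < 2 * R"
        using True z norm_triangle_ineq4[of y z] by simp
      then have "y \<in> ball z (2 * R)" by (simp add: dist_norm norm_minus_commute)
      then show ?thesis
        using True le by (auto simp: segment_integral_def intro!: mult_right_mono ennreal_leI)
    qed simp
  qed
  also have "\<dots> = ennreal (2 * R) * (\<integral>\<^sup>+ y. (\<integral>\<^sup>+ t. \<rho> (z + t *\<^sub>R (y - z)) * indicator {0..1} t * indicator (ball z (2 * R)) y \<partial>lborel) \<partial>lborel)"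
    by (rule nn_integral_cmult) measurable
  also have "(\<integral>\<^sup>+ y. (\<integral>\<^sup>+ t. \<rho> (z + t *\<^sub>R (y - z)) * indicator {0..1} t * indicator (ball z (2 * R)) y \<partial>lborel) \<partial>lborel)
      = (\<integral>\<^sup>+ t. (\<integral>\<^sup>+ y. \<rho> (z + t *\<^sub>R (y - z)) * indicator {0..1} t * indicator (ball z (2 * R)) y \<partial>lborel) \<partial>lborel)"
    by (rule lborel_pair.Fubini') measurable
  also have "\<dots> \<le> (\<integral>\<^sup>+ t. ennreal C * (ennreal (t powr (1 / ?n - 1)) * indicator {0..1} t) \<partial>lborel)"
  proof (rule nn_integral_mono_AE)
    \<comment> \<open>The value \<open>t = 0\<close> must be left out: there
      \<open>0 powr (1 / n - 1) = 0\<close>, while the left side may be positive.\<close>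
    have "AE t in lborel. t \<noteq> (0::real)" by (rule AE_lborel_singleton)
    then show "AE t in lborel. (\<integral>\<^sup>+ y. \<rho> (z + t *\<^sub>R (y - z)) * indicator {0..1} t * indicator (ball z (2 * R)) y \<partial>lborel)
      \<le> ennreal C * (ennreal (t powr (1 / ?n - 1)) * indicator {0..1} t)"
    proof eventually_elim
      case (elim t)
      show ?case
        using inner[of t] elim C by (cases "t \<in> {0..1}") (auto simp: ennreal_mult)
    qed
  qed
  also have "\<dots> = ennreal C * ennreal ?n"
    by (subst nn_integral_cmult) (auto simp: nn_integral_powr_unit_interval)
  finally have "(\<integral>\<^sup>+ y \<in> ball 0 R. segment_integral \<rho> z y \<partial>lborel) \<le> ennreal (2 * R) * (ennreal C * ennreal ?n)"
    by (simp add: mult_left_mono)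
  also have "\<dots> = ennreal (2 * R * (C * ?n))"
    using C \<open>0 < R\<close> by (simp add: ennreal_mult)
  finally show ?thesis by (simp add: C_def algebra_simps)
qed

text \<open>Countable subadditivity with the sum written as an integral over
  \<open>count_space I\<close>, so that the countable index sets produced by Vitali's lemma can be
  used without enumerating them.\<close>

lemma emeasure_UN_le_count_space:
  assumes "countable I" and X: "\<And>i. i \<in> I \<Longrightarrow> X i \<in> sets M"
  shows "emeasure M (\<Union>i\<in>I. X i) \<le> (\<integral>\<^sup>+ i. emeasure M (X i) \<partial>count_space I)"
proof -
  have "emeasure M (\<Union>i\<in>I. X i) = (\<integral>\<^sup>+ x. indicator (\<Union>i\<in>I. X i) x \<partial>M)"
    using assms by (intro nn_integral_indicator[symmetric] sets.countable_UN'') auto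
  also have "\<dots> \<le> (\<integral>\<^sup>+ x. (\<integral>\<^sup>+ i. indicator (X i) x \<partial>count_space I) \<partial>M)"
  proof (rule nn_integral_mono)
    fix x
    show "indicator (\<Union>i\<in>I. X i) x \<le> (\<integral>\<^sup>+ i. indicator (X i) x \<partial>count_space I)"
    proof (cases "x \<in> (\<Union>i\<in>I. X i)")
      case True
      then obtain j where j: "j \<in> I" "x \<in> X j" by blast
      have "1 = (\<integral>\<^sup>+ i. indicator {j} i \<partial>count_space I)"
        using j(1) by (simp add: one_ennreal_def)
      also have "\<dots> \<le> (\<integral>\<^sup>+ i. indicator (X i) x \<partial>count_space I)"
        using j by (intro nn_integral_mono) (auto split: split_indicator)
      finally show ?thesis using True by simp
    qed simp
  qed
  also have "\<dots> = (\<integral>\<^sup>+ i. (\<integral>\<^sup>+ x. indicator (X i) x \<partial>M) \<partial>count_space I)"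
    using assms by (intro nn_integral_count_space_nn_integral) auto
  also have "\<dots> = (\<integral>\<^sup>+ i. emeasure M (X i) \<partial>count_space I)"
    using X by (intro nn_integral_cong) auto
  finally show ?thesis .
qed

text \<open>Otherwise every \<open>z \<in> E\<close> is the centre of a ball violating the bound; the radii of a disjoint
  Vitali subfamily sum up to at least \<open>\<epsilon> / 10\<close>, since the image of
  \<open>E\<close> under \<open>\<lambda>z. norm (z - e)\<close> contains \<open>[0, \<epsilon>)\<close>.\<close>

lemma exists_good_point:
  fixes g :: "'a::euclidean_space \<Rightarrow> ennreal"
  assumes [measurable]: "g \<in> borel_measurable borel" and "0 < \<kappa>" "0 < \<epsilon>"
    and small: "(\<integral>\<^sup>+ x. g x \<partial>lborel) < ennreal (\<kappa> * \<epsilon> / 10)"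
    and onto: "\<forall>s\<in>{0..<\<epsilon>}. \<exists>z\<in>E. norm (z - e) = s"
  shows "\<exists>z\<in>E. \<forall>r. 0 < r \<longrightarrow> r \<le> B \<longrightarrow> (\<integral>\<^sup>+ x \<in> ball z r. g x \<partial>lborel) \<le> ennreal (\<kappa> * r)"
proof (rule ccontr)
  assume "\<not> ?thesis"
  then have "\<forall>z. \<exists>r. z \<in> E \<longrightarrow> 0 < r \<and> r \<le> B \<and> ennreal (\<kappa> * r) < (\<integral>\<^sup>+ x \<in> ball z r. g x \<partial>lborel)"
    by (auto simp: not_le)
  then obtain r where r: "\<And>z. z \<in> E \<Longrightarrow> 0 < r z \<and> r z \<le> B"
    and bad: "\<And>z. z \<in> E \<Longrightarrow> ennreal (\<kappa> * r z) < (\<integral>\<^sup>+ x \<in> ball z (r z). g x \<partial>lborel)"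
    by metis
  have "E \<subseteq> (\<Union>z\<in>E. ball z (r z))" using r by fastforce
  then obtain C where C: "countable C" "C \<subseteq> E"
    "pairwise (\<lambda>i j. disjnt (ball i (r i)) (ball j (r j))) C" "E \<subseteq> (\<Union>i\<in>C. ball i (5 * r i))"
    using Vitali_covering_lemma_balls[of E "\<lambda>z. z" r E B] r by (metis (no_types, lifting))
  have [measurable]: "ball i (r i) \<in> sets borel" for i by simp
  \<comment> \<open>Since \<open>\<lambda>z. norm (z - e)\<close> is 1-Lipschitz, it maps the
    enlarged ball of radius \<open>5 * r i\<close> into this interval. Its length
    \<open>10 * r i\<close> is the source of the 10 in the hypothesis.\<close>
  let ?I = "\<lambda>i. {norm (i - e) - 5 * r i .. norm (i - e) + 5 * r i}"
  have "{0..<\<epsilon>} \<subseteq> (\<Union>i\<in>C. ?I i)"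
  proof
    fix s assume "s \<in> {0..<\<epsilon>}"
    then obtain z where z: "z \<in> E" "norm (z - e) = s" using onto by blast
    then obtain i where i: "i \<in> C" "dist i z < 5 * r i" using C(4) by auto
    have "\<bar>norm (z - e) - norm (i - e)\<bar> \<le> norm ((z - e) - (i - e))" by (rule norm_triangle_ineq3)
    then have "\<bar>s - norm (i - e)\<bar> \<le> dist i z" using z by (simp add: dist_norm norm_minus_commute)
    then show "s \<in> (\<Union>i\<in>C. ?I i)" using i by (intro UN_I[OF i(1)]) auto
  qed
  then have "emeasure lborel {0..<\<epsilon>} \<le> emeasure lborel (\<Union>i\<in>C. ?I i)"
    using C(1) by (intro emeasure_mono) auto
  also have "\<dots> \<le> (\<integral>\<^sup>+ i. emeasure lborel (?I i) \<partial>count_space C)"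
    using C(1) by (intro emeasure_UN_le_count_space) auto
  also have "\<dots> = (\<integral>\<^sup>+ i. ennreal (10 * r i) \<partial>count_space C)"
    using r C(2) by (intro nn_integral_cong) (auto simp: less_imp_le subset_iff)
  finally have "ennreal \<kappa> * ennreal \<epsilon> \<le> ennreal \<kappa> * (\<integral>\<^sup>+ i. ennreal (10 * r i) \<partial>count_space C)"
    using \<open>0 < \<epsilon>\<close> by (intro mult_left_mono) auto
  also have "\<dots> = (\<integral>\<^sup>+ i. ennreal 10 * ennreal (\<kappa> * r i) \<partial>count_space C)"
  proof (subst nn_integral_cmult[symmetric], simp, rule nn_integral_cong)
    fix i assume "i \<in> space (count_space C)"
    then have "0 < r i" using r C(2) by auto
    then have "ennreal \<kappa> * ennreal (10 * r i) = ennreal (\<kappa> * (10 * r i))"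
      using \<open>0 < \<kappa>\<close> by (simp add: ennreal_mult)
    also have "\<kappa> * (10 * r i) = 10 * (\<kappa> * r i)" by simp
    also have "ennreal \<dots> = ennreal 10 * ennreal (\<kappa> * r i)"
      using \<open>0 < r i\<close> \<open>0 < \<kappa>\<close> by (intro ennreal_mult) auto
    finally show "ennreal \<kappa> * ennreal (10 * r i) = ennreal 10 * ennreal (\<kappa> * r i)" .
  qed
  also have "\<dots> \<le> (\<integral>\<^sup>+ i. ennreal 10 * (\<integral>\<^sup>+ x \<in> ball i (r i). g x \<partial>lborel) \<partial>count_space C)"
    using bad C(2) by (intro nn_integral_mono mult_left_mono) (auto intro: less_imp_le)
  also have "\<dots> = ennreal 10 * (\<integral>\<^sup>+ i. (\<integral>\<^sup>+ x \<in> ball i (r i). g x \<partial>lborel) \<partial>count_space C)"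
    by (rule nn_integral_cmult) simp
  also have "(\<integral>\<^sup>+ i. (\<integral>\<^sup>+ x \<in> ball i (r i). g x \<partial>lborel) \<partial>count_space C)
      = (\<integral>\<^sup>+ i. emeasure (density lborel g) (ball i (r i)) \<partial>count_space C)"
    by (simp add: emeasure_density)
  also have "\<dots> = emeasure (density lborel g) (\<Union>i\<in>C. ball i (r i))"
    using C(1,3) by (intro emeasure_UN_countable[symmetric])
      (simp_all add: disjoint_family_on_def pairwise_def disjnt_def)
  also have "\<dots> \<le> emeasure (density lborel g) (space (density lborel g))"
    by (rule emeasure_space)
  also have "\<dots> = (\<integral>\<^sup>+ x. g x \<partial>lborel)"
    by (simp add: emeasure_density)
  finally have "ennreal \<kappa> * ennreal \<epsilon> \<le> ennreal 10 * (\<integral>\<^sup>+ x. g x \<partial>lborel)"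
    by (simp add: mult_left_mono)
  also have "\<dots> < ennreal 10 * ennreal (\<kappa> * \<epsilon> / 10)"
    using small by (intro ennreal_mult_strict_left_mono) auto
  also have "\<dots> = ennreal \<kappa> * ennreal \<epsilon>"
    using \<open>0 < \<kappa>\<close> \<open>0 < \<epsilon>\<close> ennreal_mult[of 10 "\<kappa> * \<epsilon> / 10"] ennreal_mult[of \<kappa> \<epsilon>] by simp
  finally show False by simp
qed

text \<open>From good points \<open>z\<close> and \<open>w\<close>, each family of segments has mean
  \<open>\<rho>\<close>-length at most 1/4 over \<open>y\<close> in \<open>ball 0 R\<close>. The two
  means add up to at most 1/2, so some \<open>y\<close> serves both.\<close>

lemma exists_short_polyline:
  assumes R: "0 < R" and \<epsilon>: "0 < \<epsilon>"
  shows "\<exists>\<delta>>0. \<forall>(\<rho> :: 'a::euclidean_space \<Rightarrow> ennreal) E F e e'.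
      \<rho> \<in> borel_measurable borel \<and> (\<integral>\<^sup>+ x. \<rho> x ^ DIM('a) \<partial>lborel) < ennreal \<delta> \<and>
      E \<subseteq> ball 0 R \<and> F \<subseteq> ball 0 R \<and>
      (\<forall>s\<in>{0..<\<epsilon>}. \<exists>z\<in>E. norm (z - e) = s) \<and> (\<forall>s\<in>{0..<\<epsilon>}. \<exists>z\<in>F. norm (z - e') = s)
      \<longrightarrow> (\<exists>z\<in>E. \<exists>w\<in>F. \<exists>y. segment_integral \<rho> z y + segment_integral \<rho> w y < 1)"
proof -
  let ?n = "DIM('a)"
  let ?V = "unit_ball_vol ?n * R ^ ?n"
  define K where "K = 2 * R * ((unit_ball_vol ?n + 1) * (2 * R) powr (1 / ?n - 1) * (2 * R) ^ ?n * ?n)"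
  have "unit_ball_vol ?n > 0" by simp
  then have K: "K > 0" unfolding K_def using R by (intro mult_pos_pos) (auto simp: add_pos_pos)
  have V: "?V > 0" using R by simp
  \<comment> \<open>\<open>K * k\<close> bounds the integral of the \<open>\<rho>\<close>-lengths of
    the segments from a good point over the ball of volume \<open>?V\<close>; this \<open>k\<close>
    makes their mean 1/4.\<close>
  define k where "k = ?V / (4 * K)"
  have k: "k > 0" "K * k = ?V / 4" using K V by (auto simp: k_def field_simps)
  \<comment> \<open>With \<open>k ^ ?n\<close> as the constant \<open>\<kappa>\<close> of
    \<open>exists_good_point\<close>, the threshold there reads
    \<open>k ^ ?n * \<epsilon> / 10\<close>.\<close>
  show ?thesis
  proof (intro exI[of _ "k ^ ?n * \<epsilon> / 10"] conjI allI impI; (elim conjE)?)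
    show "0 < k ^ ?n * \<epsilon> / 10" using k \<epsilon> by simp
    fix \<rho> :: "'a \<Rightarrow> ennreal" and E F :: "'a set" and e e' :: 'a
    assume \<rho> [measurable]: "\<rho> \<in> borel_measurable borel"
      and small: "(\<integral>\<^sup>+ x. \<rho> x ^ DIM('a) \<partial>lborel) < ennreal (k ^ ?n * \<epsilon> / 10)"
      and sub: "E \<subseteq> ball 0 R" "F \<subseteq> ball 0 R"
      and onto: "\<forall>s\<in>{0..<\<epsilon>}. \<exists>z\<in>E. norm (z - e) = s" "\<forall>s\<in>{0..<\<epsilon>}. \<exists>z\<in>F. norm (z - e') = s"
    have good: "\<exists>z\<in>X. (\<integral>\<^sup>+ y \<in> ball 0 R. segment_integral \<rho> z y \<partial>lborel) \<le> ennreal (?V / 4)"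
      if X: "X \<subseteq> ball 0 R" "\<forall>s\<in>{0..<\<epsilon>}. \<exists>z\<in>X. norm (z - c) = s" for X c
    proof -
      obtain z where z: "z \<in> X" "\<And>r. 0 < r \<Longrightarrow> r \<le> 2 * R \<Longrightarrow>
          (\<integral>\<^sup>+ x \<in> ball z r. \<rho> x ^ ?n \<partial>lborel) \<le> ennreal (k ^ ?n * r)"
        using exists_good_point[OF _ _ \<epsilon> small X(2), of "2 * R"] k(1) by auto
      have "(\<integral>\<^sup>+ y \<in> ball 0 R. segment_integral \<rho> z y \<partial>lborel) \<le> ennreal (K * k)"
        unfolding K_def using z X(1) by (intro nn_integral_segment_integral_le \<rho> R k(1)) auto
      then show ?thesis using z k(2) by auto
    qed
    obtain z where z: "z \<in> E" "(\<integral>\<^sup>+ y \<in> ball 0 R. segment_integral \<rho> z y \<partial>lborel) \<le> ennreal (?V / 4)"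
      using good[OF sub(1) onto(1)] by blast
    obtain w where w: "w \<in> F" "(\<integral>\<^sup>+ y \<in> ball 0 R. segment_integral \<rho> w y \<partial>lborel) \<le> ennreal (?V / 4)"
      using good[OF sub(2) onto(2)] by blast
    have "\<exists>y. segment_integral \<rho> z y + segment_integral \<rho> w y < 1"
    proof (rule ccontr)
      assume "\<not> ?thesis"
      then have ge: "1 \<le> segment_integral \<rho> z y + segment_integral \<rho> w y" for y by (auto simp: not_less)
      have [measurable]: "segment_integral \<rho> v \<in> borel_measurable borel" for v
        unfolding segment_integral_def by measurable
      have [measurable]: "ball (0::'a) R \<in> sets borel" by simp
      have "ennreal ?V = (\<integral>\<^sup>+ y. indicator (ball (0::'a) R) y \<partial>lborel)"
        using R by (simp add: emeasure_ball)
      also have "\<dots> \<le> (\<integral>\<^sup>+ y. segment_integral \<rho> z y * indicator (ball 0 R) y + segment_integral \<rho> w y * indicator (ball 0 R) y \<partial>lborel)"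
        using ge by (intro nn_integral_mono) (auto split: split_indicator)
      also have "\<dots> = (\<integral>\<^sup>+ y \<in> ball 0 R. segment_integral \<rho> z y \<partial>lborel) + (\<integral>\<^sup>+ y \<in> ball 0 R. segment_integral \<rho> w y \<partial>lborel)"
        by (intro nn_integral_add) measurable
      also have "\<dots> \<le> ennreal (?V / 4) + ennreal (?V / 4)" using z w by (intro add_mono) auto
      also have "\<dots> = ennreal (?V / 2)" using V by (simp flip: ennreal_plus)
      finally have "?V \<le> ?V / 2" using V by (subst (asm) ennreal_le_iff) auto
      then show False using V by linarith
    qed
    then show "\<exists>z\<in>E. \<exists>w\<in>F. \<exists>y. segment_integral \<rho> z y + segment_integral \<rho> w y < 1"
      using z w by blast
  qed
qed

text \<open>By the triangle inequality through \<infinity>, one of the two points has chordal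
  distance at least \<open>\<epsilon> / 2\<close> from \<infinity>, hence is finite with norm at
  most \<open>2 / \<epsilon>\<close>.\<close>

lemma exists_finite_endpoint:
  assumes "\<epsilon> \<le> chordal p q" "0 < \<epsilon>"
  obtains e p' where "{p, q} = {Some e, p'}" "\<epsilon> \<le> chordal (Some e) p'" "norm e \<le> 2 / \<epsilon>"
proof -
  have sym: "chordal q p = chordal p q" by (rule ext.commute)
  have tri: "chordal p q \<le> chordal None p + chordal None q"
    using ext.triangle[of p None q] ext.commute[of p None] by simp
  consider "\<epsilon> / 2 \<le> chordal None p" | "\<epsilon> / 2 \<le> chordal None q" using tri assms by linarith
  then show ?thesis
  proof cases
    case 1
    then obtain e where "p = Some e" using assms(2) by (cases p) auto
    then show ?thesis using that[of e q] 1 assms norm_le_of_chordal_infinity[of "\<epsilon> / 2" e] by auto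
  next
    case 2
    then obtain e where "q = Some e" using assms(2) by (cases q) auto
    then show ?thesis using that[of e p] 2 assms sym norm_le_of_chordal_infinity[of "\<epsilon> / 2" e]
      by (auto simp: insert_commute)
  qed
qed

lemma chordal_diam_gt_obtain:
  assumes "ennreal \<Delta> \<le> chordal_diam S" "0 \<le> d" "d < \<Delta>"
  obtains p q where "p \<in> S" "q \<in> S" "d < chordal p q"
proof -
  have "ennreal d < chordal_diam S"
    using assms by (metis ennreal_lessI less_le_trans order_le_less_trans)
  then obtain p q where "p \<in> S" "q \<in> S" "ennreal d < ennreal (chordal p q)"
    by (auto simp: chordal_diam_def less_SUP_iff)
  then show ?thesis using that assms by (auto simp: ennreal_less_iff)
qed

text \<open>The threshold depends neither on the mapping nor on the ring, because bounded pieces of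
  \<open>E\<close> and \<open>F\<close> are found in one ball \<open>ball 0 R\<close> determined by
  \<open>\<epsilon>\<close> and \<open>\<Delta>\<close> alone.\<close>

lemma oscillation_less_of_small_modulus:
  assumes n: "2 \<le> CARD('n::finite)" and \<epsilon>: "0 < \<epsilon>" and \<Delta>: "0 < \<Delta>"
  shows "\<exists>\<delta>>0. \<forall>D (f :: 'n ext_space \<Rightarrow> 'n ext_space) x0 r1 r2 x.
      homeo_into D f \<and> ennreal \<Delta> \<le> chordal_diam (- (f ` D)) \<and> Some ` cball x0 r2 \<subseteq> D \<and>
       0 < r1 \<and> r1 < r2 \<and> x \<in> cball x0 r1 \<and>
       modulus (image_curves f (joining_curves (Some ` sphere x0 r1) (Some ` sphere x0 r2)
         (Some ` {x. r1 < dist x0 x \<and> dist x0 x < r2}))) < ennreal \<delta>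
      \<longrightarrow> chordal (f (Some x)) (f (Some x0)) < \<epsilon>"
proof -
  \<comment> \<open>The chordal diameter is a supremum that need not be attained; two omitted points
    at distance more than \<open>\<Delta> / 2\<close> do exist.\<close>
  define d where "d = min \<epsilon> (\<Delta> / 2)"
  define R where "R = 2 / d + d"
  have d: "0 < d" "d \<le> \<epsilon>" "d \<le> \<Delta> / 2" and R: "0 < R"
    using \<epsilon> \<Delta> by (auto simp: d_def R_def min_def add_pos_pos)
  obtain \<delta> where \<delta>: "0 < \<delta>" and short: "\<forall>(\<rho> :: real ^ 'n \<Rightarrow> ennreal) E F e e'.
      \<rho> \<in> borel_measurable borel \<and> (\<integral>\<^sup>+ x. \<rho> x ^ DIM(real ^ 'n) \<partial>lborel) < ennreal \<delta> \<and>
      E \<subseteq> ball 0 R \<and> F \<subseteq> ball 0 R \<and>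
      (\<forall>s\<in>{0..<d}. \<exists>z\<in>E. norm (z - e) = s) \<and> (\<forall>s\<in>{0..<d}. \<exists>z\<in>F. norm (z - e') = s)
      \<longrightarrow> (\<exists>z\<in>E. \<exists>w\<in>F. \<exists>y. segment_integral \<rho> z y + segment_integral \<rho> w y < 1)"
    using exists_short_polyline[OF R d(1), where 'a = "real ^ 'n"] by blast
  \<comment> \<open>Only points within Euclidean distance \<open>d\<close> of a finite endpoint
    \<open>e\<close> are kept. As \<open>norm e \<le> 2 / d\<close>, they lie in
    \<open>ball 0 R\<close>, and they still meet every sphere of radius below \<open>d\<close> about
    \<open>e\<close>.\<close>
  have piece: "\<exists>e. {z. Some z \<in> X \<and> norm (z - e) < d} \<subseteq> ball 0 R \<and>
      (\<forall>s\<in>{0..<d}. (\<exists>z\<in>{z. Some z \<in> X \<and> norm (z - e) < d}. norm (z - e) = s))"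
    if X: "connectedin ext_top X" "p \<in> X" "q \<in> X" "d \<le> chordal p q" for X :: "'n ext_space set" and p q
  proof -
    obtain e p' where e: "{p, q} = {Some e, p'}" "d \<le> chordal (Some e) p'" "norm e \<le> 2 / d"
      using exists_finite_endpoint[OF X(4) d(1)] .
    have "Some e \<in> {p, q}" "p' \<in> {p, q}" unfolding e(1) by simp_all
    then have in_X: "Some e \<in> X" "p' \<in> X" using X(2,3) by auto
    have "norm z < R" if "norm (z - e) < d" for z
      using that e(3) norm_triangle_sub[of z e] by (simp add: R_def)
    moreover have "\<exists>z\<in>{z. Some z \<in> X \<and> norm (z - e) < d}. norm (z - e) = s" if "s \<in> {0..<d}" for s
      using connectedin_radii_onto[OF X(1) in_X e(2) d(1), of s] that by auto
    ultimately show ?thesis by (intro exI[of _ e]) auto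
  qed
  show ?thesis
  proof (intro exI[of _ \<delta>] conjI allI impI \<delta>; elim conjE)
    fix D and f :: "'n ext_space \<Rightarrow> 'n ext_space" and x0 r1 r2 x
    assume f: "homeo_into D f" and diam: "ennreal \<Delta> \<le> chordal_diam (- (f ` D))"
      and sub: "Some ` cball x0 r2 \<subseteq> D" and r: "0 < r1" "r1 < r2" and x: "x \<in> cball x0 r1"
      and small: "modulus (image_curves f (joining_curves (Some ` sphere x0 r1) (Some ` sphere x0 r2)
         (Some ` {x. r1 < dist x0 x \<and> dist x0 x < r2}))) < ennreal \<delta>"
    let ?\<Gamma> = "joining_curves (Some ` sphere x0 r1) (Some ` sphere x0 r2)
         (Some ` {x. r1 < dist x0 x \<and> dist x0 x < r2})"
    let ?E = "f ` Some ` cball x0 r1" and ?F = "- f ` Some ` cball x0 r2"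
    have sub1: "Some ` cball x0 r1 \<subseteq> D" using sub r by (meson dual_order.trans image_mono subset_cball less_imp_le)
    show "chordal (f (Some x)) (f (Some x0)) < \<epsilon>"
    proof (rule ccontr)
      assume "\<not> chordal (f (Some x)) (f (Some x0)) < \<epsilon>"
      then have far: "d \<le> chordal (f (Some x)) (f (Some x0))" using d by auto
      \<comment> \<open>These points play two roles: they make the connected set \<open>?F\<close>
        chordally large, and \<open>p\<close> is the omitted value needed for the charts.\<close>
      obtain p q where pq: "p \<in> - (f ` D)" "q \<in> - (f ` D)" "\<Delta> / 2 < chordal p q"
        using chordal_diam_gt_obtain[OF diam, of "\<Delta> / 2"] \<Delta> by auto
      obtain \<rho> where \<rho>: "admissible \<rho> (image_curves f ?\<Gamma>)" "(\<integral>\<^sup>+ x. \<rho> x ^ CARD('n) \<partial>lborel) < ennreal \<delta>"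
        using small by (auto simp: modulus_def INF_less_iff)
      then have \<rho>_meas [measurable]: "\<rho> \<in> borel_measurable borel" by (simp add: admissible_def)
      have "f (Some x) \<in> ?E" "f (Some x0) \<in> ?E" using x r by auto
      then obtain e where e: "{z. Some z \<in> ?E \<and> norm (z - e) < d} \<subseteq> ball 0 R"
        "\<forall>s\<in>{0..<d}. \<exists>z\<in>{z. Some z \<in> ?E \<and> norm (z - e) < d}. norm (z - e) = s"
        using piece[OF connectedin_image_cball[OF f sub1] _ _ far] by blast
      have pF: "p \<notin> f ` D" "p \<in> ?F" "q \<in> ?F" "d \<le> chordal p q" using pq sub d by auto
      obtain e' where e': "{z. Some z \<in> ?F \<and> norm (z - e') < d} \<subseteq> ball 0 R"
        "\<forall>s\<in>{0..<d}. \<exists>z\<in>{z. Some z \<in> ?F \<and> norm (z - e') < d}. norm (z - e') = s"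
        using piece[OF connectedin_complement_image_cball[OF n f sub pF(1)] pF(2-4)] by blast
      obtain z w y where zwy: "Some z \<in> ?E" "Some w \<in> ?F" "segment_integral \<rho> z y + segment_integral \<rho> w y < 1"
      proof -
        have "\<exists>z\<in>{z. Some z \<in> ?E \<and> norm (z - e) < d}. \<exists>w\<in>{z. Some z \<in> ?F \<and> norm (z - e') < d}.
            \<exists>y. segment_integral \<rho> z y + segment_integral \<rho> w y < 1"
          using \<rho>(2) by (intro short[THEN spec, THEN spec, THEN spec, THEN spec, THEN spec, THEN mp, of _ _ _ e e']
              conjI \<rho>_meas e e') simp
        then show ?thesis using that by blast
      qed
      let ?\<sigma> = "polyline z y w" and ?L = "norm (y - z) + norm (w - y)"
      obtain a b \<gamma> where ab: "0 \<le> a" "a < b" "b \<le> ?L" and \<gamma>: "\<And>t. t \<in> {a..b} \<Longrightarrow> f (\<gamma> t) = Some (?\<sigma> t)"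
        "(a, b, \<gamma>) \<in> ?\<Gamma>"
      proof (rule crossing_subcurve[OF f sub _ r, of p ?L ?\<sigma>])
        show "continuous_on {0..?L} ?\<sigma>"
          using continuous_polyline continuous_on_subset by blast
      qed (use pq zwy in auto)
      have "(a, b, f \<circ> \<gamma>) \<in> image_curves f ?\<Gamma>"
        using \<gamma>(2) unfolding image_curves_def by force
      then have "1 \<le> line_integral \<rho> (a, b, f \<circ> \<gamma>)" using \<rho>(1) by (simp add: admissible_def)
      also have "\<dots> = (\<integral>\<^sup>+ t \<in> {a..b}. \<rho> (?\<sigma> t) \<partial>lborel)"
        using ab \<gamma>(1) by (intro line_integral_unit_speed[where c="norm (y - z)"])
          (auto simp: continuous_polyline dist_polyline_first_leg dist_polyline_second_leg)
      also have "\<dots> \<le> (\<integral>\<^sup>+ t \<in> {0..?L}. \<rho> (?\<sigma> t) \<partial>lborel)"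
        using ab by (intro nn_integral_mono) (auto split: split_indicator)
      also have "\<dots> \<le> segment_integral \<rho> z y + segment_integral \<rho> w y"
        by (rule nn_integral_polyline_le) simp
      finally show False using zwy(3) by simp
    qed
  qed
qed

section \<open>Divergence of the dyadic weights\<close>

text \<open>Superlevel sets of a monotone function are upward closed, and in a complete linear order
  such a set is a closed or open ray from its infimum.\<close>

lemma mono_imp_borel_measurable:
  fixes \<Phi> :: "ennreal \<Rightarrow> ennreal"
  assumes "mono \<Phi>"
  shows "\<Phi> \<in> borel_measurable borel"
proof (rule borel_measurableI_greater)
  fix y
  define U where "U = {x. y < \<Phi> x}"
  have up: "x' \<in> U" if "x \<in> U" "x \<le> x'" for x x'
    using that monoD[OF assms that(2)] by (auto simp: U_def)
  have "U = {Inf U..} \<or> U = {Inf U<..}"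
  proof (cases "Inf U \<in> U")
    case True
    then have "U = {Inf U..}" using up by (auto intro: Inf_lower)
    then show ?thesis ..
  next
    case False
    have "x \<in> U" if "Inf U < x" for x
      using that up unfolding Inf_less_iff by (meson less_imp_le)
    moreover have "Inf U < x" if "x \<in> U" for x
      using that False Inf_lower[OF that] by (metis order_le_less)
    ultimately have "U = {Inf U<..}" by auto
    then show ?thesis ..
  qed
  then have "U \<in> sets borel" by (metis atLeast_borel greaterThan_borel)
  then show "{x \<in> space borel. y < \<Phi> x} \<in> sets borel" by (simp add: U_def)
qed

context
  fixes \<Phi> :: "ennreal \<Rightarrow> ennreal"
  assumes mono: "mono \<Phi>" and conv: "convex_ennreal \<Phi>"
begin

lemma convex_chord:
  assumes "0 \<le> l" "l \<le> 1"
  shows "\<Phi> (ennreal l * t) \<le> ennreal l * \<Phi> t + ennreal (1 - l) * \<Phi> 0"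
  using conv[unfolded convex_ennreal_def, rule_format, of l t 0] assms by simp

text \<open>By convexity the slope of the chord from \<open>0\<close> to \<open>s\<close> is at
  least that of the chord from \<open>0\<close> to \<open>t\<close> when \<open>s > t\<close>, and
  the latter is at least \<open>\<tau> / (2 * t)\<close> because
  \<open>\<Phi> 0 \<le> \<tau> / 2\<close>. Written without division, and with a term that covers
  \<open>s \<le> t\<close>, this can be integrated directly.\<close>

lemma linear_growth:
  assumes \<tau>: "0 < \<tau>" "2 * \<Phi> 0 \<le> ennreal \<tau>" and t: "0 \<le> t" "ennreal \<tau> \<le> \<Phi> (ennreal t)"
  shows "ennreal \<tau> * s \<le> ennreal \<tau> * ennreal t + ennreal (2 * t) * \<Phi> s"
proof -
  have fin0: "\<Phi> 0 \<noteq> \<infinity>" using \<tau>(2) by (auto simp: ennreal_mult_eq_top_iff top_unique)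
  then obtain a where a: "\<Phi> 0 = ennreal a" "0 \<le> a" by (cases "\<Phi> 0") auto
  have "ennreal (2 * a) \<le> ennreal \<tau>" using \<tau> a by (simp add: ennreal_mult)
  then have a2: "2 * a \<le> \<tau>" using \<tau>(1) by (simp add: ennreal_le_iff)
  have "t \<noteq> 0" using t a2 a \<tau>(1) by (auto simp: ennreal_le_iff2)
  with t have "t > 0" by simp
  show ?thesis
  proof (cases "s \<le> ennreal t")
    case True
    then show ?thesis by (intro add_increasing2 mult_left_mono) auto
  next
    case False
    show ?thesis
    proof (cases "\<Phi> s = \<infinity>")
      case True
      then show ?thesis using \<open>t > 0\<close> by (simp add: ennreal_mult_eq_top_iff ennreal_top_mult ennreal_mult_top)
    next
      case fin: False
      then obtain b where b: "\<Phi> s = ennreal b" "0 \<le> b" by (cases "\<Phi> s") auto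
      \<comment> \<open>If \<open>\<Phi> \<infinity>\<close> is finite, convexity at the midpoint of
        \<open>0\<close> and \<infinity>, which is again \<infinity>, gives
        \<open>\<Phi> \<infinity> \<le> \<Phi> 0\<close>, contrary to
        \<open>\<tau> \<le> \<Phi> \<infinity>\<close> and
        \<open>2 * \<Phi> 0 \<le> \<tau>\<close>.\<close>
      have "s \<noteq> \<infinity>"
      proof
        assume s: "s = \<infinity>"
        have "\<Phi> (ennreal (1/2) * \<infinity>) \<le> ennreal (1/2) * \<Phi> \<infinity> + ennreal (1 - 1/2) * \<Phi> 0"
          by (rule convex_chord) auto
        then have "ennreal b \<le> ennreal (1/2) * ennreal b + ennreal (1/2) * ennreal a"
          using b a s by (simp add: ennreal_mult_top)
        also have "\<dots> = ennreal (1/2 * b + 1/2 * a)" using a b by (intro ennreal_linear_combination) auto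
        finally have "b \<le> a" using a b by (subst (asm) ennreal_le_iff) auto
        moreover have "\<tau> \<le> b"
        proof -
          have "ennreal \<tau> \<le> \<Phi> s" using t(2) monoD[OF mono, of "ennreal t" s] s by (auto intro: order_trans)
          then show ?thesis using b by (simp add: ennreal_le_iff)
        qed
        ultimately show False using a2 \<tau>(1) a(2) by simp
      qed
      then obtain x where x: "s = ennreal x" "0 \<le> x" by (cases s) auto
      have "t < x" using False x t by (simp add: ennreal_le_iff)
      have "\<Phi> (ennreal t) \<le> ennreal (t / x) * \<Phi> s + ennreal (1 - t / x) * \<Phi> 0"
        using convex_chord[of "t / x" s] \<open>t > 0\<close> \<open>t < x\<close> x by (simp flip: ennreal_mult)
      also have "\<dots> = ennreal (t / x * b + (1 - t / x) * a)"
        unfolding a b using a b \<open>t > 0\<close> \<open>t < x\<close> by (intro ennreal_linear_combination) auto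
      finally have "ennreal \<tau> \<le> ennreal (t / x * b + (1 - t / x) * a)"
        using t(2) by (rule order_trans[rotated])
      moreover have "0 \<le> t / x * b + (1 - t / x) * a"
        using a b \<open>t > 0\<close> \<open>t < x\<close> by (intro add_nonneg_nonneg mult_nonneg_nonneg) auto
      ultimately have "\<tau> \<le> t / x * b + (1 - t / x) * a" by (simp only: ennreal_le_iff)
      also have "\<dots> \<le> t / x * b + 1 * a"
        using \<open>t > 0\<close> \<open>t < x\<close> a by (intro add_left_mono mult_right_mono) auto
      finally have "\<tau> / 2 \<le> t / x * b" using a2 by linarith
      then have "\<tau> * x \<le> 2 * t * b"
        using \<open>t > 0\<close> \<open>t < x\<close> by (simp add: field_simps)
      moreover have "0 \<le> \<tau> * t" using \<open>t > 0\<close> \<tau>(1) by simp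
      ultimately have "\<tau> * x \<le> \<tau> * t + 2 * t * b" by linarith
      then have "ennreal (\<tau> * x) \<le> ennreal (\<tau> * t + 2 * t * b)" by (rule ennreal_leI)
      then show ?thesis
        using x b \<open>t > 0\<close> \<tau>(1) ennreal_linear_combination[of \<tau> t "2 * t" b] by (simp add: ennreal_mult)
    qed
  qed
qed

text \<open>Integrating \<open>linear_growth\<close> at a point \<open>u\<close> with
  \<open>\<Phi> u \<ge> \<tau>\<close> gives the bound with \<open>u\<close> in place of the
  generalized inverse; such points exist arbitrarily close to it.\<close>

lemma nn_integral_le_gen_inverse:
  assumes [measurable]: "Q \<in> borel_measurable N" and \<tau>: "0 < \<tau>" "2 * \<Phi> 0 \<le> ennreal \<tau>"
    and space: "emeasure N (space N) \<le> ennreal A" "0 < A"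
    and int: "(\<integral>\<^sup>+ x. \<Phi> (Q x) \<partial>N) \<le> ennreal I" "0 \<le> I"
    and fin: "gen_inverse \<Phi> (ennreal \<tau>) \<noteq> \<infinity>"
  shows "(\<integral>\<^sup>+ x. Q x \<partial>N) \<le> gen_inverse \<Phi> (ennreal \<tau>) * ennreal (A + 2 * I / \<tau>)"
proof (rule ccontr)
  assume contra: "\<not> ?thesis"
  note [measurable] = mono_imp_borel_measurable[OF mono]
  define B where "B = A + 2 * I / \<tau>"
  have B: "B > 0" using space(2) int(2) \<tau>(1) by (simp add: B_def add_pos_nonneg)
  obtain g where g: "gen_inverse \<Phi> (ennreal \<tau>) = ennreal g" "0 \<le> g"
    using fin by (cases "gen_inverse \<Phi> (ennreal \<tau>)") auto
  have less: "ennreal (g * B) < (\<integral>\<^sup>+ x. Q x \<partial>N)"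
    using contra g B by (simp add: B_def[symmetric] not_le ennreal_mult)
  \<comment> \<open>The infimum need not be attained, so room is made between \<open>g\<close> and
    the supposed excess; a point \<open>u < e\<close> with \<open>\<Phi> u \<ge> \<tau>\<close> then
    contradicts the integrated inequality.\<close>
  obtain e where e: "g < e" "ennreal (e * B) \<le> (\<integral>\<^sup>+ x. Q x \<partial>N)"
  proof (cases "\<integral>\<^sup>+ x. Q x \<partial>N")
    case (real y)
    then have "g < y / B" "ennreal (y / B * B) \<le> (\<integral>\<^sup>+ x. Q x \<partial>N)"
      using less B g by (simp_all add: ennreal_less_iff field_simps)
    then show ?thesis by (rule that)
  next
    case top
    then show ?thesis using that[of "g + 1"] by simp
  qed
  have "gen_inverse \<Phi> (ennreal \<tau>) < ennreal e" using g e by (simp add: ennreal_less_iff)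
  then obtain t where t: "ennreal \<tau> \<le> \<Phi> t" "t < ennreal e"
    unfolding gen_inverse_def Inf_less_iff by auto
  obtain u where u: "t = ennreal u" "0 \<le> u" using t(2) by (cases t) auto
  have "ennreal \<tau> * (\<integral>\<^sup>+ x. Q x \<partial>N) = (\<integral>\<^sup>+ x. ennreal \<tau> * Q x \<partial>N)"
    by (rule nn_integral_cmult[symmetric]) simp
  also have "\<dots> \<le> (\<integral>\<^sup>+ x. ennreal \<tau> * ennreal u + ennreal (2 * u) * \<Phi> (Q x) \<partial>N)"
    using t u by (intro nn_integral_mono linear_growth \<tau>) auto
  also have "\<dots> = ennreal \<tau> * ennreal u * emeasure N (space N) + ennreal (2 * u) * (\<integral>\<^sup>+ x. \<Phi> (Q x) \<partial>N)"
    by (simp add: nn_integral_add nn_integral_cmult)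
  also have "\<dots> \<le> ennreal \<tau> * ennreal u * ennreal A + ennreal (2 * u) * ennreal I"
    by (intro add_mono mult_left_mono space int) auto
  also have "\<dots> = ennreal (\<tau> * (u * B))"
    using u \<tau>(1) space(2) int(2) by (simp add: B_def field_simps flip: ennreal_mult ennreal_plus)
  finally have "(\<integral>\<^sup>+ x. Q x \<partial>N) \<le> ennreal (u * B)"
    using \<tau>(1) u B by (simp add: ennreal_mult ennreal_mult_le_mult_iff)
  with e(2) have "ennreal (e * B) \<le> ennreal (u * B)" by (rule order_trans)
  then have "e * B \<le> u * B" using u B by (subst (asm) ennreal_le_iff) auto
  then show False using t(2) u B by (simp add: ennreal_less_iff)
qed

lemma gen_inverse_mono:
  assumes "\<sigma> \<le> \<tau>"
  shows "gen_inverse \<Phi> \<sigma> \<le> gen_inverse \<Phi> \<tau>"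
  unfolding gen_inverse_def using assms by (intro Inf_superset_mono) auto

lemma gen_inverse_ge:
  assumes "\<Phi> t < \<tau>"
  shows "t \<le> gen_inverse \<Phi> \<tau>"
  unfolding gen_inverse_def
proof (rule Inf_greatest, rule ccontr)
  fix s assume "s \<in> {t. \<tau> \<le> \<Phi> t}" "\<not> t \<le> s"
  moreover then have "\<Phi> s \<le> \<Phi> t" by (intro monoD[OF mono]) simp
  ultimately show False using assms by simp
qed

end

text \<open>The maximum with 1 covers a vanishing generalized inverse, for which \<open>0 powr (- p) = 0\<close> would be
  the wrong value.\<close>

definition dyadic_weight :: "(ennreal \<Rightarrow> ennreal) \<Rightarrow> real \<Rightarrow> real \<Rightarrow> real" where
  "dyadic_weight \<Phi> p \<tau> = (if gen_inverse \<Phi> (ennreal \<tau>) = \<infinity> then 0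
     else max 1 (enn2real (gen_inverse \<Phi> (ennreal \<tau>))) powr (- p))"

lemma dyadic_weight_nonneg: "0 \<le> dyadic_weight \<Phi> p \<tau>"
  by (simp add: dyadic_weight_def)

text \<open>On \<open>[T k, T (k+1))\<close> the integrand is at most \<open>w k / T k\<close>, as
  far as the maximum with 1 is inactive, and the interval has length \<open>(q - 1) * T k\<close>. A
  convergent sum would make the tail of the integral finite, and the initial piece is finite as
  well.\<close>

lemma dyadic_weight_not_summable:
  assumes mono: "mono \<Phi>" and conv: "convex_ennreal \<Phi>" and p: "0 < p"
    and \<delta>0: "\<Phi> 0 < ennreal \<delta>0"
    and inf: "(\<integral>\<^sup>+ \<tau> \<in> {\<delta>0..}. 1 / (ennreal \<tau> * ennreal_rpow (gen_inverse \<Phi> (ennreal \<tau>)) p) \<partial>lborel) = \<infinity>"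
    and \<tau>0: "0 < \<tau>0" and q: "1 < q"
  shows "\<not> summable (\<lambda>k. dyadic_weight \<Phi> p (\<tau>0 * q ^ k))"
proof
  define T where "T k = \<tau>0 * q ^ k" for k
  define w where "w k = dyadic_weight \<Phi> p (T k)" for k
  let ?G = "\<lambda>\<tau>. gen_inverse \<Phi> (ennreal \<tau>)"
  let ?h = "\<lambda>\<tau>. 1 / (ennreal \<tau> * ennreal_rpow (?G \<tau>) p)"
  assume "summable (\<lambda>k. dyadic_weight \<Phi> p (\<tau>0 * q ^ k))"
  then have sum: "summable w" by (simp add: w_def[abs_def] T_def)
  have T: "0 < T k" "T k < T (Suc k)" for k using \<tau>0 q by (auto simp: T_def)
  have \<delta>0_pos: "0 < \<delta>0" using \<delta>0 by (metis ennreal_neg less_le_not_le linorder_not_less zero_le not_less_zero)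
  \<comment> \<open>A weight is 1 as soon as the generalized inverse is at most 1. Since summable
    weights tend to 0, the maximum in \<open>dyadic_weight\<close> is inactive from some index
    on.\<close>
  obtain K where K: "\<And>k. k \<ge> K \<Longrightarrow> w k < 1"
    using order_tendstoD(2)[OF summable_LIMSEQ_zero[OF sum], of 1] by (auto simp: eventually_sequentially)
  have big: "1 < ?G (T k)" if "k \<ge> K" for k
  proof (rule ccontr)
    assume "\<not> 1 < ?G (T k)"
    then have le: "?G (T k) \<le> 1" by (simp add: not_less)
    have "?G (T k) \<noteq> \<infinity>" "max 1 (enn2real (?G (T k))) = 1"
      using le enn2real_mono[OF le] by (auto simp: top_unique max_def)
    then have "w k = 1" by (simp add: w_def dyadic_weight_def)
    then show False using K[OF that] by simp
  qed
  \<comment> \<open>Finiteness of the initial piece requires the generalized inverse to be bounded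
    away from 0 on \<open>{\<delta>0..}\<close>. As \<open>\<Phi> 1\<close> is finite, convexity
    brings \<open>\<Phi> l\<close> below \<open>\<delta>0\<close> for small \<open>l\<close>; this
    uses \<open>\<Phi> 0 < \<delta>0\<close>.\<close>
  obtain l where l: "0 < l" "ennreal l \<le> ?G \<delta>0"
  proof -
    have "\<Phi> 1 < ennreal (T K)"
    proof (rule ccontr)
      assume "\<not> \<Phi> 1 < ennreal (T K)"
      then have "?G (T K) \<le> 1" unfolding gen_inverse_def by (intro Inf_lower) auto
      then show False using big[of K] by simp
    qed
    then obtain b where b: "\<Phi> 1 = ennreal b" "0 \<le> b" by (cases "\<Phi> 1") auto
    obtain a where a: "\<Phi> 0 = ennreal a" "0 \<le> a" using \<delta>0 by (cases "\<Phi> 0") auto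
    have "a < \<delta>0" using \<delta>0 a by (simp add: ennreal_less_iff)
    define l where "l = min 1 ((\<delta>0 - a) / (2 * (b + 1)))"
    have l: "0 < l" "l \<le> 1" "l * b < \<delta>0 - a"
    proof -
      show "0 < l" "l \<le> 1" using \<open>a < \<delta>0\<close> b by (auto simp: l_def)
      have "l * b \<le> (\<delta>0 - a) / (2 * (b + 1)) * b" using b by (intro mult_right_mono) (auto simp: l_def)
      also have "\<dots> = (\<delta>0 - a) * (b / (2 * (b + 1)))" by simp
      also have "\<dots> < (\<delta>0 - a) * 1" using \<open>a < \<delta>0\<close> b by (intro mult_strict_left_mono) auto
      also have "\<dots> = \<delta>0 - a" by simp
      finally show "l * b < \<delta>0 - a" .
    qed
    have "\<Phi> (ennreal l * 1) \<le> ennreal l * \<Phi> 1 + ennreal (1 - l) * \<Phi> 0"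
      using l by (intro convex_chord mono conv) auto
    also have "\<dots> = ennreal (l * b + (1 - l) * a)"
      unfolding a b using a b l by (intro ennreal_linear_combination) auto
    also have "\<dots> < ennreal \<delta>0"
    proof (rule ennreal_lessI[OF \<delta>0_pos])
      have "(1 - l) * a \<le> 1 * a" using l a by (intro mult_right_mono) auto
      then show "l * b + (1 - l) * a < \<delta>0" using l(3) by simp
    qed
    finally have "ennreal l \<le> ?G \<delta>0" by (intro gen_inverse_ge mono conv) simp
    with l(1) show ?thesis by (rule that)
  qed
  have h_le: "?h \<tau> \<le> ennreal (1 / (c * m powr p))" if "0 < c" "c \<le> \<tau>" "0 < m" "ennreal m \<le> ?G \<tau>" for c \<tau> m
  proof (cases "?G \<tau>")
    case (real g)
    then have g: "m \<le> g" using that by (simp add: ennreal_le_iff)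
    then have "?h \<tau> = ennreal (1 / (\<tau> * g powr p))"
      using real that by (simp add: ennreal_rpow_def divide_ennreal flip: ennreal_mult ennreal_1)
    also have "\<dots> \<le> ennreal (1 / (c * m powr p))"
      using g that p by (intro ennreal_leI divide_left_mono mult_mono powr_mono2 mult_pos_pos) auto
    finally show ?thesis .
  next
    case top
    then show ?thesis using that by (simp add: ennreal_rpow_def ennreal_mult_top)
  qed
  define C where "C = 1 / (\<delta>0 * l powr p)"
  define f where "f j \<tau> = ennreal (w (K + j) / T (K + j)) * indicator {T (K + j)..<T (K + Suc j)} \<tau>" for j \<tau>
  have "?h \<tau> * indicator {\<delta>0..} \<tau> \<le> ennreal C * indicator {\<delta>0..T K} \<tau> + (\<Sum>j. f j \<tau>)" for \<tau>
  proof (cases "\<tau> \<in> {\<delta>0..}")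
    case \<tau>: True
    show ?thesis
    proof (cases "\<tau> \<le> T K")
      case True
      have "ennreal l \<le> ?G \<tau>" using l \<tau> by (meson gen_inverse_mono mono conv ennreal_leI atLeast_iff order_trans)
      then have "?h \<tau> \<le> ennreal C" unfolding C_def using \<tau> \<delta>0_pos l by (intro h_le) auto
      then show ?thesis using True \<tau> by (simp add: add_increasing2)
    next
      case False
      have "\<exists>m. \<tau> < T m"
      proof -
        obtain m where "\<tau> / \<tau>0 < q ^ m" using real_arch_pow[OF q] by blast
        then have "\<tau> < T m" using \<tau>0 by (simp add: T_def field_simps)
        then show ?thesis ..
      qed
      \<comment> \<open>The first level above \<open>\<tau>\<close>; the index wanted is the one
        before it.\<close>
      then obtain m where m: "\<tau> < T m" "\<And>i. i < m \<Longrightarrow> \<not> \<tau> < T i"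
        using exists_least_iff[of "\<lambda>m. \<tau> < T m"] by blast
      have "strict_mono T" using T(2) by (rule strict_monoI_Suc)
      then have "K < m" using m(1) False by (metis order_less_trans linorder_not_le strict_mono_less)
      then obtain j where j: "m = K + Suc j" by (metis less_iff_Suc_add add_Suc_right)
      have \<tau>j: "T (K + j) \<le> \<tau>" "\<tau> < T (K + Suc j)" using m(2)[of "K + j"] m(1) j by auto
      have "?h \<tau> \<le> ennreal (w (K + j) / T (K + j))"
      proof (cases "?G (T (K + j))")
        case (real g)
        then have g: "1 < g" using big[of "K + j"] by (simp add: ennreal_less_iff flip: ennreal_1)
        have "ennreal g \<le> ?G \<tau>" using real \<tau>j by (metis gen_inverse_mono mono conv ennreal_leI)
        then have "?h \<tau> \<le> ennreal (1 / (T (K + j) * g powr p))"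
          using \<tau>j T g by (intro h_le) auto
        also have "1 / (T (K + j) * g powr p) = w (K + j) / T (K + j)"
          using real g by (simp add: w_def dyadic_weight_def powr_minus field_simps max_def)
        finally show ?thesis .
      next
        case top
        then have "?G \<tau> = \<infinity>" using \<tau>j gen_inverse_mono[OF mono conv, of "ennreal (T (K + j))" "ennreal \<tau>"]
          by (simp add: ennreal_leI top_unique)
        then show ?thesis using \<tau> \<delta>0_pos by (simp add: ennreal_rpow_def ennreal_mult_top)
      qed
      also have "\<dots> = f j \<tau>" using \<tau>j by (simp add: f_def)
      also have "\<dots> \<le> (\<Sum>j. f j \<tau>)" using sum_le_suminf[of "\<lambda>j. f j \<tau>" "{j}"] by simp
      finally show ?thesis using \<tau> by (simp add: add_increasing)
    qed
  qed simp
  then have "(\<integral>\<^sup>+ \<tau> \<in> {\<delta>0..}. ?h \<tau> \<partial>lborel)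
      \<le> (\<integral>\<^sup>+ \<tau>. ennreal C * indicator {\<delta>0..T K} \<tau> + (\<Sum>j. f j \<tau>) \<partial>lborel)"
    by (intro nn_integral_mono)
  also have "\<dots> = ennreal C * emeasure lborel {\<delta>0..T K} + (\<Sum>j. \<integral>\<^sup>+ \<tau>. f j \<tau> \<partial>lborel)"
    unfolding f_def by (simp add: nn_integral_add nn_integral_suminf nn_integral_cmult_indicator)
  also have "(\<Sum>j. \<integral>\<^sup>+ \<tau>. f j \<tau> \<partial>lborel) = (\<Sum>j. ennreal ((q - 1) * w (K + j)))"
  proof (rule arg_cong[where f=suminf], rule ext)
    fix j
    have "(\<integral>\<^sup>+ \<tau>. f j \<tau> \<partial>lborel) = ennreal (w (K + j) / T (K + j)) * ennreal (T (K + Suc j) - T (K + j))"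
      using T(2)[of "K + j"] unfolding f_def by (simp add: nn_integral_cmult_indicator)
    also have "\<dots> = ennreal (w (K + j) / T (K + j) * (T (K + Suc j) - T (K + j)))"
      using T[of "K + j"] dyadic_weight_nonneg by (intro ennreal_mult[symmetric]) (auto simp: w_def)
    also have "T (K + Suc j) - T (K + j) = (q - 1) * T (K + j)" by (simp add: T_def algebra_simps)
    also have "w (K + j) / T (K + j) * ((q - 1) * T (K + j)) = (q - 1) * w (K + j)"
      using T(1)[of "K + j"] by simp
    finally show "(\<integral>\<^sup>+ \<tau>. f j \<tau> \<partial>lborel) = ennreal ((q - 1) * w (K + j))" .
  qed
  finally have "\<infinity> \<le> ennreal C * emeasure lborel {\<delta>0..T K} + (\<Sum>j. ennreal ((q - 1) * w (K + j)))"
    unfolding inf .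
  moreover have "(\<Sum>j. ennreal ((q - 1) * w (K + j))) \<noteq> \<infinity>"
  proof -
    have "summable (\<lambda>j. (q - 1) * w (j + K))" using sum by (intro summable_mult) (simp add: summable_iff_shift)
    then show ?thesis unfolding infinity_ennreal_def using q dyadic_weight_nonneg
      by (intro ennreal_suminf_neq_top) (auto simp: w_def add.commute)
  qed
  moreover have "ennreal C * emeasure lborel {\<delta>0..T K} \<noteq> \<infinity>"
    by (cases "\<delta>0 \<le> T K") (auto simp: ennreal_mult_eq_top_iff)
  ultimately show False by (simp add: top_unique)
qed

section \<open>Dyadic densities\<close>

text \<open>\<open>w ^ (n - 1)\<close> is the reciprocal of the generalized inverse raised to at
  least 1, so it cancels that factor of the integral bound. If the generalized inverse is infinite,
  the weight is 0 and the product vanishes even for an infinite integral.\<close>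

lemma dyadic_weight_nn_integral_le:
  assumes mono: "mono \<Phi>" and conv: "convex_ennreal \<Phi>" and n: "2 \<le> n"
    and Q: "Q \<in> borel_measurable N" and \<tau>: "0 < \<tau>" "2 * \<Phi> 0 \<le> ennreal \<tau>"
    and space: "emeasure N (space N) \<le> ennreal A" "0 < A"
    and int: "(\<integral>\<^sup>+ x. \<Phi> (Q x) \<partial>N) \<le> ennreal I" "0 \<le> I"
  shows "ennreal (dyadic_weight \<Phi> (1 / (real n - 1)) \<tau> ^ (n - 1)) * (\<integral>\<^sup>+ x. Q x \<partial>N) \<le> ennreal (A + 2 * I / \<tau>)"
proof (cases "gen_inverse \<Phi> (ennreal \<tau>)")
  case top
  then show ?thesis using n by (simp add: dyadic_weight_def zero_power)
next
  case (real g)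
  define m where "m = max 1 g"
  have m: "1 \<le> m" "g \<le> m" by (auto simp: m_def)
  have B: "0 \<le> A + 2 * I / \<tau>" using space int \<tau> by simp
  have "dyadic_weight \<Phi> (1 / (real n - 1)) \<tau> ^ (n - 1) = (m powr (- (1 / (real n - 1)))) powr real (n - 1)"
    using real m by (simp add: dyadic_weight_def m_def powr_realpow)
  also have "\<dots> = m powr (- 1)" using n by (simp add: powr_powr of_nat_diff)
  also have "\<dots> = 1 / m" using m by (simp add: powr_minus field_simps)
  finally have w: "dyadic_weight \<Phi> (1 / (real n - 1)) \<tau> ^ (n - 1) = 1 / m" .
  have "(\<integral>\<^sup>+ x. Q x \<partial>N) \<le> ennreal g * ennreal (A + 2 * I / \<tau>)"
    using nn_integral_le_gen_inverse[OF mono conv Q \<tau> space int] real by simp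
  also have "\<dots> \<le> ennreal m * ennreal (A + 2 * I / \<tau>)"
    using m by (intro mult_right_mono ennreal_leI) auto
  finally have "ennreal (1 / m) * (\<integral>\<^sup>+ x. Q x \<partial>N) \<le> ennreal (1 / m) * (ennreal m * ennreal (A + 2 * I / \<tau>))"
    by (rule mult_left_mono) simp
  also have "\<dots> = ennreal (A + 2 * I / \<tau>)"
    using m B by (simp add: mult.assoc[symmetric] flip: ennreal_mult)
  finally show ?thesis unfolding w .
qed

definition dyadic_annulus :: "'a::metric_space \<Rightarrow> real \<Rightarrow> nat \<Rightarrow> 'a set" where
  "dyadic_annulus x0 r k = {x. r / 2 ^ Suc k < dist x0 x \<and> dist x0 x < r / 2 ^ k}"

lemma open_dyadic_annulus: "open (dyadic_annulus x0 r k)"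
  unfolding dyadic_annulus_def by (intro open_Collect_conj open_Collect_less continuous_intros)

definition dyadic_density :: "(nat \<Rightarrow> real) \<Rightarrow> real \<Rightarrow> nat \<Rightarrow> real \<Rightarrow> ennreal" where
  "dyadic_density w r N s = (\<Sum>k<N. ennreal (w k / (\<Sum>k<N. w k) * (2 ^ Suc k / r)) * indicator {r / 2 ^ Suc k<..<r / 2 ^ k} s)"

lemma borel_measurable_dyadic_density [measurable]: "dyadic_density w r N \<in> borel_measurable borel"
  unfolding dyadic_density_def by measurable

lemma dyadic_interval_unique:
  fixes r s :: real
  assumes "0 < r" "r / 2 ^ Suc j < s" "s < r / 2 ^ j" "r / 2 ^ Suc k < s" "s < r / 2 ^ k"
  shows "j = (k::nat)"
proof (rule ccontr)
  have *: False if "i < l" "r / 2 ^ Suc i < s" "s < r / 2 ^ l" for i l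
  proof -
    have "r / 2 ^ l \<le> r / 2 ^ Suc i"
      using that(1) \<open>0 < r\<close> by (intro divide_left_mono power_increasing) auto
    then show False using that by linarith
  qed
  assume "j \<noteq> k"
  then consider "j < k" | "k < j" by linarith
  then show False using * assms by cases blast+
qed

text \<open>Annulus \<open>k\<close> has width \<open>r / 2 ^ Suc k\<close>, so its step contributes
  \<open>w k / S\<close>.\<close>

lemma nn_integral_dyadic_density:
  assumes w: "\<And>k. 0 \<le> w k" and S: "0 < (\<Sum>k<N. w k)" and r: "0 < r"
  shows "(\<integral>\<^sup>+ s \<in> {r / 2 ^ N<..<r}. dyadic_density w r N s \<partial>lebesgue) = 1"
proof -
  let ?S = "\<Sum>k<N. w k"
  have sub: "{r / 2 ^ Suc k<..<r / 2 ^ k} \<subseteq> {r / 2 ^ N<..<r}" if "k < N" for k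
  proof -
    have "r / 2 ^ N \<le> r / 2 ^ Suc k" using that r by (intro divide_left_mono power_increasing) auto
    moreover have "r / 2 ^ k \<le> r / 1" using r by (intro divide_left_mono) auto
    ultimately show ?thesis by auto
  qed
  have "(\<integral>\<^sup>+ s \<in> {r / 2 ^ N<..<r}. dyadic_density w r N s \<partial>lebesgue)
      = (\<integral>\<^sup>+ s \<in> {r / 2 ^ N<..<r}. dyadic_density w r N s \<partial>lborel)"
    by (rule nn_integral_completion)
  also have "\<dots> = (\<integral>\<^sup>+ s. (\<Sum>k<N. ennreal (w k / ?S * (2 ^ Suc k / r)) * indicator {r / 2 ^ Suc k<..<r / 2 ^ k} s) \<partial>lborel)"
  proof (rule nn_integral_cong)
    fix s
    show "dyadic_density w r N s * indicator {r / 2 ^ N<..<r} s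
        = (\<Sum>k<N. ennreal (w k / ?S * (2 ^ Suc k / r)) * indicator {r / 2 ^ Suc k<..<r / 2 ^ k} s)"
      unfolding dyadic_density_def sum_distrib_right
    proof (rule sum.cong[OF refl])
      fix k assume "k \<in> {..<N}"
      then have "k < N" by simp
      from sub[OF this]
      show "ennreal (w k / ?S * (2 ^ Suc k / r)) * indicator {r / 2 ^ Suc k<..<r / 2 ^ k} s * indicator {r / 2 ^ N<..<r} s
          = ennreal (w k / ?S * (2 ^ Suc k / r)) * indicator {r / 2 ^ Suc k<..<r / 2 ^ k} s"
        by (simp add: indicator_def subset_iff)
    qed
  qed
  also have "\<dots> = (\<Sum>k<N. ennreal (w k / ?S * (2 ^ Suc k / r)) * emeasure lborel {r / 2 ^ Suc k<..<r / 2 ^ k})"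
    by (subst nn_integral_sum) (simp_all add: nn_integral_cmult_indicator)
  also have "\<dots> = (\<Sum>k<N. ennreal (w k / ?S))"
  proof (rule sum.cong[OF refl])
    fix k
    have "emeasure lborel {r / 2 ^ Suc k<..<r / 2 ^ k} = ennreal (r / 2 ^ k - r / 2 ^ Suc k)"
      using r by (intro emeasure_lborel_Ioo) (simp add: divide_simps)
    also have "r / 2 ^ k - r / 2 ^ Suc k = r / 2 ^ Suc k" by (simp add: field_simps)
    finally have em: "emeasure lborel {r / 2 ^ Suc k<..<r / 2 ^ k} = ennreal (r / 2 ^ Suc k)" .
    have "ennreal (w k / ?S * (2 ^ Suc k / r)) * ennreal (r / 2 ^ Suc k) = ennreal (w k / ?S * (2 ^ Suc k / r) * (r / 2 ^ Suc k))"
      using w[of k] S r by (intro ennreal_mult[symmetric]) auto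
    also have "w k / ?S * (2 ^ Suc k / r) * (r / 2 ^ Suc k) = w k / ?S" using r by simp
    finally show "ennreal (w k / ?S * (2 ^ Suc k / r)) * emeasure lborel {r / 2 ^ Suc k<..<r / 2 ^ k} = ennreal (w k / ?S)"
      unfolding em .
  qed
  also have "\<dots> = ennreal (\<Sum>k<N. w k / ?S)" using w S by (intro sum_ennreal) auto
  also have "(\<Sum>k<N. w k / ?S) = 1" using S by (simp flip: sum_divide_distrib)
  finally show ?thesis by simp
qed

text \<open>At most one step is nonzero at a point, so the power of the density is the sum of the
  powers of its steps. The factors \<open>2 ^ (k * n)\<close> cancel against \<open>le\<close>, and
  of \<open>w k ^ n\<close> one factor \<open>w k\<close> is left over, whose sum is
  \<open>S\<close>.\<close>

lemma nn_integral_dyadic_density_power_le: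
  fixes x0 :: "'a::euclidean_space"
  assumes w: "\<And>k. 0 \<le> w k" and S: "1 \<le> (\<Sum>k<N. w k)" and r: "0 < r" and C: "0 \<le> C" and n: "2 \<le> n"
    and Q: "\<And>k. Q \<in> borel_measurable (restrict_space lebesgue (dyadic_annulus x0 r k))"
    and le: "\<And>k. ennreal (w k ^ (n - 1)) * (\<integral>\<^sup>+ x \<in> dyadic_annulus x0 r k. Q x \<partial>lebesgue) \<le> ennreal (C / (2 ^ k) ^ n)"
  shows "(\<integral>\<^sup>+ x \<in> X. Q x * dyadic_density w r N (norm (x - x0)) ^ n \<partial>lebesgue)
    \<le> ennreal (C * (2 / r) ^ n / (\<Sum>k<N. w k))"
proof -
  define S where "S = (\<Sum>k<N. w k)"
  have S1: "1 \<le> S" using S by (simp add: S_def)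
  define c where "c k = w k / S * (2 ^ Suc k / r)" for k
  have c: "0 \<le> c k" for k using w S1 r by (simp add: c_def)
  let ?A = "dyadic_annulus x0 r"
  have meas: "(\<lambda>x. Q x * indicator (?A k) x) \<in> borel_measurable lebesgue" for k
    using Q[of k] open_dyadic_annulus[of x0 r k]
    by (subst (asm) borel_measurable_restrict_space_iff_ennreal) auto
  have pt: "Q x * dyadic_density w r N (norm (x - x0)) ^ n * indicator X x
      \<le> (\<Sum>k<N. ennreal (c k ^ n) * (Q x * indicator (?A k) x))" for x
  proof (cases "\<exists>j<N. x \<in> ?A j")
    case True
    then obtain j where j: "j < N" "x \<in> ?A j" by blast
    have ind: "indicator {r / 2 ^ Suc k<..<r / 2 ^ k} (norm (x - x0)) = (if k = j then 1 else (0::ennreal))" for k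
    proof -
      have dj: "r / 2 ^ Suc j < norm (x - x0)" "norm (x - x0) < r / 2 ^ j"
        using j(2) by (simp_all add: dyadic_annulus_def dist_norm norm_minus_commute)
      show ?thesis
      proof (cases "k = j")
        case True then show ?thesis using dj by simp
      next
        case False
        then have "norm (x - x0) \<notin> {r / 2 ^ Suc k<..<r / 2 ^ k}"
          using dyadic_interval_unique[OF r _ _ dj, of k] by (metis greaterThanLessThan_iff)
        then show ?thesis using False by simp
      qed
    qed
    have "dyadic_density w r N (norm (x - x0)) = (\<Sum>k<N. if k = j then ennreal (c k) else 0)"
      unfolding dyadic_density_def ind by (intro sum.cong) (auto simp: c_def S_def)
    also have "\<dots> = ennreal (c j)" using j by simp
    finally have "Q x * dyadic_density w r N (norm (x - x0)) ^ n * indicator X x \<le> Q x * ennreal (c j) ^ n * 1"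
      by (intro mult_mono) (auto simp: indicator_def)
    also have "\<dots> = ennreal (c j ^ n) * (Q x * indicator (?A j) x)"
      using j c[of j] by (simp add: ennreal_power mult.commute)
    also have "\<dots> \<le> (\<Sum>k<N. ennreal (c k ^ n) * (Q x * indicator (?A k) x))"
      using j by (intro member_le_sum) auto
    finally show ?thesis .
  next
    case False
    then have "dyadic_density w r N (norm (x - x0)) = 0"
      unfolding dyadic_density_def
      by (intro sum.neutral) (auto simp: dyadic_annulus_def indicator_def dist_norm norm_minus_commute)
    then show ?thesis using n by (simp add: zero_power)
  qed
  have summand: "ennreal (c k ^ n) * (\<integral>\<^sup>+ x \<in> ?A k. Q x \<partial>lebesgue) \<le> ennreal (w k * (C * (2 / r) ^ n / S ^ n))" for k
  proof -
    define v where "v = w k * (2 ^ Suc k / (S * r)) ^ n"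
    have v: "0 \<le> v" using w S1 r by (simp add: v_def)
    have "w k ^ n = w k * w k ^ (n - 1)" using n by (simp add: power_eq_if)
    then have "c k ^ n = v * w k ^ (n - 1)"
      by (simp add: c_def v_def power_mult_distrib power_divide)
    then have "ennreal (c k ^ n) * (\<integral>\<^sup>+ x \<in> ?A k. Q x \<partial>lebesgue)
        = ennreal v * (ennreal (w k ^ (n - 1)) * (\<integral>\<^sup>+ x \<in> ?A k. Q x \<partial>lebesgue))"
      using v w[of k] by (simp add: ennreal_mult mult.assoc)
    also have "\<dots> \<le> ennreal v * ennreal (C / (2 ^ k) ^ n)" by (intro mult_left_mono le) simp
    also have "\<dots> = ennreal (v * (C / (2 ^ k) ^ n))" using v C by (intro ennreal_mult[symmetric]) auto
    also have "v * (C / (2 ^ k) ^ n) = w k * (C * (2 / r) ^ n / S ^ n)"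
      by (simp add: v_def power_mult_distrib power_divide ac_simps)
    finally show ?thesis .
  qed
  have "(\<integral>\<^sup>+ x \<in> X. Q x * dyadic_density w r N (norm (x - x0)) ^ n \<partial>lebesgue)
      \<le> (\<integral>\<^sup>+ x. (\<Sum>k<N. ennreal (c k ^ n) * (Q x * indicator (?A k) x)) \<partial>lebesgue)"
    by (intro nn_integral_mono pt)
  also have "\<dots> = (\<Sum>k<N. ennreal (c k ^ n) * (\<integral>\<^sup>+ x \<in> ?A k. Q x \<partial>lebesgue))"
    using meas by (subst nn_integral_sum) (auto simp: nn_integral_cmult intro!: borel_measurable_times)
  also have "\<dots> \<le> (\<Sum>k<N. ennreal (w k * (C * (2 / r) ^ n / S ^ n)))"
    by (intro sum_mono summand)
  also have "\<dots> = ennreal (\<Sum>k<N. w k * (C * (2 / r) ^ n / S ^ n))"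
    using w C r S1 by (intro sum_ennreal) auto
  also have "(\<Sum>k<N. w k * (C * (2 / r) ^ n / S ^ n)) = S * (C * (2 / r) ^ n / S ^ n)"
    unfolding S_def by (rule sum_distrib_right[symmetric])
  also have "\<dots> \<le> C * (2 / r) ^ n / S"
  proof -
    \<comment> \<open>The bound obtained is of order \<open>S ^ (1 - n)\<close>; for
      \<open>S \<ge> 1\<close> and \<open>n \<ge> 2\<close> it is weakened to \<open>1 / S\<close>,
      which still tends to 0.\<close>
    have "S ^ 2 \<le> S ^ n" using S1 n by (intro power_increasing) auto
    then have "S / S ^ n \<le> S / S ^ 2" using S1 by (intro divide_left_mono) auto
    also have "\<dots> = 1 / S" using S1 by (simp add: power2_eq_square)
    finally have "C * (2 / r) ^ n * (S / S ^ n) \<le> C * (2 / r) ^ n * (1 / S)"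
      using C r by (intro mult_left_mono) auto
    then show ?thesis by (simp add: ac_simps)
  qed
  finally show ?thesis by (simp add: S_def ennreal_leI)
qed

section \<open>Inversion and Lebesgue measure\<close>

lemma lebesgue_outer_open_small:
  fixes S :: "'a::euclidean_space set"
  assumes "S \<in> sets lebesgue" "0 < e"
  obtains T where "open T" "S \<subseteq> T" "emeasure lebesgue T \<le> emeasure lebesgue S + ennreal e"
proof -
  obtain T where T: "open T" "S \<subseteq> T" "(T - S) \<in> lmeasurable" "emeasure lebesgue (T - S) < ennreal e"
    using sets_lebesgue_outer_open[OF assms] by blast
  have "emeasure lebesgue T = emeasure lebesgue (S \<union> (T - S))" using T(2) by (simp add: Un_absorb1)
  also have "\<dots> \<le> emeasure lebesgue S + emeasure lebesgue (T - S)"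
    using assms T by (intro emeasure_subadditive) (auto simp: fmeasurable_def)
  also have "\<dots> \<le> emeasure lebesgue S + ennreal e" using T by (intro add_left_mono) simp
  finally show ?thesis using that T by blast
qed

text \<open>The factor 10 comes from the Vitali covering lemma.\<close>

lemma emeasure_lipschitz_image_le:
  fixes f :: "'a::euclidean_space \<Rightarrow> 'a"
  assumes S: "S \<in> sets lebesgue" and L: "0 < L"
    and lip: "\<And>x y. x \<in> S \<Longrightarrow> y \<in> S \<Longrightarrow> norm (f x - f y) \<le> L * norm (x - y)"
    and fS: "f ` S \<in> sets lebesgue"
  shows "emeasure lebesgue (f ` S) \<le> ennreal ((10 * L) ^ DIM('a)) * emeasure lebesgue S"
proof -
  let ?n = "DIM('a)" and ?c = "ennreal ((10 * L) ^ DIM('a))"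
  have main: "emeasure lebesgue (f ` S) \<le> ?c * emeasure lebesgue T" if T: "open T" "S \<subseteq> T" for T
  proof -
    \<comment> \<open>Choosing the balls inside \<open>T\<close> bounds the total measure of the
      disjoint ones by that of \<open>T\<close>; the bound 1 on the radii is for Vitali's
      lemma.\<close>
    have "\<exists>r. 0 < r \<and> r \<le> 1 \<and> cball x r \<subseteq> T" if "x \<in> S" for x
    proof -
      have "x \<in> T" using T(2) that by auto
      then obtain e where "e > 0" "cball x e \<subseteq> T" using open_contains_cball_eq[OF T(1)] by metis
      then show ?thesis by (intro exI[of _ "min e 1"]) auto
    qed
    then obtain r where r: "\<And>x. x \<in> S \<Longrightarrow> 0 < r x \<and> r x \<le> 1 \<and> cball x (r x) \<subseteq> T" by metis
    have "S \<subseteq> (\<Union>x\<in>S. cball x (r x))" using r by fastforce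
    then obtain C where C: "countable C" "C \<subseteq> S"
      "pairwise (\<lambda>i j. disjnt (cball i (r i)) (cball j (r j))) C" "S \<subseteq> (\<Union>i\<in>C. cball i (5 * r i))"
      using Vitali_covering_lemma_cballs[of S "\<lambda>x. x" r S 1] r by (metis (no_types, lifting))
    have cover: "f ` S \<subseteq> (\<Union>i\<in>C. cball (f i) (10 * L * r i))"
    proof
      fix y assume "y \<in> f ` S"
      then obtain x where x: "x \<in> S" "y = f x" by blast
      then obtain i where i: "i \<in> C" "x \<in> cball i (5 * r i)" using C(4) by blast
      have "norm (f i - f x) \<le> L * norm (i - x)" using lip i C(2) x by blast
      also have "\<dots> \<le> L * (10 * r i)"
        using i r C(2) L by (intro mult_left_mono) (force simp: dist_norm)+
      finally show "y \<in> (\<Union>i\<in>C. cball (f i) (10 * L * r i))"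
        using i x by (intro UN_I[OF i(1)]) (simp add: dist_norm)
    qed
    have "emeasure lebesgue (f ` S) \<le> emeasure lebesgue (\<Union>i\<in>C. cball (f i) (10 * L * r i))"
      using C(1) by (intro emeasure_mono cover sets.countable_UN'') auto
    also have "\<dots> \<le> (\<integral>\<^sup>+ i. emeasure lebesgue (cball (f i) (10 * L * r i)) \<partial>count_space C)"
      using C(1) by (intro emeasure_UN_le_count_space) auto
    also have "\<dots> = (\<integral>\<^sup>+ i. ?c * emeasure lebesgue (cball i (r i)) \<partial>count_space C)"
    proof (rule nn_integral_cong)
      fix i assume "i \<in> space (count_space C)"
      then have "0 < r i" using r C(2) by auto
      then show "emeasure lebesgue (cball (f i) (10 * L * r i)) = ?c * emeasure lebesgue (cball i (r i))"
        using L by (simp add: emeasure_cball power_mult_distrib ac_simps flip: ennreal_mult)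
    qed
    also have "\<dots> = ?c * (\<integral>\<^sup>+ i. emeasure lebesgue (cball i (r i)) \<partial>count_space C)"
      by (rule nn_integral_cmult) simp
    also have "(\<integral>\<^sup>+ i. emeasure lebesgue (cball i (r i)) \<partial>count_space C) = emeasure lebesgue (\<Union>i\<in>C. cball i (r i))"
      using C(1,3) by (intro emeasure_UN_countable[symmetric])
        (auto simp: disjoint_family_on_def pairwise_def disjnt_def)
    also have "\<dots> \<le> emeasure lebesgue T"
      using r C(2) T(1) by (intro emeasure_mono) (auto simp: subset_iff)
    finally show ?thesis by (simp add: mult_left_mono)
  qed
  show ?thesis
  proof (rule ennreal_le_epsilon)
    fix e :: real assume "0 < e"
    define d where "d = e / (10 * L) ^ ?n"
    have "0 < d" using \<open>0 < e\<close> L by (simp add: d_def)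
    obtain T where T: "open T" "S \<subseteq> T" "emeasure lebesgue T \<le> emeasure lebesgue S + ennreal d"
      using lebesgue_outer_open_small[OF S \<open>0 < d\<close>] by blast
    have "emeasure lebesgue (f ` S) \<le> ?c * (emeasure lebesgue S + ennreal d)"
      using main[OF T(1,2)] T(3) by (meson mult_left_mono order_trans zero_le)
    also have "\<dots> = ?c * emeasure lebesgue S + ennreal e"
      using L \<open>0 < e\<close> by (simp add: d_def distrib_left flip: ennreal_mult)
    finally show "emeasure lebesgue (f ` S) \<le> ?c * emeasure lebesgue S + ennreal e" .
  qed
qed

text \<open>Agrees with \<open>inversion\<close> on nonzero vectors. Division by 0 yields 0 here, so
  \<open>0\<close> is a fixed point and the map is an involution of the whole vector space.\<close>

definition vec_inv :: "'a::euclidean_space \<Rightarrow> 'a" where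
  "vec_inv x = x /\<^sub>R (norm x)\<^sup>2"

lemma norm_vec_inv: "norm (vec_inv x) = 1 / norm x"
  by (cases "x = 0") (simp_all add: vec_inv_def power2_eq_square field_simps)

lemma vec_inv_vec_inv [simp]: "vec_inv (vec_inv x) = x"
  by (cases "x = 0") (simp_all add: vec_inv_def power2_eq_square field_simps)

text \<open>Expand the square into inner products. On \<open>norm x \<ge> c\<close> the identity
  makes \<open>vec_inv\<close> Lipschitz with constant \<open>1 / c\<^sup>2\<close>.\<close>

lemma norm_vec_inv_diff:
  assumes "x \<noteq> 0" "y \<noteq> 0"
  shows "norm (vec_inv x - vec_inv y) = norm (x - y) / (norm x * norm y)"
proof -
  define a b where "a = (norm x)\<^sup>2" and "b = (norm y)\<^sup>2"
  have pos: "a > 0" "b > 0" using assms by (auto simp: a_def b_def)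
  have xx: "x \<bullet> x = a" and yy: "y \<bullet> y = b" by (simp_all add: a_def b_def power2_norm_eq_inner)
  have "(norm (vec_inv x - vec_inv y))\<^sup>2 = (x \<bullet> x) / a\<^sup>2 - 2 * (x \<bullet> y) / (a * b) + (y \<bullet> y) / b\<^sup>2"
    unfolding vec_inv_def a_def[symmetric] b_def[symmetric] unfolding power2_norm_eq_inner using pos
    by (simp add: inner_diff_left inner_diff_right inner_commute[of y x] power2_eq_square)
       (simp add: field_simps)
  also have "\<dots> = (a - 2 * (x \<bullet> y) + b) / (a * b)"
    unfolding xx yy using pos by (simp add: field_simps power2_eq_square)
  also have "a - 2 * (x \<bullet> y) + b = (norm (x - y))\<^sup>2"
    by (simp add: power2_norm_eq_inner inner_diff_left inner_diff_right inner_commute xx yy)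
  also have "(norm (x - y))\<^sup>2 / (a * b) = (norm (x - y) / (norm x * norm y))\<^sup>2"
    by (simp add: a_def b_def power_divide power_mult_distrib)
  finally show ?thesis by (rule power2_eq_imp_eq) auto
qed

lemma differentiable_on_vec_inv:
  assumes "0 \<notin> S"
  shows "vec_inv differentiable_on S"
proof -
  have "(\<lambda>x. x /\<^sub>R (x \<bullet> x)) differentiable (at x within S)" if "x \<in> S" for x
    using that assms by (intro derivative_intros) auto
  then show ?thesis
    by (simp add: differentiable_on_def vec_inv_def[abs_def] power2_norm_eq_inner)
qed

lemma vec_inv_image_sets_lebesgue:
  assumes "S \<in> sets lebesgue" "0 \<notin> S"
  shows "vec_inv ` S \<in> sets lebesgue"
  using assms by (intro differentiable_image_in_sets_lebesgue differentiable_on_vec_inv) auto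

text \<open>Preimages under an involution are images, and differentiable images of Lebesgue
  measurable sets are measurable. Borel measurability of the map would not do, since
  \<open>Q\<close> is only Lebesgue measurable.\<close>

lemma measurable_vec_inv:
  assumes B: "B \<in> sets lebesgue" "0 \<notin> B"
  shows "vec_inv \<in> restrict_space lebesgue (vec_inv ` B) \<rightarrow>\<^sub>M restrict_space lebesgue B"
proof (rule measurableI)
  fix x assume "x \<in> space (restrict_space lebesgue (vec_inv ` B))"
  then show "vec_inv x \<in> space (restrict_space lebesgue B)" by (auto simp: space_restrict_space)
next
  fix X assume X: "X \<in> sets (restrict_space lebesgue B)"
  then have "X \<in> sets lebesgue" "X \<subseteq> B"
    using B by (auto simp: sets_restrict_space_iff)
  moreover have "vec_inv -` X \<inter> space (restrict_space lebesgue (vec_inv ` B)) = vec_inv ` X"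
    using \<open>X \<subseteq> B\<close> by (force simp: space_restrict_space)
  ultimately show "vec_inv -` X \<inter> space (restrict_space lebesgue (vec_inv ` B)) \<in> sets (restrict_space lebesgue (vec_inv ` B))"
    using B vec_inv_image_sets_lebesgue[of X] vec_inv_image_sets_lebesgue[OF B]
    by (auto simp: sets_restrict_space_iff)
qed

text \<open>An upper bound up to a constant suffices here, so no Jacobian appears: by the Lipschitz
  estimate, the image of Lebesgue measure under \<open>vec_inv\<close> is dominated by a multiple of
  Lebesgue measure on \<open>B\<close>.\<close>

lemma nn_integral_vec_inv_le:
  fixes B :: "'a::euclidean_space set"
  assumes B: "B \<in> sets lebesgue" and c: "0 < c" "\<And>y. y \<in> B \<Longrightarrow> c \<le> norm y"
    and Q: "Q \<in> borel_measurable (restrict_space lebesgue B)"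
  shows "(\<integral>\<^sup>+ x \<in> vec_inv ` B. Q (vec_inv x) \<partial>lebesgue)
    \<le> ennreal ((10 / c\<^sup>2) ^ DIM('a)) * (\<integral>\<^sup>+ y \<in> B. Q y \<partial>lebesgue)"
proof -
  have B0: "0 \<notin> B" using c by force
  let ?A = "vec_inv ` B" and ?k = "ennreal ((10 / c\<^sup>2) ^ DIM('a))"
  let ?N1 = "restrict_space lebesgue ?A" and ?N2 = "restrict_space lebesgue B"
  note A = vec_inv_image_sets_lebesgue[OF B B0]
  note meas = measurable_vec_inv[OF B B0]
  have le: "distr ?N1 ?N2 vec_inv \<le> scale_measure ?k ?N2"
  proof (rule le_measure[THEN iffD2])
    show "\<forall>X\<in>sets (distr ?N1 ?N2 vec_inv). emeasure (distr ?N1 ?N2 vec_inv) X \<le> emeasure (scale_measure ?k ?N2) X"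
    proof
      fix X assume "X \<in> sets (distr ?N1 ?N2 vec_inv)"
      then have X: "X \<in> sets ?N2" by simp
      then have X': "X \<in> sets lebesgue" "X \<subseteq> B"
        using B by (auto simp: sets_restrict_space_iff)
      have pre: "vec_inv -` X \<inter> space ?N1 = vec_inv ` X"
        using X'(2) by (force simp: space_restrict_space)
      have "emeasure (distr ?N1 ?N2 vec_inv) X = emeasure ?N1 (vec_inv ` X)"
        by (simp only: emeasure_distr[OF meas X] pre)
      also have "\<dots> = emeasure lebesgue (vec_inv ` X)"
        using A X'(2) by (intro emeasure_restrict_space) auto
      also have "\<dots> \<le> ennreal ((10 * (1 / c\<^sup>2)) ^ DIM('a)) * emeasure lebesgue X"
      proof (rule emeasure_lipschitz_image_le[OF X'(1)])
        fix x y assume xy: "x \<in> X" "y \<in> X"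
        then have nz: "x \<noteq> 0" "y \<noteq> 0" and ge: "c \<le> norm x" "c \<le> norm y" using X'(2) B0 c by auto
        have "c * c \<le> norm x * norm y" using ge c by (intro mult_mono) auto
        then have "norm (x - y) / (norm x * norm y) \<le> norm (x - y) / c\<^sup>2"
          using c nz by (intro divide_left_mono) (auto simp: power2_eq_square)
        then show "norm (vec_inv x - vec_inv y) \<le> 1 / c\<^sup>2 * norm (x - y)"
          by (simp add: norm_vec_inv_diff[OF nz])
      qed (use c X' B0 in \<open>auto intro: vec_inv_image_sets_lebesgue\<close>)
      also have "\<dots> = emeasure (scale_measure ?k ?N2) X"
        using B X'(2) by (simp add: emeasure_restrict_space)
      finally show "emeasure (distr ?N1 ?N2 vec_inv) X \<le> emeasure (scale_measure ?k ?N2) X" .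
    qed
  qed simp
  have "(\<integral>\<^sup>+ x \<in> ?A. Q (vec_inv x) \<partial>lebesgue) = (\<integral>\<^sup>+ x. Q (vec_inv x) \<partial>?N1)"
    using A by (simp add: nn_integral_restrict_space)
  also have "\<dots> = (\<integral>\<^sup>+ y. Q y \<partial>distr ?N1 ?N2 vec_inv)"
    using meas Q by (simp add: nn_integral_distr)
  also have "\<dots> \<le> (\<integral>\<^sup>+ y. Q y \<partial>scale_measure ?k ?N2)"
    by (rule nn_integral_mono_measure[OF _ le]) simp
  also have "\<dots> = ?k * (\<integral>\<^sup>+ y. Q y \<partial>?N2)" by (rule nn_integral_scale_measure[OF Q])
  also have "(\<integral>\<^sup>+ y. Q y \<partial>?N2) = (\<integral>\<^sup>+ y \<in> B. Q y \<partial>lebesgue)"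
    using B by (simp add: nn_integral_restrict_space)
  finally show ?thesis .
qed

section \<open>Equicontinuous families are normal\<close>

lemma norm_stereo_le:
  fixes p :: "'n::finite ext_space"
  shows "norm (stereo p) \<le> 1"
proof -
  have "stereo (Some (0 :: real ^ 'n)) = 0" by (simp add: stereo_def zero_prod_def)
  then have "norm (stereo p) = chordal p (Some 0)" for p :: "'n ext_space"
    by (simp add: chordal_eq_dist_stereo)
  moreover have "chordal p (Some 0) \<le> 1" for p :: "'n ext_space"
  proof (cases p)
    case (Some x)
    have "norm x \<le> sqrt (1 + (norm x)\<^sup>2)" by (rule real_le_rsqrt) simp
    moreover have "0 < sqrt (1 + (norm x)\<^sup>2)" by (simp add: add_pos_nonneg)
    ultimately show ?thesis using Some by simp
  qed simp
  ultimately show ?thesis by simp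
qed

text \<open>Wanted for closedness: a limit of values of \<open>stereo\<close> is again such a value
  and so determines a point of the extended space.\<close>

lemma range_stereo: "range (stereo :: 'n::finite ext_space \<Rightarrow> _) = sphere (0, 1/2) (1/2)"
proof (intro equalityI subsetI)
  fix u assume "u \<in> range (stereo :: 'n ext_space \<Rightarrow> _)"
  then obtain p :: "'n ext_space" where p: "u = stereo p" by blast
  have "(norm (u - (0, 1/2)))\<^sup>2 = (1/2)\<^sup>2"
  proof (cases p)
    case None
    then show ?thesis using p by (simp add: stereo_def power2_eq_square)
  next
    case (Some x)
    define a where "a = 1 + (norm x)\<^sup>2"
    have a: "a > 0" by (simp add: a_def add_pos_nonneg)
    have "u - (0, 1/2) = (x /\<^sub>R a, 1 - 1 / a - 1 / 2)"
      using p Some by (simp add: stereo_def a_def)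
    moreover have "norm (x /\<^sub>R a) = norm x / a" using a by (simp add: divide_inverse mult.commute)
    ultimately have "(norm (u - (0, 1/2)))\<^sup>2 = (norm x / a)\<^sup>2 + (1 - 1 / a - 1 / 2)\<^sup>2"
      by (simp only: norm_Pair real_norm_def power2_abs real_sqrt_pow2 add_nonneg_nonneg zero_le_power2)
    also have "\<dots> = (a - 1) / a\<^sup>2 + (1 - 1 / a - 1 / 2)\<^sup>2"
      by (simp add: power_divide a_def)
    also have "\<dots> = (1/2)\<^sup>2" using a by (simp add: field_simps power2_eq_square)
    finally show ?thesis .
  qed
  then have "norm (u - (0, 1/2)) = 1/2" by (rule power2_eq_imp_eq) auto
  then show "u \<in> sphere (0, 1/2) (1/2)" by (simp add: dist_norm norm_minus_commute)
next
  fix u :: "(real ^ 'n) \<times> real" assume u: "u \<in> sphere (0, 1/2) (1/2)"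
  obtain v s where vs: "u = (v, s)" by (cases u)
  have "(norm (u - (0, 1/2)))\<^sup>2 = (1/2)\<^sup>2"
    using u by (simp add: dist_norm norm_minus_commute)
  then have "(norm v)\<^sup>2 + (s - 1/2)\<^sup>2 = (1/2)\<^sup>2" by (simp add: vs norm_Pair)
  then have v: "(norm v)\<^sup>2 = s * (1 - s)" by (simp add: field_simps power2_eq_square)
  show "u \<in> range stereo"
  proof (cases "s = 1")
    case True
    then have "u = stereo None" using v vs by (simp add: stereo_def)
    then show ?thesis by blast
  next
    case False
    \<comment> \<open>Inverse of the stereographic projection from the pole \<open>(0, 1)\<close>,
      which represents \<infinity>.\<close>
    define x where "x = v /\<^sub>R (1 - s)"
    have "(norm x)\<^sup>2 = (norm v)\<^sup>2 / (1 - s)\<^sup>2" by (simp add: x_def power_mult_distrib field_simps)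
    also have "\<dots> = s / (1 - s)" using v False by (simp add: power2_eq_square)
    finally have a: "1 + (norm x)\<^sup>2 = 1 / (1 - s)" using False by (simp add: field_simps)
    have "stereo (Some x) = (x /\<^sub>R (1 / (1 - s)), 1 - 1 / (1 / (1 - s)))"
      by (simp only: stereo_def option.case a)
    also have "\<dots> = u" using False by (simp add: x_def vs)
    finally show ?thesis by blast
  qed
qed

lemma openin_subtopology_ext_chordal:
  assumes "openin (subtopology ext_top D) U" "p \<in> U"
  obtains r where "0 < r" "\<And>q. q \<in> D \<Longrightarrow> chordal p q < r \<Longrightarrow> q \<in> U"
proof -
  obtain V where V: "openin ext_top V" "U = V \<inter> D" using assms(1) by (auto simp: openin_subtopology)
  then obtain r where "0 < r" "ext.mball p r \<subseteq> V"
    using assms(2) unfolding ext.openin_mtopology by blast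
  then show ?thesis using that[of r] V by (auto simp: ext.mball_def)
qed

lemma openin_chordal_ball: "openin ext_top {q. chordal p q < r}"
  using ext.openin_mball[of p r] by (simp add: ext.mball_def)

text \<open>Ascoli's argument carried out through the isometric embedding \<open>stereo\<close>: a
  diagonal subsequence converges on a countable dense set, equicontinuity extends this to
  \<open>D\<close>, and finite covers make it uniform on compact sets.\<close>

lemma equicontinuous_imp_normal_family:
  fixes D :: "'n::finite ext_space set"
  assumes eq: "equicontinuous_family D \<F>"
    and cont: "\<And>f. f \<in> \<F> \<Longrightarrow> continuous_map (subtopology ext_top D) ext_top f"
  shows "normal_family D \<F>"
  unfolding normal_family_def
proof (intro conjI ballI allI impI cont)
  have near: "\<exists>r>0. \<forall>q\<in>D. chordal p q < r \<longrightarrow> (\<forall>f\<in>\<F>. chordal (f q) (f p) < \<epsilon>)" if p: "p \<in> D" "0 < \<epsilon>" for p \<epsilon>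
  proof -
    obtain U where U: "openin (subtopology ext_top D) U" "p \<in> U" "\<forall>q\<in>U. \<forall>f\<in>\<F>. chordal (f q) (f p) < \<epsilon>"
      using eq p unfolding equicontinuous_family_def by meson
    obtain r where "0 < r" "\<And>q. q \<in> D \<Longrightarrow> chordal p q < r \<Longrightarrow> q \<in> U"
      using openin_subtopology_ext_chordal[OF U(1,2)] by metis
    then show ?thesis using U(3) by (intro exI[of _ r]) auto
  qed
  fix F :: "nat \<Rightarrow> 'n ext_space \<Rightarrow> 'n ext_space" assume F: "range F \<subseteq> \<F>"
  then have FF: "F j \<in> \<F>" for j by auto
  obtain T0 where T0: "countable T0" "T0 \<subseteq> stereo ` D" "stereo ` D \<subseteq> closure T0"
    using separable by blast
  define T where "T = inv_into D stereo ` T0"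
  have "countable T" using T0(1) by (simp add: T_def)
  have TD: "T \<subseteq> D" unfolding T_def using T0(2) by (auto intro!: inv_into_into)
  have dense: "\<exists>t\<in>T. chordal p t < r" if p: "p \<in> D" "0 < r" for p r
  proof -
    have "stereo p \<in> closure T0" using T0(3) p by auto
    then obtain u where u: "u \<in> T0" "dist u (stereo p) < r" using p(2) by (auto simp: closure_approachable)
    then have "stereo (inv_into D stereo u) = u" using T0(2) by (intro f_inv_into_f) auto
    then have "chordal p (inv_into D stereo u) < r" using u by (simp add: chordal_eq_dist_stereo dist_commute)
    then show ?thesis using u(1) by (auto simp: T_def)
  qed
  obtain k where k: "strict_mono (k :: nat \<Rightarrow> nat)" "\<And>t. t \<in> T \<Longrightarrow> \<exists>l. (\<lambda>j. stereo (F (k j) t)) \<longlonglongrightarrow> l"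
    using function_convergent_subsequence[OF \<open>countable T\<close>, of "\<lambda>j t. stereo (F j t)" 1] norm_stereo_le by metis
  have "\<exists>q. (\<lambda>j. stereo (F (k j) p)) \<longlonglongrightarrow> stereo q" if p: "p \<in> D" for p
  proof -
    have "Cauchy (\<lambda>j. stereo (F (k j) p))"
    proof (rule metric_CauchyI)
      fix e :: real assume "0 < e"
      then obtain r where r: "0 < r" "\<And>q f. q \<in> D \<Longrightarrow> chordal p q < r \<Longrightarrow> f \<in> \<F> \<Longrightarrow> chordal (f q) (f p) < e / 3"
        using near[OF p, of "e / 3"] by auto
      obtain t where t: "t \<in> T" "chordal p t < r" using dense[OF p r(1)] by blast
      have "Cauchy (\<lambda>j. stereo (F (k j) t))" using k(2)[OF t(1)] LIMSEQ_imp_Cauchy by blast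
      then obtain N where N: "\<And>i j. i \<ge> N \<Longrightarrow> j \<ge> N \<Longrightarrow> dist (stereo (F (k i) t)) (stereo (F (k j) t)) < e / 3"
        using \<open>0 < e\<close> unfolding Cauchy_def by (metis divide_pos_pos zero_less_numeral)
      have close: "dist (stereo (F j t)) (stereo (F j p)) < e / 3" for j
        using r(2)[of t "F j"] t TD FF[of j] by (auto simp: chordal_eq_dist_stereo)
      have "dist (stereo (F (k i) p)) (stereo (F (k j) p)) < e" if "i \<ge> N" "j \<ge> N" for i j
        using close[of "k i"] close[of "k j"] N[OF that]
          dist_triangle[of "stereo (F (k i) p)" "stereo (F (k j) p)" "stereo (F (k i) t)"]
          dist_triangle[of "stereo (F (k i) t)" "stereo (F (k j) p)" "stereo (F (k j) t)"]
        by (simp add: dist_commute)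
      then show "\<exists>N. \<forall>i\<ge>N. \<forall>j\<ge>N. dist (stereo (F (k i) p)) (stereo (F (k j) p)) < e" by blast
    qed
    then obtain l where l: "(\<lambda>j. stereo (F (k j) p)) \<longlonglongrightarrow> l" using Cauchy_convergent convergent_def by blast
    have "closed (range (stereo :: 'n ext_space \<Rightarrow> _))" unfolding range_stereo by simp
    then have "l \<in> range (stereo :: 'n ext_space \<Rightarrow> _)"
      by (rule closed_sequentially[OF _ _ l]) simp
    then show ?thesis using l by auto
  qed
  then obtain g where g: "\<And>p. p \<in> D \<Longrightarrow> (\<lambda>j. stereo (F (k j) p)) \<longlonglongrightarrow> stereo (g p)" by metis
  have g_close: "chordal (g q) (g p) \<le> e"
    if "p \<in> D" "q \<in> D" "\<And>f. f \<in> \<F> \<Longrightarrow> chordal (f q) (f p) < e" for p q e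
  proof -
    have "(\<lambda>j. dist (stereo (F (k j) q)) (stereo (F (k j) p))) \<longlonglongrightarrow> dist (stereo (g q)) (stereo (g p))"
      using that by (intro tendsto_dist g)
    then have "dist (stereo (g q)) (stereo (g p)) \<le> e"
      using that(3)[OF FF] by (intro LIMSEQ_le_const2) (auto simp: chordal_eq_dist_stereo intro: less_imp_le)
    then show ?thesis by (simp add: chordal_eq_dist_stereo)
  qed
  show "\<exists>k g. strict_mono (k::nat \<Rightarrow> nat) \<and> continuous_map (subtopology ext_top D) ext_top g \<and>
         (\<forall>K. compactin ext_top K \<and> K \<subseteq> D \<longrightarrow>
           (\<forall>\<epsilon>>0. \<exists>N. \<forall>j\<ge>N. \<forall>p\<in>K. chordal (F (k j) p) (g p) < \<epsilon>))"
  proof (rule exI[of _ k], rule exI[of _ g], intro conjI allI impI k(1))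
    show "continuous_map (subtopology ext_top D) ext_top g"
      unfolding continuous_map_def
    proof (intro conjI allI impI)
      fix V :: "'n ext_space set" assume V: "openin ext_top V"
      show "openin (subtopology ext_top D) {p \<in> topspace (subtopology ext_top D). g p \<in> V}"
      proof (subst openin_subopen, intro ballI)
        fix p assume "p \<in> {p \<in> topspace (subtopology ext_top D). g p \<in> V}"
        then have p: "p \<in> D" "g p \<in> V" by auto
        obtain e where e: "0 < e" "ext.mball (g p) e \<subseteq> V" using V p unfolding ext.openin_mtopology by blast
        obtain r where r: "0 < r" "\<And>q f. q \<in> D \<Longrightarrow> chordal p q < r \<Longrightarrow> f \<in> \<F> \<Longrightarrow> chordal (f q) (f p) < e / 2"
          using near[OF p(1), of "e / 2"] e by auto
        have "g q \<in> V" if q: "q \<in> D" "chordal p q < r" for q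
        proof -
          have "chordal (g q) (g p) \<le> e / 2" using r(2)[OF q] by (intro g_close p q) auto
          then show ?thesis using e ext.commute[of "g q" "g p"] by (auto simp: ext.mball_def subset_iff)
        qed
        then show "\<exists>T. openin (subtopology ext_top D) T \<and> p \<in> T \<and> T \<subseteq> {p \<in> topspace (subtopology ext_top D). g p \<in> V}"
          using p r(1) by (intro exI[of _ "{q. chordal p q < r} \<inter> D"])
            (auto simp: openin_subtopology intro: openin_chordal_ball)
      qed
    qed simp
    fix K \<epsilon> assume K: "compactin ext_top K \<and> K \<subseteq> D" and "(0::real) < \<epsilon>"
    then have "\<forall>p\<in>D. \<exists>r>0. \<forall>q\<in>D. chordal p q < r \<longrightarrow> (\<forall>f\<in>\<F>. chordal (f q) (f p) < \<epsilon> / 3)"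
      by (intro ballI near) auto
    then obtain r where r: "\<And>p. p \<in> D \<Longrightarrow> 0 < r p"
      "\<And>p q f. p \<in> D \<Longrightarrow> q \<in> D \<Longrightarrow> chordal p q < r p \<Longrightarrow> f \<in> \<F> \<Longrightarrow> chordal (f q) (f p) < \<epsilon> / 3"
      by metis
    let ?\<U> = "(\<lambda>p. {q. chordal p q < r p}) ` K"
    have "K \<subseteq> \<Union>?\<U>" using r(1) K by (force simp: ext.mdist_zero)
    moreover have "openin ext_top U" if "U \<in> ?\<U>" for U using that openin_chordal_ball by auto
    ultimately obtain \<U> where "finite \<U>" "\<U> \<subseteq> ?\<U>" and cov: "K \<subseteq> \<Union>\<U>"
      using K unfolding compactin_def by meson
    then obtain P where P: "finite P" "P \<subseteq> K" "\<U> = (\<lambda>p. {q. chordal p q < r p}) ` P"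
      by (meson finite_subset_image)
    have "\<forall>p\<in>P. eventually (\<lambda>j. chordal (F (k j) p) (g p) < \<epsilon> / 3) sequentially"
    proof
      fix p assume "p \<in> P"
      then have "p \<in> D" using P K by blast
      then show "eventually (\<lambda>j. chordal (F (k j) p) (g p) < \<epsilon> / 3) sequentially"
        unfolding chordal_eq_dist_stereo using g \<open>0 < \<epsilon>\<close> by (intro tendstoD) auto
    qed
    then have "eventually (\<lambda>j. \<forall>p\<in>P. chordal (F (k j) p) (g p) < \<epsilon> / 3) sequentially"
      using P(1) by (simp add: eventually_ball_finite)
    then obtain N where N: "\<And>j p. j \<ge> N \<Longrightarrow> p \<in> P \<Longrightarrow> chordal (F (k j) p) (g p) < \<epsilon> / 3"
      unfolding eventually_sequentially by blast
    have "chordal (F (k j) q) (g q) < \<epsilon>" if j: "j \<ge> N" and q: "q \<in> K" for j q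
    proof -
      obtain p where p: "p \<in> P" "chordal p q < r p" using cov q P(3) by auto
      have D: "p \<in> D" "q \<in> D" using p P q K by auto
      have 1: "chordal (F (k j) q) (F (k j) p) < \<epsilon> / 3" using r(2)[OF D p(2) FF] .
      have 2: "chordal (F (k j) p) (g p) < \<epsilon> / 3" using N[OF j p(1)] .
      have 3: "chordal (g q) (g p) \<le> \<epsilon> / 3" using r(2)[OF D p(2)] by (intro g_close D)
      show ?thesis
        using 1 2 3 ext.triangle[of "F (k j) q" "F (k j) p" "g q"] ext.triangle[of "F (k j) p" "g p" "g q"]
          ext.commute[of "g q" "g p"] by simp
    qed
    then show "\<exists>N. \<forall>j\<ge>N. \<forall>p\<in>K. chordal (F (k j) p) (g p) < \<epsilon>" by blast
  qed
qed

section \<open>Equicontinuity\<close>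

lemma oscillation_less_of_weighted_bounds:
  fixes w :: "nat \<Rightarrow> real"
  assumes n: "2 \<le> CARD('n::finite)" and w: "\<And>k. 0 \<le> w k" "\<not> summable w"
    and r: "0 < r" and C: "0 \<le> C" and \<epsilon>: "0 < \<epsilon>" and \<Delta>: "0 < \<Delta>"
  shows "\<exists>r1. 0 < r1 \<and> r1 < r \<and> (\<forall>D (f :: 'n ext_space \<Rightarrow> 'n ext_space) Q x0 x.
    ring_homeo_at_finite D Q f x0 \<and> ennreal \<Delta> \<le> chordal_diam (- (f ` D)) \<and>
    Some ` cball x0 r \<subseteq> D \<and> ennreal r < boundary_dist D x0 \<and>
    (\<forall>k. (\<lambda>x. Q (Some x)) \<in> borel_measurable (restrict_space lebesgue (dyadic_annulus x0 r k))) \<and>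
    (\<forall>k. ennreal (w k ^ (CARD('n) - 1)) * (\<integral>\<^sup>+ x \<in> dyadic_annulus x0 r k. Q (Some x) \<partial>lebesgue)
       \<le> ennreal (C / (2 ^ k) ^ CARD('n))) \<and>
    x \<in> cball x0 r1 \<longrightarrow> chordal (f (Some x)) (f (Some x0)) < \<epsilon>)"
proof -
  let ?n = "CARD('n)"
  obtain \<delta> where \<delta>: "0 < \<delta>" and osc: "\<forall>D (f :: 'n ext_space \<Rightarrow> 'n ext_space) x0 r1 r2 x.
      homeo_into D f \<and> ennreal \<Delta> \<le> chordal_diam (- (f ` D)) \<and> Some ` cball x0 r2 \<subseteq> D \<and>
       0 < r1 \<and> r1 < r2 \<and> x \<in> cball x0 r1 \<and>
       modulus (image_curves f (joining_curves (Some ` sphere x0 r1) (Some ` sphere x0 r2)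
         (Some ` {x. r1 < dist x0 x \<and> dist x0 x < r2}))) < ennreal \<delta>
      \<longrightarrow> chordal (f (Some x)) (f (Some x0)) < \<epsilon>"
    using oscillation_less_of_small_modulus[OF n \<epsilon> \<Delta>] by blast
  define B where "B = C * (2 / r) ^ ?n"
  have B: "0 \<le> B" using C r by (simp add: B_def)
  obtain N where N: "max 1 (B / (\<delta> / 2)) < (\<Sum>k<N. w k)"
    using w summableI_nonneg_bounded[of w "max 1 (B / (\<delta> / 2))"] by (metis not_less)
  define S where "S = (\<Sum>k<N. w k)"
  have S: "1 \<le> S" "B / S \<le> \<delta> / 2" using N \<delta> by (auto simp: S_def[symmetric] field_simps)
  have "N \<noteq> 0" using S(1) by (intro notI) (simp add: S_def)
  define r1 where "r1 = r / 2 ^ N"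
  have "(1::real) < 2 ^ N" using \<open>N \<noteq> 0\<close> by (simp add: one_less_power)
  then have r1: "0 < r1" "r1 < r" using r by (auto simp: r1_def field_simps)
  show ?thesis
  proof (rule exI[of _ r1], intro conjI allI impI r1; elim conjE)
    fix D Q and f :: "'n ext_space \<Rightarrow> 'n ext_space" and x0 x
    assume ring: "ring_homeo_at_finite D Q f x0" and diam: "ennreal \<Delta> \<le> chordal_diam (- (f ` D))"
      and sub: "Some ` cball x0 r \<subseteq> D" and bd: "ennreal r < boundary_dist D x0"
      and Q: "\<forall>k. (\<lambda>x. Q (Some x)) \<in> borel_measurable (restrict_space lebesgue (dyadic_annulus x0 r k))"
      and le: "\<forall>k. ennreal (w k ^ (?n - 1)) * (\<integral>\<^sup>+ x \<in> dyadic_annulus x0 r k. Q (Some x) \<partial>lebesgue)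
       \<le> ennreal (C / (2 ^ k) ^ ?n)"
      and x: "x \<in> cball x0 r1"
    let ?\<eta> = "dyadic_density w r N" and ?R = "{x. r1 < dist x0 x \<and> dist x0 x < r}"
    have "?\<eta> \<in> borel_measurable lebesgue" by (rule measurable_completion) simp
    then have \<eta>: "?\<eta> \<in> borel_measurable (restrict_space lebesgue {r1<..<r})"
      by (rule measurable_restrict_space1)
    have "(\<integral>\<^sup>+ s \<in> {r1<..<r}. ?\<eta> s \<partial>lebesgue) = 1"
      unfolding r1_def using S(1) by (intro nn_integral_dyadic_density w r) (simp add: S_def[symmetric])
    then have "modulus (image_curves f (joining_curves (Some ` sphere x0 r1) (Some ` sphere x0 r) (Some ` ?R)))
        \<le> (\<integral>\<^sup>+ x \<in> ?R. Q (Some x) * ?\<eta> (norm (x - x0)) ^ ?n \<partial>lebesgue)"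
      using ring[unfolded ring_homeo_at_finite_def Let_def, THEN conjunct2, rule_format, of r1 r ?\<eta>] r1 bd \<eta>
      by simp
    also have "\<dots> \<le> ennreal (C * (2 / r) ^ ?n / (\<Sum>k<N. w k))"
      using S(1) Q le by (intro nn_integral_dyadic_density_power_le w r C n) (auto simp: S_def[symmetric])
    also have "\<dots> < ennreal \<delta>"
    proof (rule ennreal_lessI[OF \<delta>])
      have "B / S < \<delta>" using S(2) \<delta> by linarith
      then show "C * (2 / r) ^ ?n / (\<Sum>k<N. w k) < \<delta>" by (simp only: B_def S_def)
    qed
    finally show "chordal (f (Some x)) (f (Some x0)) < \<epsilon>"
      using ring diam sub r1 x
      by (intro osc[THEN spec, THEN spec, THEN spec, THEN spec, THEN spec, THEN spec, THEN mp])
         (auto simp: ring_homeo_at_finite_def)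
  qed
qed

lemma exists_cball_below_boundary_dist:
  fixes D :: "'n::finite ext_space set"
  assumes "openin ext_top D" "Some x0 \<in> D"
  obtains r where "0 < r" "Some ` cball x0 r \<subseteq> D" "ennreal r < boundary_dist D x0"
proof -
  have "open (finite_part D)" "x0 \<in> finite_part D"
    using assms by (auto simp: openin_ext_top_iff finite_part_def)
  then obtain e where e: "e > 0" "ball x0 e \<subseteq> finite_part D" using openE by blast
  have "ennreal e \<le> boundary_dist D x0"
    unfolding boundary_dist_def
  proof (rule INF_greatest)
    fix y assume "y \<in> finite_part (ext_top frontier_of D)"
    then have "Some y \<notin> D"
      using assms(1) by (simp add: finite_part_def frontier_of_def interior_of_openin)
    then have "y \<notin> ball x0 e" using e by (auto simp: finite_part_def)
    then show "ennreal e \<le> ennreal (dist x0 y)" by (auto intro: ennreal_leI)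
  qed
  moreover have "ennreal (e / 2) < ennreal e" using e by (simp add: ennreal_less_iff)
  moreover have "cball x0 (e / 2) \<subseteq> ball x0 e" using e by auto
  then have "Some ` cball x0 (e / 2) \<subseteq> D" using e by (auto simp: finite_part_def subset_iff)
  ultimately show ?thesis using that[of "e / 2"] e by simp
qed

lemma nn_integral_Phi_le:
  fixes A X :: "'a::euclidean_space set" and \<Phi> :: "ennreal \<Rightarrow> ennreal"
  assumes mono: "mono \<Phi>" and X: "X \<in> sets lebesgue" and A: "A \<subseteq> X"
    and Q: "Q \<in> borel_measurable (restrict_space lebesgue X)"
    and M: "(\<integral>\<^sup>+ x \<in> X. \<Phi> (Q x) / ennreal ((1 + (norm x)\<^sup>2) ^ n) \<partial>lebesgue) \<le> ennreal M" "0 \<le> M"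
    and c: "\<And>x. x \<in> A \<Longrightarrow> (1 + (norm x)\<^sup>2) ^ n \<le> c"
  shows "(\<integral>\<^sup>+ x \<in> A. \<Phi> (Q x) \<partial>lebesgue) \<le> ennreal (c * M)"
proof (cases "A = {}")
  case False
  then obtain a where "a \<in> A" by blast
  have "0 \<le> c" using c[OF \<open>a \<in> A\<close>] by (meson add_nonneg_nonneg order_trans zero_le_one zero_le_power zero_le_power2)
  note [measurable] = mono_imp_borel_measurable[OF mono]
  let ?g = "\<lambda>x. \<Phi> (Q x) / ennreal ((1 + (norm x)\<^sup>2) ^ n)"
  have "(\<lambda>x. \<Phi> (Q x)) \<in> borel_measurable (restrict_space lebesgue X)"
    using Q by measurable
  moreover have "(\<lambda>x::'a. ennreal ((1 + (norm x)\<^sup>2) ^ n)) \<in> borel_measurable (restrict_space lebesgue X)"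
    by (intro measurable_restrict_space1 measurable_completion) measurable
  ultimately have "?g \<in> borel_measurable (restrict_space lebesgue X)"
    by (rule borel_measurable_divide_ennreal)
  then have g: "(\<lambda>x. ?g x * indicator X x) \<in> borel_measurable lebesgue"
    using X by (subst (asm) borel_measurable_restrict_space_iff_ennreal) auto
  have "(\<integral>\<^sup>+ x \<in> A. \<Phi> (Q x) \<partial>lebesgue) \<le> (\<integral>\<^sup>+ x. ennreal c * (?g x * indicator X x) \<partial>lebesgue)"
  proof (rule nn_integral_mono)
    fix x
    show "\<Phi> (Q x) * indicator A x \<le> ennreal c * (?g x * indicator X x)"
    proof (cases "x \<in> A")
      case True
      define b where "b = (1 + (norm x)\<^sup>2) ^ n"
      have b: "0 < b" "b \<le> c" using c[OF True] by (auto simp: b_def add_pos_nonneg)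
      have "\<Phi> (Q x) = ennreal b * (\<Phi> (Q x) / ennreal b)"
        using b by (simp add: ennreal_times_divide mult.commute[of "ennreal b"] ennreal_mult_divide_eq)
      also have "\<dots> \<le> ennreal c * (\<Phi> (Q x) / ennreal b)"
        using b by (intro mult_right_mono ennreal_leI) auto
      finally show ?thesis using True A by (auto simp: b_def)
    qed simp
  qed
  also have "\<dots> = ennreal c * (\<integral>\<^sup>+ x \<in> X. ?g x \<partial>lebesgue)" by (rule nn_integral_cmult[OF g])
  also have "\<dots> \<le> ennreal c * ennreal M" by (intro mult_left_mono M) simp
  also have "\<dots> = ennreal (c * M)" using \<open>0 \<le> c\<close> M(2) by (simp add: ennreal_mult)
  finally show ?thesis .
qed simp

lemma weighted_nn_integral_subset_le:
  fixes A X :: "'a::euclidean_space set" and \<Phi> :: "ennreal \<Rightarrow> ennreal"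
  assumes mono: "mono \<Phi>" and conv: "convex_ennreal \<Phi>" and n: "2 \<le> n"
    and X: "X \<in> sets lebesgue" and A: "A \<subseteq> X" "A \<in> sets lebesgue"
    and Q: "Q \<in> borel_measurable (restrict_space lebesgue X)"
    and M: "(\<integral>\<^sup>+ x \<in> X. \<Phi> (Q x) / ennreal ((1 + (norm x)\<^sup>2) ^ n) \<partial>lebesgue) \<le> ennreal M" "0 \<le> M"
    and c: "\<And>x. x \<in> A \<Longrightarrow> (1 + (norm x)\<^sup>2) ^ n \<le> c" "0 \<le> c"
    and \<tau>: "0 < \<tau>" "2 * \<Phi> 0 \<le> ennreal \<tau>" and R: "A \<subseteq> ball x0 R" "0 < R"
  shows "ennreal (dyadic_weight \<Phi> (1 / (real n - 1)) \<tau> ^ (n - 1)) * (\<integral>\<^sup>+ x \<in> A. Q x \<partial>lebesgue)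
    \<le> ennreal (unit_ball_vol DIM('a) * R ^ DIM('a) + 2 * (c * M) / \<tau>)"
proof -
  let ?N = "restrict_space lebesgue A"
  have "ennreal (dyadic_weight \<Phi> (1 / (real n - 1)) \<tau> ^ (n - 1)) * (\<integral>\<^sup>+ x. Q x \<partial>?N)
    \<le> ennreal (unit_ball_vol DIM('a) * R ^ DIM('a) + 2 * (c * M) / \<tau>)"
  proof (rule dyadic_weight_nn_integral_le[OF mono conv n])
    show "Q \<in> borel_measurable ?N" using measurable_restrict_mono[OF Q A(1)] .
    have "emeasure ?N (space ?N) = emeasure lebesgue A"
      using A(2) by (simp add: space_restrict_space emeasure_restrict_space)
    also have "\<dots> \<le> emeasure lebesgue (ball x0 R)" by (intro emeasure_mono R) simp
    also have "\<dots> = ennreal (unit_ball_vol DIM('a) * R ^ DIM('a))" using R(2) by (simp add: emeasure_ball)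
    finally show "emeasure ?N (space ?N) \<le> ennreal (unit_ball_vol DIM('a) * R ^ DIM('a))" .
    show "(\<integral>\<^sup>+ x. \<Phi> (Q x) \<partial>?N) \<le> ennreal (c * M)"
      using nn_integral_Phi_le[OF mono X A(1) Q M c(1)] A(2) by (simp add: nn_integral_restrict_space)
  qed (use \<tau> R c M in auto)
  then show ?thesis using A(2) by (simp add: nn_integral_restrict_space)
qed

lemma dyadic_annulus_subset_ball:
  assumes "0 < r"
  shows "dyadic_annulus x0 r k \<subseteq> ball x0 (r / 2 ^ k)" "dyadic_annulus x0 r k \<subseteq> ball x0 r"
proof -
  show "dyadic_annulus x0 r k \<subseteq> ball x0 (r / 2 ^ k)" by (auto simp: dyadic_annulus_def)
  also have "r / 2 ^ k \<le> r / 1" using assms by (intro divide_left_mono) auto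
  then have "ball x0 (r / 2 ^ k) \<subseteq> ball x0 r" by (intro subset_ball) simp
  finally show "dyadic_annulus x0 r k \<subseteq> ball x0 r" .
qed

lemma vec_inv_image_annulus:
  fixes r :: real
  assumes "0 < r"
  shows "vec_inv ` {y :: 'a::euclidean_space. 2 ^ k / r < norm y \<and> norm y < 2 ^ Suc k / r} = dyadic_annulus 0 r k"
proof -
  have iff: "2 ^ k / r < norm y \<and> norm y < 2 ^ Suc k / r \<longleftrightarrow> vec_inv y \<in> dyadic_annulus 0 r k" for y :: 'a
  proof (cases "y = 0")
    case True
    then show ?thesis using assms by (auto simp: dyadic_annulus_def vec_inv_def divide_less_0_iff)
  next
    case False
    then show ?thesis using assms by (auto simp: dyadic_annulus_def norm_vec_inv field_simps)
  qed
  show ?thesis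
  proof (intro equalityI subsetI)
    fix x :: 'a assume "x \<in> dyadic_annulus 0 r k"
    then have "vec_inv x \<in> {y. 2 ^ k / r < norm y \<and> norm y < 2 ^ Suc k / r}" using iff[of "vec_inv x"] by simp
    then show "x \<in> vec_inv ` {y. 2 ^ k / r < norm y \<and> norm y < 2 ^ Suc k / r}"
      by (rule rev_image_eqI) simp
  qed (use iff in auto)
qed

lemma weighted_bound_at_finite_point:
  fixes x0 :: "real ^ 'n::finite" and \<Phi> :: "ennreal \<Rightarrow> ennreal"
  defines "n \<equiv> CARD('n)"
  assumes mono: "mono \<Phi>" and conv: "convex_ennreal \<Phi>" and n: "2 \<le> n"
    and X: "X \<in> sets lebesgue" "ball x0 r \<subseteq> X" and r: "0 < r"
    and Q: "Q \<in> borel_measurable (restrict_space lebesgue X)"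
    and M: "(\<integral>\<^sup>+ x \<in> X. \<Phi> (Q x) / ennreal ((1 + (norm x)\<^sup>2) ^ n) \<partial>lebesgue) \<le> ennreal M" "0 \<le> M"
    and \<tau>0: "0 < \<tau>0" "2 * \<Phi> 0 \<le> ennreal \<tau>0"
  shows "ennreal (dyadic_weight \<Phi> (1 / (real n - 1)) (\<tau>0 * (2 ^ n) ^ k) ^ (n - 1))
      * (\<integral>\<^sup>+ x \<in> dyadic_annulus x0 r k. Q x \<partial>lebesgue)
    \<le> ennreal ((unit_ball_vol n * r ^ n + 2 * ((1 + (norm x0 + r)\<^sup>2) ^ n * M) / \<tau>0) / (2 ^ k) ^ n)"
proof -
  let ?c = "(1 + (norm x0 + r)\<^sup>2) ^ n"
  have "ennreal \<tau>0 \<le> ennreal (\<tau>0 * (2 ^ n) ^ k)"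
    using \<tau>0(1) by (intro ennreal_leI) (simp add: one_le_power)
  then have \<tau>: "0 < \<tau>0 * (2 ^ n) ^ k" "2 * \<Phi> 0 \<le> ennreal (\<tau>0 * (2 ^ n) ^ k)"
    using \<tau>0 by (auto intro: order_trans)
  have "ennreal (dyadic_weight \<Phi> (1 / (real n - 1)) (\<tau>0 * (2 ^ n) ^ k) ^ (n - 1))
      * (\<integral>\<^sup>+ x \<in> dyadic_annulus x0 r k. Q x \<partial>lebesgue)
    \<le> ennreal (unit_ball_vol DIM(real ^ 'n) * (r / 2 ^ k) ^ DIM(real ^ 'n) + 2 * (?c * M) / (\<tau>0 * (2 ^ n) ^ k))"
  proof (rule weighted_nn_integral_subset_le[OF mono conv n X(1) _ _ Q M _ _ \<tau>])
    show "dyadic_annulus x0 r k \<subseteq> X" using dyadic_annulus_subset_ball(2)[OF r, of x0 k] X(2) by auto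
    show "dyadic_annulus x0 r k \<in> sets lebesgue" using open_dyadic_annulus[of x0 r k] by auto
    show "dyadic_annulus x0 r k \<subseteq> ball x0 (r / 2 ^ k)" by (rule dyadic_annulus_subset_ball[OF r])
    show "0 \<le> ?c" by simp
    show "0 < r / 2 ^ k" using r by simp
    fix x assume "x \<in> dyadic_annulus x0 r k"
    then have "norm (x - x0) < r"
      using dyadic_annulus_subset_ball(2)[OF r, of x0 k] by (auto simp: dist_norm norm_minus_commute)
    then have "norm x \<le> norm x0 + r" using norm_triangle_sub[of x x0] by simp
    then show "(1 + (norm x)\<^sup>2) ^ n \<le> ?c" by (intro power_mono add_left_mono) auto
  qed
  also have "unit_ball_vol DIM(real ^ 'n) * (r / 2 ^ k) ^ DIM(real ^ 'n) + 2 * (?c * M) / (\<tau>0 * (2 ^ n) ^ k)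
      = (unit_ball_vol n * r ^ n + 2 * (?c * M) / \<tau>0) / (2 ^ k) ^ n"
    by (simp add: n_def power_divide add_divide_distrib power_mult[symmetric] mult.commute)
  finally show ?thesis .
qed

lemma weighted_bound_at_infinity:
  fixes X :: "(real ^ 'n::finite) set" and \<Phi> :: "ennreal \<Rightarrow> ennreal"
  defines "n \<equiv> CARD('n)"
  assumes mono: "mono \<Phi>" and conv: "convex_ennreal \<Phi>" and n: "2 \<le> n"
    and X: "X \<in> sets lebesgue" "\<And>x. 0 < norm x \<Longrightarrow> norm x < r \<Longrightarrow> vec_inv x \<in> X" and r: "0 < r"
    and Q: "Q \<in> borel_measurable (restrict_space lebesgue X)"
    and M: "(\<integral>\<^sup>+ x \<in> X. \<Phi> (Q x) / ennreal ((1 + (norm x)\<^sup>2) ^ n) \<partial>lebesgue) \<le> ennreal M" "0 \<le> M"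
    and \<tau>0: "0 < \<tau>0" "2 * \<Phi> 0 \<le> ennreal \<tau>0"
  shows "(\<lambda>x. Q (vec_inv x)) \<in> borel_measurable (restrict_space lebesgue (dyadic_annulus 0 r k))"
    and "ennreal (dyadic_weight \<Phi> (1 / (real n - 1)) (\<tau>0 * (2 ^ n) ^ k) ^ (n - 1))
      * (\<integral>\<^sup>+ x \<in> dyadic_annulus 0 r k. Q (vec_inv x) \<partial>lebesgue)
    \<le> ennreal ((10 ^ n * (unit_ball_vol n * (2 * r) ^ n + 2 * ((r\<^sup>2 + 4) ^ n * M) / \<tau>0)) / (2 ^ k) ^ n)"
proof -
  define B where "B = {y :: real ^ 'n. 2 ^ k / r < norm y \<and> norm y < 2 ^ Suc k / r}"
  have img: "vec_inv ` B = dyadic_annulus 0 r k" unfolding B_def by (rule vec_inv_image_annulus[OF r])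
  have "open B" unfolding B_def by (intro open_Collect_conj open_Collect_less continuous_intros)
  then have B: "B \<in> sets lebesgue" by auto
  have B0: "0 \<notin> B" using r by (simp add: B_def not_less)
  have BX: "B \<subseteq> X"
  proof
    fix y assume "y \<in> B"
    then have "y \<noteq> 0" "vec_inv y \<in> dyadic_annulus 0 r k" unfolding img[symmetric] using B0 by auto
    moreover then have "vec_inv y \<in> ball 0 r" using dyadic_annulus_subset_ball(2)[OF r] by blast
    ultimately show "y \<in> X" using X(2)[of "vec_inv y"] by (simp add: norm_vec_inv)
  qed
  have QB: "Q \<in> borel_measurable (restrict_space lebesgue B)" using measurable_restrict_mono[OF Q BX] .
  show "(\<lambda>x. Q (vec_inv x)) \<in> borel_measurable (restrict_space lebesgue (dyadic_annulus 0 r k))"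
    using measurable_compose[OF measurable_vec_inv[OF B B0] QB] by (simp only: img)
  let ?w = "ennreal (dyadic_weight \<Phi> (1 / (real n - 1)) (\<tau>0 * (2 ^ n) ^ k) ^ (n - 1))"
  let ?\<tau> = "\<tau>0 * (2 ^ n) ^ k" and ?R = "2 ^ Suc k / r" and ?L = "(10 / (2 ^ k / r)\<^sup>2) ^ n"
  have "ennreal \<tau>0 \<le> ennreal ?\<tau>"
    using \<tau>0(1) by (intro ennreal_leI) (simp add: one_le_power)
  then have \<tau>: "0 < ?\<tau>" "2 * \<Phi> 0 \<le> ennreal ?\<tau>"
    using \<tau>0 by (auto intro: order_trans)
  have wB: "?w * (\<integral>\<^sup>+ y \<in> B. Q y \<partial>lebesgue)
      \<le> ennreal (unit_ball_vol DIM(real ^ 'n) * ?R ^ DIM(real ^ 'n) + 2 * ((1 + ?R\<^sup>2) ^ n * M) / ?\<tau>)"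
  proof (rule weighted_nn_integral_subset_le[OF mono conv n X(1) BX B Q M _ _ \<tau>])
    show "B \<subseteq> ball 0 ?R" by (auto simp: B_def)
    show "0 < ?R" using r by simp
    show "0 \<le> (1 + ?R\<^sup>2) ^ n" by simp
    show "(1 + (norm y)\<^sup>2) ^ n \<le> (1 + ?R\<^sup>2) ^ n" if "y \<in> B" for y
      using that by (intro power_mono add_left_mono) (auto simp: B_def)
  qed
  have "?w * (\<integral>\<^sup>+ x \<in> vec_inv ` B. Q (vec_inv x) \<partial>lebesgue) \<le> ?w * (ennreal ?L * (\<integral>\<^sup>+ y \<in> B. Q y \<partial>lebesgue))"
    using nn_integral_vec_inv_le[OF B _ _ QB, of "2 ^ k / r"] r
    by (intro mult_left_mono) (auto simp: B_def n_def)
  also have "\<dots> = ennreal ?L * (?w * (\<integral>\<^sup>+ y \<in> B. Q y \<partial>lebesgue))" by (simp add: mult.left_commute)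
  also have "\<dots> \<le> ennreal ?L * ennreal (unit_ball_vol n * ?R ^ n + 2 * ((1 + ?R\<^sup>2) ^ n * M) / ?\<tau>)"
    using wB by (intro mult_left_mono) (simp_all add: n_def)
  also have "\<dots> = ennreal (?L * (unit_ball_vol n * ?R ^ n + 2 * ((1 + ?R\<^sup>2) ^ n * M) / ?\<tau>))"
    using r \<tau>(1) M(2) by (intro ennreal_mult[symmetric]) (auto intro!: add_nonneg_nonneg divide_nonneg_pos mult_nonneg_nonneg)
  also have "?L * (unit_ball_vol n * ?R ^ n + 2 * ((1 + ?R\<^sup>2) ^ n * M) / ?\<tau>)
      \<le> 10 ^ n * (unit_ball_vol n * (2 * r) ^ n + 2 * ((r\<^sup>2 + 4) ^ n * M) / \<tau>0) / (2 ^ k) ^ n"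
  proof -
    define t where "t = (2::real) ^ k"
    have t: "1 \<le> t" by (simp add: t_def)
    have \<tau>t: "?\<tau> = \<tau>0 * t ^ n" by (simp add: t_def power_mult[symmetric] mult.commute)
    have L: "?L = 10 ^ n * (r\<^sup>2 / t\<^sup>2) ^ n"
      by (simp add: t_def power_divide power_mult_distrib)
    have 1: "(r\<^sup>2 / t\<^sup>2) ^ n * ?R ^ n = (2 * r) ^ n / t ^ n"
    proof -
      have "r\<^sup>2 / t\<^sup>2 * ?R = 2 * r / t" using r t by (simp add: t_def[symmetric] power2_eq_square)
      then show ?thesis by (metis power_mult_distrib power_divide)
    qed
    have 2: "(r\<^sup>2 / t\<^sup>2) ^ n * (1 + ?R\<^sup>2) ^ n \<le> (r\<^sup>2 + 4) ^ n"
    proof -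
      have "r\<^sup>2 / t\<^sup>2 * (1 + ?R\<^sup>2) = r\<^sup>2 / t\<^sup>2 + 4"
        using r t by (simp add: t_def[symmetric] field_simps power2_eq_square)
      also have "\<dots> \<le> r\<^sup>2 / 1 + 4" using t by (intro add_right_mono divide_left_mono) (auto simp: one_le_power)
      finally have "(r\<^sup>2 / t\<^sup>2 * (1 + ?R\<^sup>2)) ^ n \<le> (r\<^sup>2 + 4) ^ n" by (intro power_mono) auto
      then show ?thesis by (simp only: power_mult_distrib)
    qed
    have "?L * (unit_ball_vol n * ?R ^ n + 2 * ((1 + ?R\<^sup>2) ^ n * M) / ?\<tau>)
        = 10 ^ n * (unit_ball_vol n * ((r\<^sup>2 / t\<^sup>2) ^ n * ?R ^ n)
          + 2 * (((r\<^sup>2 / t\<^sup>2) ^ n * (1 + ?R\<^sup>2) ^ n) * M) / (\<tau>0 * t ^ n))"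
      unfolding L \<tau>t by (simp add: algebra_simps)
    also have "\<dots> \<le> 10 ^ n * (unit_ball_vol n * ((2 * r) ^ n / t ^ n) + 2 * ((r\<^sup>2 + 4) ^ n * M) / (\<tau>0 * t ^ n))"
      unfolding 1 using 2 M(2) \<tau>0(1) t
      by (intro mult_left_mono add_left_mono divide_right_mono mult_right_mono) auto
    also have "\<dots> = 10 ^ n * (unit_ball_vol n * (2 * r) ^ n + 2 * ((r\<^sup>2 + 4) ^ n * M) / \<tau>0) / t ^ n"
      by (simp add: add_divide_distrib distrib_left)
    finally show ?thesis by (simp only: t_def)
  qed
  finally show "?w * (\<integral>\<^sup>+ x \<in> dyadic_annulus 0 r k. Q (vec_inv x) \<partial>lebesgue)
    \<le> ennreal ((10 ^ n * (unit_ball_vol n * (2 * r) ^ n + 2 * ((r\<^sup>2 + 4) ^ n * M) / \<tau>0)) / (2 ^ k) ^ n)"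
    by (simp add: img ennreal_leI)
qed

theorem theorem4p1:
  fixes D :: "'n::finite ext_space set" and \<Phi> :: "ennreal \<Rightarrow> ennreal"
  assumes "2 \<le> CARD('n)"
    and "ext_domain D"
    and "mono \<Phi>" and "convex_ennreal \<Phi>"
    and "\<exists>\<delta>0::real. \<Phi> 0 < ennreal \<delta>0 \<and>
      (\<integral>\<^sup>+ \<tau> \<in> {\<delta>0..}. 1 / (ennreal \<tau> * ennreal_rpow (gen_inverse \<Phi> (ennreal \<tau>)) (1 / (real CARD('n) - 1)))
        \<partial>lborel) = \<infinity>"
  shows "\<forall>M \<Delta>::real. 0 < M \<and> 0 < \<Delta> \<and> \<Delta> < 1 \<longrightarrow>
    equicontinuous_family D (ring_homeo_class D \<Phi> M \<Delta>) \<and> normal_family D (ring_homeo_class D \<Phi> M \<Delta>)"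
proof (intro allI impI; elim conjE)
  fix M \<Delta> :: real assume M: "0 < M" and \<Delta>: "0 < \<Delta>"
  let ?n = "CARD('n)" and ?p = "1 / (real CARD('n) - 1)" and ?\<F> = "ring_homeo_class D \<Phi> M \<Delta>"
  note n = assms(1) and mono = assms(3) and conv = assms(4)
  have D: "openin ext_top D" using assms(2) by (simp add: ext_domain_def)
  have X: "finite_part D \<in> sets lebesgue"
    using D by (simp add: openin_ext_top_iff)
  obtain \<delta>0 where \<delta>0: "\<Phi> 0 < ennreal \<delta>0"
    "(\<integral>\<^sup>+ \<tau> \<in> {\<delta>0..}. 1 / (ennreal \<tau> * ennreal_rpow (gen_inverse \<Phi> (ennreal \<tau>)) ?p) \<partial>lborel) = \<infinity>"
    using assms(5) by blast
  obtain a where a: "\<Phi> 0 = ennreal a" "0 \<le> a" using \<delta>0(1) by (cases "\<Phi> 0") auto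
  define \<tau>0 where "\<tau>0 = 2 * a + 1"
  have "2 * \<Phi> 0 = ennreal (2 * a)" using a by (simp add: ennreal_mult)
  then have \<tau>0: "0 < \<tau>0" "2 * \<Phi> 0 \<le> ennreal \<tau>0" using a by (auto simp: \<tau>0_def intro: ennreal_leI)
  define w where "w k = dyadic_weight \<Phi> ?p (\<tau>0 * (2 ^ ?n) ^ k)" for k
  have w: "\<And>k. 0 \<le> w k" "\<not> summable w"
  proof -
    show "0 \<le> w k" for k by (simp add: w_def dyadic_weight_nonneg)
    have "(1::real) < 2 ^ ?n" using n by (intro one_less_power) auto
    then show "\<not> summable w"
      unfolding w_def using n by (intro dyadic_weight_not_summable[OF mono conv _ \<delta>0 \<tau>0(1)]) auto
  qed
  have class_D: "\<exists>Q. ring_homeo D Q f \<and> (\<lambda>x. Q (Some x)) \<in> borel_measurable (restrict_space lebesgue (finite_part D)) \<and>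
      (\<integral>\<^sup>+ x \<in> finite_part D. \<Phi> (Q (Some x)) / ennreal ((1 + (norm x)\<^sup>2) ^ ?n) \<partial>lebesgue) \<le> ennreal M"
    and class_diam: "ennreal \<Delta> \<le> chordal_diam (- (f ` D))"
    and class_homeo: "homeo_into D f" if "f \<in> ?\<F>" for f
    using that unfolding ring_homeo_class_def measurable_on_domain_def by blast+
  have "equicontinuous_family D ?\<F>"
    unfolding equicontinuous_family_def
  proof (intro ballI allI impI)
    fix p and \<epsilon> :: real assume p: "p \<in> D" and \<epsilon>: "0 < \<epsilon>"
    show "\<exists>U. openin (subtopology ext_top D) U \<and> p \<in> U \<and> (\<forall>q\<in>U. \<forall>f\<in>?\<F>. chordal (f q) (f p) < \<epsilon>)"
    proof (cases p)
      case (Some x0)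
      obtain r where r: "0 < r" "Some ` cball x0 r \<subseteq> D" "ennreal r < boundary_dist D x0"
        using exists_cball_below_boundary_dist[OF D] p Some by metis
      have rX: "ball x0 r \<subseteq> finite_part D" using r(2) by (auto simp: finite_part_def)
      define C where "C = unit_ball_vol ?n * r ^ ?n + 2 * ((1 + (norm x0 + r)\<^sup>2) ^ ?n * M) / \<tau>0"
      have C: "0 \<le> C" using r(1) M \<tau>0(1) by (simp add: C_def)
      obtain r1 where r1: "0 < r1" "r1 < r" and osc: "\<forall>D (f :: 'n ext_space \<Rightarrow> 'n ext_space) Q x0 x.
        ring_homeo_at_finite D Q f x0 \<and> ennreal \<Delta> \<le> chordal_diam (- (f ` D)) \<and>
        Some ` cball x0 r \<subseteq> D \<and> ennreal r < boundary_dist D x0 \<and>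
        (\<forall>k. (\<lambda>x. Q (Some x)) \<in> borel_measurable (restrict_space lebesgue (dyadic_annulus x0 r k))) \<and>
        (\<forall>k. ennreal (w k ^ (?n - 1)) * (\<integral>\<^sup>+ x \<in> dyadic_annulus x0 r k. Q (Some x) \<partial>lebesgue)
           \<le> ennreal (C / (2 ^ k) ^ ?n)) \<and>
        x \<in> cball x0 r1 \<longrightarrow> chordal (f (Some x)) (f (Some x0)) < \<epsilon>"
        using oscillation_less_of_weighted_bounds[OF n w r(1) C \<epsilon> \<Delta>] by blast
      have "chordal (f (Some x)) (f p) < \<epsilon>" if x: "x \<in> ball x0 r1" and f: "f \<in> ?\<F>" for x f
      proof -
        obtain Q where Q: "ring_homeo D Q f"
          "(\<lambda>x. Q (Some x)) \<in> borel_measurable (restrict_space lebesgue (finite_part D))"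
          "(\<integral>\<^sup>+ x \<in> finite_part D. \<Phi> (Q (Some x)) / ennreal ((1 + (norm x)\<^sup>2) ^ ?n) \<partial>lebesgue) \<le> ennreal M"
          using class_D[OF f] by blast
        have ring: "ring_homeo_at_finite D Q f x0"
          using Q(1) p Some by (auto simp: ring_homeo_def ring_homeo_at_def)
        have "chordal (f (Some x)) (f (Some x0)) < \<epsilon>"
        proof (intro osc[THEN spec, THEN spec, THEN spec, THEN spec, THEN spec, THEN mp, of D Q f x0 x] conjI allI)
          fix k
          show "(\<lambda>x. Q (Some x)) \<in> borel_measurable (restrict_space lebesgue (dyadic_annulus x0 r k))"
            by (rule measurable_restrict_mono[OF Q(2)]) (use dyadic_annulus_subset_ball(2)[OF r(1)] rX in blast)
          show "ennreal (w k ^ (?n - 1)) * (\<integral>\<^sup>+ x \<in> dyadic_annulus x0 r k. Q (Some x) \<partial>lebesgue)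
              \<le> ennreal (C / (2 ^ k) ^ ?n)"
            unfolding w_def C_def
            by (rule weighted_bound_at_finite_point[OF mono conv n X rX r(1) Q(2,3) _ \<tau>0]) (use M in simp)
        qed (use ring class_diam[OF f] r x in auto)
        then show ?thesis using Some by simp
      qed
      moreover have "Some ` ball x0 r1 \<subseteq> D"
      proof -
        have "ball x0 r1 \<subseteq> cball x0 r" using r1 by auto
        then show ?thesis using r(2) by (meson image_mono order_trans)
      qed
      moreover have "openin ext_top (Some ` ball x0 r1)" by simp
      ultimately show ?thesis
        using r1 Some by (intro exI[of _ "Some ` ball x0 r1"]) (auto simp: openin_open_subtopology[OF D])
    next
      case None
      let ?D = "inversion ` D"
      have D': "openin ext_top ?D"
        using homeomorphic_maps_inversion D homeomorphic_map_openness_eq homeomorphic_map_maps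
        by (metis homeomorphic_maps_map)
      have "Some 0 \<in> ?D" using p None by (metis imageI inversion_simps(1))
      then obtain r where r: "0 < r" "Some ` cball 0 r \<subseteq> ?D" "ennreal r < boundary_dist ?D 0"
        using exists_cball_below_boundary_dist[OF D'] by metis
      have rX: "vec_inv x \<in> finite_part D" if "0 < norm x" "norm x < r" for x
      proof -
        have "Some x \<in> ?D" using that r(2) by auto
        then obtain q where "q \<in> D" "Some x = inversion q" by blast
        then have "inversion (Some x) \<in> D" by simp
        then show ?thesis using that by (simp add: finite_part_def vec_inv_def)
      qed
      define C where "C = 10 ^ ?n * (unit_ball_vol ?n * (2 * r) ^ ?n + 2 * ((r\<^sup>2 + 4) ^ ?n * M) / \<tau>0)"
      have C: "0 \<le> C" using r(1) M \<tau>0(1) by (simp add: C_def)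
      obtain r1 where r1: "0 < r1" "r1 < r" and osc: "\<forall>D (f :: 'n ext_space \<Rightarrow> 'n ext_space) Q x0 x.
        ring_homeo_at_finite D Q f x0 \<and> ennreal \<Delta> \<le> chordal_diam (- (f ` D)) \<and>
        Some ` cball x0 r \<subseteq> D \<and> ennreal r < boundary_dist D x0 \<and>
        (\<forall>k. (\<lambda>x. Q (Some x)) \<in> borel_measurable (restrict_space lebesgue (dyadic_annulus x0 r k))) \<and>
        (\<forall>k. ennreal (w k ^ (?n - 1)) * (\<integral>\<^sup>+ x \<in> dyadic_annulus x0 r k. Q (Some x) \<partial>lebesgue)
           \<le> ennreal (C / (2 ^ k) ^ ?n)) \<and>
        x \<in> cball x0 r1 \<longrightarrow> chordal (f (Some x)) (f (Some x0)) < \<epsilon>"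
        using oscillation_less_of_weighted_bounds[OF n w r(1) C \<epsilon> \<Delta>] by blast
      have close: "chordal (f (inversion (Some x))) (f p) < \<epsilon>" if x: "x \<in> ball 0 r1" and f: "f \<in> ?\<F>" for x f
      proof -
        obtain Q where Q: "ring_homeo D Q f"
          "(\<lambda>x. Q (Some x)) \<in> borel_measurable (restrict_space lebesgue (finite_part D))"
          "(\<integral>\<^sup>+ x \<in> finite_part D. \<Phi> (Q (Some x)) / ennreal ((1 + (norm x)\<^sup>2) ^ ?n) \<partial>lebesgue) \<le> ennreal M"
          using class_D[OF f] by blast
        have ring: "ring_homeo_at_finite ?D (Q \<circ> inversion) (f \<circ> inversion) 0"
          using Q(1) p None by (auto simp: ring_homeo_def ring_homeo_at_def)
        have img: "(f \<circ> inversion) ` ?D = f ` D" by (simp add: image_image)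
        have nz: "x \<noteq> 0" if "x \<in> dyadic_annulus (0 :: real ^ 'n) r k" for x k
          using that r(1) by (auto simp: dyadic_annulus_def divide_less_0_iff)
        note bound = weighted_bound_at_infinity[OF mono conv n X rX r(1) Q(2,3) less_imp_le[OF M] \<tau>0]
        have "chordal ((f \<circ> inversion) (Some x)) ((f \<circ> inversion) (Some 0)) < \<epsilon>"
        proof (intro osc[THEN spec, THEN spec, THEN spec, THEN spec, THEN spec, THEN mp,
              of ?D "Q \<circ> inversion" "f \<circ> inversion" 0 x] conjI allI)
          fix k
          have "(\<lambda>x. (Q \<circ> inversion) (Some x)) \<in> borel_measurable (restrict_space lebesgue (dyadic_annulus 0 r k))
              \<longleftrightarrow> (\<lambda>x. Q (Some (vec_inv x))) \<in> borel_measurable (restrict_space lebesgue (dyadic_annulus 0 r k))"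
            by (intro measurable_cong) (simp add: space_restrict_space vec_inv_def nz)
          then show "(\<lambda>x. (Q \<circ> inversion) (Some x)) \<in> borel_measurable (restrict_space lebesgue (dyadic_annulus 0 r k))"
            using bound(1) by simp
          have "(\<integral>\<^sup>+ x \<in> dyadic_annulus 0 r k. (Q \<circ> inversion) (Some x) \<partial>lebesgue)
              = (\<integral>\<^sup>+ x \<in> dyadic_annulus 0 r k. Q (Some (vec_inv x)) \<partial>lebesgue)"
          proof (rule nn_integral_cong)
            fix x :: "real ^ 'n"
            show "(Q \<circ> inversion) (Some x) * indicator (dyadic_annulus 0 r k) x
                = Q (Some (vec_inv x)) * indicator (dyadic_annulus 0 r k) x"
              by (cases "x \<in> dyadic_annulus 0 r k") (simp_all add: vec_inv_def nz)
          qed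
          then show "ennreal (w k ^ (?n - 1)) * (\<integral>\<^sup>+ x \<in> dyadic_annulus 0 r k. (Q \<circ> inversion) (Some x) \<partial>lebesgue)
              \<le> ennreal (C / (2 ^ k) ^ ?n)"
            using bound(2)[of k] by (simp only: w_def C_def)
        qed (use ring class_diam[OF f] r x img in auto)
        then show ?thesis using None by simp
      qed
      let ?U = "inversion ` Some ` ball (0 :: real ^ 'n) r1"
      have "?U \<subseteq> D"
      proof
        fix q assume "q \<in> ?U"
        then obtain x where x: "x \<in> ball 0 r1" "q = inversion (Some x)" by blast
        then have "Some x \<in> ?D" using r(2) r1 by auto
        then show "q \<in> D" using x by auto
      qed
      moreover have "openin ext_top ?U"
        using homeomorphic_maps_inversion homeomorphic_map_openness_eq
        by (metis homeomorphic_maps_map openin_Some_image open_ball)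
      moreover have "p \<in> ?U" using None r1 by (auto simp: image_iff intro!: bexI[of _ 0])
      ultimately show ?thesis
        using close by (intro exI[of _ ?U]) (auto simp: openin_open_subtopology[OF D])
    qed
  qed
  moreover from this have "normal_family D ?\<F>"
    by (rule equicontinuous_imp_normal_family) (use class_homeo homeo_intoD(1) in blast)
  ultimately show "equicontinuous_family D ?\<F> \<and> normal_family D ?\<F>" ..
qed

end
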